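(* Let $\boldsymbol\alpha\in\mathbb C^d$. Then ${\rm Ann}(L(\boldsymbol\alpha))=0$ if and only if the equivalence class $[\boldsymbol\alpha]$ is extreme and $\mathbb R_{>0}(\boldsymbol\alpha)$ is nonempty.
   Context: $A\subset\mathbb Z^d$ is a finite set generating the group $\mathbb Z^d$; $\mathbb NA$ its monoid; $R_A=\mathbb C[\mathbb NA]\subseteq\mathbb C[t_1^{\pm1},\dots,t_d^{\pm1}]$; $D(R_A)=\{P\in\mathbb C[t^{\pm1}]\langle\partial_1,\dots,\partial_d\rangle:P(R_A)\subseteq R_A\}$; $s_j=t_j\partial_j$. $L(\boldsymbol\alpha)$ is the unique simple quotient of $M(\boldsymbol\alpha)=D(R_A)/\sum_iD(R_A)(s_i-\alpha_i)$ in the category of left $D(R_A)$-modules that are direct sums of finite-dimensional weight spaces $\{x:f(s)x=f(\boldsymbol\lambda)x\ \forall f\in\mathbb C[s]\}$. For a face $\tau$ of $\mathbb R_{\ge0}A$, $E_\tau(\boldsymbol\alpha)=\{\boldsymbol\lambda\in\mathbb C(A\cap\tau)/\mathbb Z(A\cap\tau):\boldsymbol\alpha-\boldsymbol\lambda\in\mathbb NA+\mathbb Z(A\cap\tau)\}$, called full if it has $[\mathbb Q(A\cap\tau)\cap\mathbb Z^d:\mathbb Z(A\cap\tau)]$ elements; $\boldsymbol\alpha\sim\boldsymbol\beta$ iff $E_\tau(\boldsymbol\alpha)=E_\tau(\boldsymbol\beta)$ for all faces $\tau$, $[\boldsymbol\alpha]$ the class. For a facet $\sigma$, $F_\sigma$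 is the unique linear form (extended $\mathbb C$-linearly) with $F_\sigma(\mathbb R_{\ge0}A)\ge0$, $F_\sigma(\sigma)=0$, $F_\sigma(\mathbb Z^d)=\mathbb Z$. $\mathcal F_+(\boldsymbol\alpha)=\{\sigma:F_\sigma(\boldsymbol\alpha)\in F_\sigma(\mathbb NA)\}$, $\mathcal F_-(\boldsymbol\alpha)=\{\sigma:F_\sigma(\boldsymbol\alpha)\in\mathbb Z\setminus F_\sigma(\mathbb NA)\}$, $\mathbb R_{>0}(\boldsymbol\alpha)=\{\boldsymbol\gamma\in\mathbb R^d:F_\sigma(\boldsymbol\gamma)>0\ (\sigma\in\mathcal F_+(\boldsymbol\alpha)),\ F_\sigma(\boldsymbol\gamma)<0\ (\sigma\in\mathcal F_-(\boldsymbol\alpha))\}$. ${\rm Face}(\boldsymbol\alpha)$ is the set of faces $\tau$ such that $\boldsymbol\alpha-\boldsymbol\lambda\in\mathbb Z^d$ for some $\boldsymbol\lambda\in\mathbb C(A\cap\tau)$ and every facet containing $\tau$ lies in $\mathcal F_+(\boldsymbol\alpha)$. $[\boldsymbol\alpha]$ is extreme if $E_\tau(\boldsymbol\alpha)$ is full for all $\tau\in{\rm Face}(\boldsymbol\alpha)$ and empty for all $\tau\notin{\rm Face}(\boldsymbol\alpha)$. *)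

theory Defs
  imports "HOL-Analysis.Analysis"
begin

definition ivec :: "int^'n \<Rightarrow> 'a::ring_1^'n" where
  "ivec z = (\<chi> i. of_int (z $ i))"

definition Zspan :: "(int^'n) set \<Rightarrow> (int^'n) set" where
  "Zspan S = {\<Sum>a\<in>T. c a *s a | T c. finite T \<and> T \<subseteq> S}"

definition Nspan :: "(int^'n) set \<Rightarrow> (int^'n) set" where
  "Nspan S = {\<Sum>a\<in>T. of_nat (c a) *s a | T (c :: int^'n \<Rightarrow> nat). finite T \<and> T \<subseteq> S}"

definition Cspan :: "(int^'n) set \<Rightarrow> (complex^'n) set" where
  "Cspan S = {\<Sum>a\<in>T. c a *s ivec a | T c. finite T \<and> T \<subseteq> S}"

definition QZ :: "(int^'n) set \<Rightarrow> (int^'n) set" where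
  "QZ S = {y. \<exists>T (c :: int^'n \<Rightarrow> rat). finite T \<and> T \<subseteq> S \<and>
              (ivec y :: rat^'n) = (\<Sum>a\<in>T. c a *s ivec a)}"

definition cone :: "(int^'n) set \<Rightarrow> (real^'n) set" where
  "cone A = {\<Sum>a\<in>T. c a *s ivec a | T c. finite T \<and> T \<subseteq> A \<and> (\<forall>a\<in>T. 0 \<le> c a)}"

definition face :: "(int^'n) set \<Rightarrow> (real^'n) set \<Rightarrow> bool" where
  "face A \<tau> \<longleftrightarrow> (\<exists>w. (\<forall>x\<in>cone A. 0 \<le> inner w x) \<and> \<tau> = {x \<in> cone A. inner w x = 0})"

definition facet :: "(int^'n) set \<Rightarrow> (real^'n) set \<Rightarrow> bool" where
  "facet A \<sigma> \<longleftrightarrow> face A \<sigma> \<and> dim \<sigma> = CARD('n) - 1"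

definition Fform :: "(int^'n) set \<Rightarrow> (real^'n) set \<Rightarrow> real^'n" where
  "Fform A \<sigma> = (THE w. (\<forall>x\<in>cone A. 0 \<le> inner w x) \<and> (\<forall>x\<in>\<sigma>. inner w x = 0) \<and>
                       range (\<lambda>z. inner w (ivec z)) = \<int>)"

definition FC :: "(int^'n) set \<Rightarrow> (real^'n) set \<Rightarrow> complex^'n \<Rightarrow> complex" where
  "FC A \<sigma> \<alpha> = (\<Sum>i\<in>UNIV. complex_of_real (Fform A \<sigma> $ i) * \<alpha> $ i)"

definition Fplus :: "(int^'n) set \<Rightarrow> complex^'n \<Rightarrow> (real^'n) set set" where
  "Fplus A \<alpha> = {\<sigma>. facet A \<sigma> \<and> (\<exists>a\<in>Nspan A. FC A \<sigma> \<alpha> = FC A \<sigma> (ivec a))}"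

definition Fminus :: "(int^'n) set \<Rightarrow> complex^'n \<Rightarrow> (real^'n) set set" where
  "Fminus A \<alpha> = {\<sigma>. facet A \<sigma> \<and> FC A \<sigma> \<alpha> \<in> \<int> \<and> \<not> (\<exists>a\<in>Nspan A. FC A \<sigma> \<alpha> = FC A \<sigma> (ivec a))}"

definition Rpos :: "(int^'n) set \<Rightarrow> complex^'n \<Rightarrow> (real^'n) set" where
  "Rpos A \<alpha> = {\<gamma>. (\<forall>\<sigma>\<in>Fplus A \<alpha>. inner (Fform A \<sigma>) \<gamma> > 0) \<and>
                  (\<forall>\<sigma>\<in>Fminus A \<alpha>. inner (Fform A \<sigma>) \<gamma> < 0)}"

definition Aface :: "(int^'n) set \<Rightarrow> (real^'n) set \<Rightarrow> (int^'n) set" where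
  "Aface A \<tau> = {a\<in>A. ivec a \<in> \<tau>}"

definition Eset :: "(int^'n) set \<Rightarrow> (real^'n) set \<Rightarrow> complex^'n \<Rightarrow> (complex^'n) set set" where
  "Eset A \<tau> \<alpha> = {{l + ivec z | z. z \<in> Zspan (Aface A \<tau>)} | l.
       l \<in> Cspan (Aface A \<tau>) \<and>
       (\<exists>a\<in>Nspan A. \<exists>z\<in>Zspan (Aface A \<tau>). \<alpha> - l = ivec (a + z))}"

definition face_index :: "(int^'n) set \<Rightarrow> (real^'n) set \<Rightarrow> nat" where
  "face_index A \<tau> = card {{y + z | z. z \<in> Zspan (Aface A \<tau>)} | y. y \<in> QZ (Aface A \<tau>)}"

definition Efull :: "(int^'n) set \<Rightarrow> (real^'n) set \<Rightarrow> complex^'n \<Rightarrow> bool" where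
  "Efull A \<tau> \<alpha> \<longleftrightarrow> card (Eset A \<tau> \<alpha>) = face_index A \<tau>"

definition FaceSet :: "(int^'n) set \<Rightarrow> complex^'n \<Rightarrow> (real^'n) set set" where
  "FaceSet A \<alpha> = {\<tau>. face A \<tau> \<and> (\<exists>l\<in>Cspan (Aface A \<tau>). \<exists>z. \<alpha> - l = ivec z) \<and>
                     (\<forall>\<sigma>. facet A \<sigma> \<and> \<tau> \<subseteq> \<sigma> \<longrightarrow> \<sigma> \<in> Fplus A \<alpha>)}"

definition extreme :: "(int^'n) set \<Rightarrow> complex^'n \<Rightarrow> bool" where
  "extreme A \<alpha> \<longleftrightarrow> (\<forall>\<tau>. face A \<tau> \<longrightarrow>
       (\<tau> \<in> FaceSet A \<alpha> \<longrightarrow> Efull A \<tau> \<alpha>) \<and> (\<tau> \<notin> FaceSet A \<alpha> \<longrightarrow> Eset A \<tau> \<alpha> = {}))"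

section \<open>The ring D(R_A), realised faithfully as operators on functions Z^d \<rightarrow> C\<close>

text \<open>A function f :: int^'n \<Rightarrow> complex with finite support is the Laurent polynomial
  \<Sum>_m f m t^m.  The operator t^a \<partial>^b sends t^m to
  (\<Prod>_i m_i(m_i-1)...(m_i-b_i+1)) t^(m-b+a).\<close>

type_synonym ('n) op = "(int^'n \<Rightarrow> complex) \<Rightarrow> (int^'n \<Rightarrow> complex)"

definition mono_op :: "int^'n \<Rightarrow> nat^'n \<Rightarrow> 'n op" where
  "mono_op a b f = (\<lambda>z. let m = z - a + (\<chi> i. int (b $ i)) in
       (\<Prod>i\<in>UNIV. \<Prod>k<b $ i. (of_int (m $ i) - of_nat k)) * f m)"

definition Weyl :: "('n::finite) op set" where
  "Weyl = {P. \<exists>S c. finite S \<and> P = (\<lambda>f z. \<Sum>p\<in>S. c p * mono_op (fst p) (snd p) f z)}"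

definition LP :: "(int^('n::finite) \<Rightarrow> complex) set" where
  "LP = {f. finite {z. f z \<noteq> 0}}"

definition RA :: "(int^'n) set \<Rightarrow> (int^'n \<Rightarrow> complex) set" where
  "RA A = {f \<in> LP. \<forall>z. f z \<noteq> 0 \<longrightarrow> z \<in> Nspan A}"

definition DA :: "(int^'n) set \<Rightarrow> 'n op set" where
  "DA A = {P \<in> Weyl. \<forall>f\<in>RA A. P f \<in> RA A}"

text \<open>s_j = t_j \<partial>_j and scalar operators\<close>
definition s_op :: "'n::finite \<Rightarrow> 'n op" where
  "s_op j = (\<lambda>f z. of_int (z $ j) * f z)"

definition scal_op :: "complex \<Rightarrow> 'n op" where
  "scal_op c = (\<lambda>f z. c * f z)"

definition dmodule :: "(int^'n) set \<Rightarrow> ('n op \<Rightarrow> 'b::ab_group_add \<Rightarrow> 'b) \<Rightarrow> bool" where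
  "dmodule A act \<longleftrightarrow>
     (\<forall>P\<in>DA A. \<forall>x y. act P (x + y) = act P x + act P y) \<and>
     (\<forall>P\<in>DA A. \<forall>Q\<in>DA A. \<forall>x. act (\<lambda>f z. P f z + Q f z) x = act P x + act Q x) \<and>
     (\<forall>P\<in>DA A. \<forall>Q\<in>DA A. \<forall>x. act (P \<circ> Q) x = act P (act Q x)) \<and>
     (\<forall>x. act id x = x)"

definition dsubmodule :: "(int^'n) set \<Rightarrow> ('n op \<Rightarrow> 'b::ab_group_add \<Rightarrow> 'b) \<Rightarrow> 'b set \<Rightarrow> bool" where
  "dsubmodule A act N \<longleftrightarrow> 0 \<in> N \<and> (\<forall>x\<in>N. \<forall>y\<in>N. x + y \<in> N) \<and>
     (\<forall>P\<in>DA A. \<forall>x\<in>N. act P x \<in> N)"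

definition dsimple :: "(int^'n) set \<Rightarrow> ('n op \<Rightarrow> 'b::ab_group_add \<Rightarrow> 'b) \<Rightarrow> bool" where
  "dsimple A act \<longleftrightarrow> (\<exists>x::'b. x \<noteq> 0) \<and>
     (\<forall>N. dsubmodule A act N \<longrightarrow> N = {0} \<or> N = UNIV)"

text \<open>act is (a module isomorphic to) L(alpha): a simple D(R_A)-module containing a nonzero
  vector v with s_i v = alpha_i v, i.e. a simple quotient of M(alpha).\<close>
definition is_L :: "(int^'n) set \<Rightarrow> complex^'n \<Rightarrow> ('n op \<Rightarrow> 'b::ab_group_add \<Rightarrow> 'b) \<Rightarrow> bool" where
  "is_L A \<alpha> act \<longleftrightarrow> dmodule A act \<and> dsimple A act \<and>
     (\<exists>v. v \<noteq> 0 \<and> (\<forall>i. act (s_op i) v = act (scal_op (\<alpha> $ i)) v))"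

definition Ann :: "(int^'n) set \<Rightarrow> ('n op \<Rightarrow> 'b::ab_group_add \<Rightarrow> 'b) \<Rightarrow> 'n op set" where
  "Ann A act = {P \<in> DA A. \<forall>x. act P x = 0}"

end

theory Submission
  imports Defs
begin

text \<open>
  Operators of degree \<open>a\<close> in \<open>D(R_A)\<close> have the form \<open>t^a q(s)\<close> with \<open>q\<close> vanishing on
  \<open>\<Omega>(a) = {m \<in> \<nat>A. m + a \<notin> \<nat>A}\<close>. A simple module with a vector of weight \<open>\<alpha>\<close> has weight
  \<open>\<alpha> + a\<close> iff \<open>\<alpha>\<close> is not a zero of all such \<open>q\<close> and \<open>\<alpha> + a\<close> is not a zero of their counterparts
  of degree \<open>-a\<close>. The set \<open>\<Omega>(a)\<close> is a finite union of translates \<open>b + \<nat>S\<close>, whose Zariski closures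
  are \<open>b + \<complex>S\<close>; therefore the condition says that \<open>\<alpha> \<sim> \<alpha> + a\<close>. So the weights form the class
  \<open>[\<alpha>]\<close>, and the annihilator vanishes iff \<open>[\<alpha>]\<close> is Zariski dense.

  Away from finitely many hyperplanes \<open>F\<^sub>\<sigma> = const\<close>, membership in \<open>\<nat>A + \<int>(A \<inter> \<tau>)\<close> is decided by
  the signs of the \<open>F\<^sub>\<sigma>\<close> with \<open>\<tau> \<subseteq> \<sigma>\<close>. Hence a class that is not extreme lies in finitely many
  hyperplanes, while an extreme one contains all points of \<open>\<alpha> + \<int>^d\<close> deep inside the cone
  \<open>\<real>\<^sub>>\<^sub>0(\<alpha>)\<close>. If this cone is empty, Gordan's theorem bounds some \<open>F\<^sub>\<sigma>\<close> on the class.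
\<close>

text \<open>The data are real or complex where integrality is needed: a face comes with a real
  normal and a span with complex coefficients, but the forms \<open>F_\<sigma>\<close>, the index
  that defines fullness and multiples inside \<nat>A are integral. Simultaneous Dirichlet
  approximation bridges this gap: an integer of absolute value below 1 is 0. Zariski closures are
  never formed. On a line a polynomial function is a polynomial in one variable, so infinitely many
  roots kill it there; freeing one coefficient after another leads from \<nat>S to \<complex>S. The
  delicate step is to construct an operator of degree \<open>a\<close> that is nonzero at \<alpha>
  when every \<open>E_\<tau>(\<alpha>)\<close> is contained in
  \<open>E_\<tau>(\<alpha> + a)\<close>. A translate \<open>b + \<nat>S\<close> that is moved out of
  the monoid entirely must be separated from \<alpha>, but \<open>S\<close> need not be the
  generating set of a face, while the hypothesis speaks of faces only. The smallest face \<tau>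
  containing \<open>S\<close> mediates: every element of \<open>\<int>(A \<inter> \<tau>)\<close> is
  pushed into \<nat>A by adding an element of \<nat>S.\<close>

section \<open>Integer vectors and their natural, integral, complex and conic spans\<close>

lemma ivec_nth [simp]: "ivec z $ i = of_int (z $ i)"
  by (simp add: ivec_def)

lemma ivec_0 [simp]: "ivec 0 = 0"
  and ivec_add: "ivec (y + z) = ivec y + ivec z"
  and ivec_diff: "ivec (y - z) = ivec y - ivec z"
  and ivec_minus: "ivec (- z) = - ivec z"
  and ivec_scale: "ivec (k *s z) = of_int k *s ivec z"
  by (simp_all add: vec_eq_iff)

lemma ivec_sum: "ivec (sum f T) = (\<Sum>a\<in>T. ivec (f a))"
  by (induction T rule: infinite_finite_induct) (simp_all add: ivec_add)

lemma ivec_eq_iff [simp]: "(ivec y :: 'a::ring_char_0^'n) = ivec z \<longleftrightarrow> y = z"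
  by (simp add: vec_eq_iff)

lemma sum_extend_zero:
  fixes f :: "'b \<Rightarrow> 'c::comm_monoid_add"
  assumes "finite S" "T \<subseteq> S" "\<And>a. a \<in> S - T \<Longrightarrow> g a = 0" "\<And>a. a \<in> T \<Longrightarrow> f a = g a"
  shows "sum f T = sum g S"
  using assms by (intro sum.mono_neutral_cong_left) auto

text \<open>Padding with zero coefficients gives all elements the same support, so that sums and
  differences are taken coefficientwise.\<close>

lemma Nspan_finite:
  assumes "finite S"
  shows "Nspan S = {\<Sum>a\<in>S. of_nat (c a) *s a | c. True}"
proof (intro subset_antisym subsetI)
  fix x assume "x \<in> Nspan S"
  then obtain T c where T: "T \<subseteq> S" and x: "x = (\<Sum>a\<in>T. of_nat (c a) *s a)"
    unfolding Nspan_def by blast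
  have "x = (\<Sum>a\<in>S. of_nat (if a \<in> T then c a else 0) *s a)"
    unfolding x using assms T by (intro sum_extend_zero) auto
  then show "x \<in> {\<Sum>a\<in>S. of_nat (c a) *s a | c. True}"
    by (intro CollectI exI[of _ "\<lambda>a. if a \<in> T then c a else 0"]) simp
qed (use assms in \<open>auto simp: Nspan_def\<close>)

lemma Zspan_finite:
  assumes "finite S"
  shows "Zspan S = {\<Sum>a\<in>S. c a *s a | c. True}"
proof (intro subset_antisym subsetI)
  fix x assume "x \<in> Zspan S"
  then obtain T c where T: "T \<subseteq> S" and x: "x = (\<Sum>a\<in>T. c a *s a)"
    unfolding Zspan_def by blast
  have "x = (\<Sum>a\<in>S. (if a \<in> T then c a else 0) *s a)"
    unfolding x using assms T by (intro sum_extend_zero) auto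
  then show "x \<in> {\<Sum>a\<in>S. c a *s a | c. True}"
    by (intro CollectI exI[of _ "\<lambda>a. if a \<in> T then c a else 0"]) simp
qed (use assms in \<open>auto simp: Zspan_def\<close>)

lemma Cspan_finite:
  assumes "finite S"
  shows "Cspan S = {\<Sum>a\<in>S. c a *s ivec a | c. True}"
proof (intro subset_antisym subsetI)
  fix x assume "x \<in> Cspan S"
  then obtain T c where T: "T \<subseteq> S" and x: "x = (\<Sum>a\<in>T. c a *s ivec a)"
    unfolding Cspan_def by blast
  have "x = (\<Sum>a\<in>S. (if a \<in> T then c a else 0) *s ivec a)"
    unfolding x using assms T by (intro sum_extend_zero) auto
  then show "x \<in> {\<Sum>a\<in>S. c a *s ivec a | c. True}"
    by (intro CollectI exI[of _ "\<lambda>a. if a \<in> T then c a else 0"]) simp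
qed (use assms in \<open>auto simp: Cspan_def\<close>)

lemma cone_finite:
  assumes "finite S"
  shows "cone S = {\<Sum>a\<in>S. c a *s ivec a | c. \<forall>a\<in>S. 0 \<le> c a}"
proof (intro subset_antisym subsetI)
  fix x assume "x \<in> cone S"
  then obtain T c where T: "T \<subseteq> S" "\<forall>a\<in>T. 0 \<le> c a" and x: "x = (\<Sum>a\<in>T. c a *s ivec a)"
    unfolding cone_def by blast
  have "x = (\<Sum>a\<in>S. (if a \<in> T then c a else 0) *s ivec a)"
    unfolding x using assms T by (intro sum_extend_zero) auto
  then show "x \<in> {\<Sum>a\<in>S. c a *s ivec a | c. \<forall>a\<in>S. 0 \<le> c a}"
    using T(2) by (intro CollectI exI[of _ "\<lambda>a. if a \<in> T then c a else 0"]) auto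
qed (use assms in \<open>auto simp: cone_def\<close>)

lemma vector_sub_rdistrib: "(a - b) *s x = a *s x - b *s (x :: 'a::ring^'n)"
  by (simp add: vec_eq_iff left_diff_distrib)

lemma Nspan_finiteI:
  "finite S \<Longrightarrow> x = (\<Sum>a\<in>S. of_nat (c a) *s a) \<Longrightarrow> x \<in> Nspan S"
  unfolding Nspan_def by (intro CollectI exI[of _ S] exI[of _ c]) simp

lemma Zspan_finiteI:
  "finite S \<Longrightarrow> x = (\<Sum>a\<in>S. c a *s a) \<Longrightarrow> x \<in> Zspan S"
  unfolding Zspan_def by (intro CollectI exI[of _ S] exI[of _ c]) simp

lemma Cspan_finiteI:
  "finite S \<Longrightarrow> x = (\<Sum>a\<in>S. c a *s ivec a) \<Longrightarrow> x \<in> Cspan S"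
  unfolding Cspan_def by (intro CollectI exI[of _ S] exI[of _ c]) simp

lemma Nspan_0 [simp]: "0 \<in> Nspan S"
  unfolding Nspan_def by (intro CollectI exI[of _ "{}"]) simp

lemma Nspan_superset: "a \<in> S \<Longrightarrow> a \<in> Nspan S"
  unfolding Nspan_def by (intro CollectI exI[of _ "{a}"] exI[of _ "\<lambda>_. 1"]) simp

lemma Nspan_mono: "S \<subseteq> S' \<Longrightarrow> Nspan S \<subseteq> Nspan S'"
  unfolding Nspan_def by blast

lemma Zspan_mono: "S \<subseteq> S' \<Longrightarrow> Zspan S \<subseteq> Zspan S'"
  unfolding Zspan_def by blast

lemma Cspan_mono: "S \<subseteq> S' \<Longrightarrow> Cspan S \<subseteq> Cspan S'"
  unfolding Cspan_def by blast

lemma Nspan_add: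
  assumes "finite S" "x \<in> Nspan S" "y \<in> Nspan S"
  shows "x + y \<in> Nspan S"
proof -
  obtain c d where "x = (\<Sum>a\<in>S. of_nat (c a) *s a)" "y = (\<Sum>a\<in>S. of_nat (d a) *s a)"
    using assms by (auto simp: Nspan_finite)
  then have "x + y = (\<Sum>a\<in>S. of_nat (c a + d a) *s a)"
    by (simp add: sum.distrib[symmetric] vector_sadd_rdistrib)
  then show ?thesis by (rule Nspan_finiteI[OF assms(1)])
qed

lemma Nspan_sum: "finite S \<Longrightarrow> (\<And>i. i \<in> I \<Longrightarrow> f i \<in> Nspan S) \<Longrightarrow> sum f I \<in> Nspan S"
  by (induction I rule: infinite_finite_induct) (auto intro: Nspan_add)

lemma Nspan_scale: "finite S \<Longrightarrow> x \<in> Nspan S \<Longrightarrow> of_nat k *s x \<in> Nspan S"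
  by (induction k) (auto intro: Nspan_add simp: vector_sadd_rdistrib)

lemma Zspan_diff:
  assumes "finite S" "x \<in> Zspan S" "y \<in> Zspan S"
  shows "x - y \<in> Zspan S"
proof -
  obtain c d where "x = (\<Sum>a\<in>S. c a *s a)" "y = (\<Sum>a\<in>S. d a *s a)"
    using assms by (auto simp: Zspan_finite)
  then have "x - y = (\<Sum>a\<in>S. (c a - d a) *s a)"
    by (simp add: sum_subtractf[symmetric] vector_sub_rdistrib)
  then show ?thesis by (rule Zspan_finiteI[OF assms(1)])
qed

lemma Zspan_0 [simp]: "0 \<in> Zspan S"
  unfolding Zspan_def by (intro CollectI exI[of _ "{}"]) simp

lemma Zspan_uminus: "finite S \<Longrightarrow> x \<in> Zspan S \<Longrightarrow> - x \<in> Zspan S"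
  using Zspan_diff[of S 0 x] by simp

lemma Zspan_add: "finite S \<Longrightarrow> x \<in> Zspan S \<Longrightarrow> y \<in> Zspan S \<Longrightarrow> x + y \<in> Zspan S"
  using Zspan_diff[of S x "-y"] Zspan_uminus[of S y] by simp

lemma Nspan_subset_Zspan: "Nspan S \<subseteq> Zspan S"
  unfolding Nspan_def Zspan_def by force

lemma Zspan_eq_Nspan_diff:
  assumes "finite S" "z \<in> Zspan S"
  obtains x y where "x \<in> Nspan S" "y \<in> Nspan S" "z = x - y"
proof -
  obtain c where z: "z = (\<Sum>a\<in>S. c a *s a)"
    using assms by (auto simp: Zspan_finite)
  have "c a *s a = of_nat (nat (c a)) *s a - of_nat (nat (- c a)) *s a" for a :: "int^'a"
    by (cases "0 \<le> c a") (simp_all add: vec_eq_iff)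
  then have "z = (\<Sum>a\<in>S. of_nat (nat (c a)) *s a) - (\<Sum>a\<in>S. of_nat (nat (- c a)) *s a)"
    unfolding z by (simp add: sum_subtractf[symmetric])
  then show ?thesis
    by (rule that[OF Nspan_finiteI[OF assms(1) refl] Nspan_finiteI[OF assms(1) refl]])
qed

lemma Cspan_diff:
  assumes "finite S" "x \<in> Cspan S" "y \<in> Cspan S"
  shows "x - y \<in> Cspan S"
proof -
  obtain c d where "x = (\<Sum>a\<in>S. c a *s ivec a)" "y = (\<Sum>a\<in>S. d a *s ivec a)"
    using assms by (auto simp: Cspan_finite)
  then have "x - y = (\<Sum>a\<in>S. (c a - d a) *s ivec a)"
    by (simp add: sum_subtractf[symmetric] vector_sub_rdistrib)
  then show ?thesis by (rule Cspan_finiteI[OF assms(1)])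
qed

lemma Cspan_0 [simp]: "0 \<in> Cspan S"
  unfolding Cspan_def by (intro CollectI exI[of _ "{}"]) simp

lemma Cspan_add: "finite S \<Longrightarrow> x \<in> Cspan S \<Longrightarrow> y \<in> Cspan S \<Longrightarrow> x + y \<in> Cspan S"
  using Cspan_diff[of S x "0-y"] Cspan_diff[of S 0 y] by simp

lemma ivec_Zspan_in_Cspan: "z \<in> Zspan S \<Longrightarrow> ivec z \<in> Cspan S"
proof -
  assume "z \<in> Zspan S"
  then obtain T c where "finite T" "T \<subseteq> S" "z = (\<Sum>a\<in>T. c a *s a)"
    unfolding Zspan_def by blast
  then show ?thesis unfolding Cspan_def
    by (intro CollectI exI[of _ T] exI[of _ "\<lambda>a. of_int (c a)"]) (simp add: ivec_sum ivec_scale)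
qed

section \<open>Polynomial functions\<close>

text \<open>Products enter only through a single coordinate. Inductions such as
  \<open>polyfun_falling_comb\<close> and \<open>weight_vec_polyfun\<close> then have to treat one
  coordinate only, and closure under products is derived.\<close>

inductive polyfun :: "(complex^'n \<Rightarrow> complex) \<Rightarrow> bool" where
  polyfun_const: "polyfun (\<lambda>_. c)"
| polyfun_coord: "polyfun p \<Longrightarrow> polyfun (\<lambda>x. x $ i * p x)"
| polyfun_add: "polyfun p \<Longrightarrow> polyfun q \<Longrightarrow> polyfun (\<lambda>x. p x + q x)"

lemma polyfun_nth: "polyfun (\<lambda>x. x $ i)"
  using polyfun_coord[OF polyfun_const[of 1]] by simp

lemma polyfun_cmult: "polyfun p \<Longrightarrow> polyfun (\<lambda>x. c * p x)"
proof (induction rule: polyfun.induct)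
  case (polyfun_coord p i)
  then show ?case using polyfun.polyfun_coord[of "\<lambda>x. c * p x" i] by (simp add: mult.left_commute)
qed (auto intro: polyfun.intros simp: distrib_left)

lemma polyfun_mult:
  assumes "polyfun p" "polyfun q"
  shows "polyfun (\<lambda>x. p x * q x)"
  using assms(1)
proof (induction rule: polyfun.induct)
  case (polyfun_const c)
  then show ?case by (rule polyfun_cmult[OF assms(2)])
next
  case (polyfun_coord p i)
  then show ?case using polyfun.polyfun_coord[of "\<lambda>x. p x * q x" i] by (simp add: mult.assoc)
qed (auto intro: polyfun.intros simp: distrib_right)

lemma polyfun_diff: "polyfun p \<Longrightarrow> polyfun q \<Longrightarrow> polyfun (\<lambda>x. p x - q x)"
  using polyfun_add[OF _ polyfun_cmult[of q "-1"], of p] by simp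

lemma polyfun_prod: "(\<And>i. i \<in> I \<Longrightarrow> polyfun (p i)) \<Longrightarrow> polyfun (\<lambda>x. \<Prod>i\<in>I. p i x)"
  by (induction I rule: infinite_finite_induct) (auto intro: polyfun_const polyfun_mult)

lemma polyfun_sum: "(\<And>i. i \<in> I \<Longrightarrow> polyfun (p i)) \<Longrightarrow> polyfun (\<lambda>x. \<Sum>i\<in>I. p i x)"
  by (induction I rule: infinite_finite_induct) (auto intro: polyfun_const polyfun_add)

lemma polyfun_translate: "polyfun p \<Longrightarrow> polyfun (\<lambda>x. p (x + b))"
proof (induction rule: polyfun.induct)
  case (polyfun_coord p i)
  have "polyfun (\<lambda>x. x $ i + b $ i)"
    by (intro polyfun_add polyfun_nth polyfun_const)
  from polyfun_mult[OF this polyfun_coord.IH] show ?case by simp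
qed (auto intro: polyfun.intros)

lemma polyfun_line:
  assumes "polyfun p"
  shows "\<exists>P. \<forall>t. p (x + t *s y) = poly P t"
  using assms
proof (induction rule: polyfun.induct)
  case (polyfun_const c)
  then show ?case by (intro exI[of _ "[:c:]"]) simp
next
  case (polyfun_coord p i)
  then obtain P where P: "p (x + t *s y) = poly P t" for t by blast
  show ?case by (intro exI[of _ "[:x $ i, y $ i:] * P"]) (simp add: P algebra_simps)
next
  case (polyfun_add p q)
  then show ?case by (metis poly_add)
qed

text \<open>A polynomial in one variable with infinitely many roots is zero. The tail
  \<open>k \<ge> K\<close> suffices, which later allows rays that enter a class only far
  out.\<close>

lemma polyfun_line_zero:
  assumes "polyfun p" and "\<And>k. k \<ge> K \<Longrightarrow> p (x + of_nat k *s y) = 0"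
  shows "p (x + t *s y) = 0"
proof -
  obtain P where P: "p (x + t *s y) = poly P t" for t
    using polyfun_line[OF assms(1)] by blast
  have "of_nat ` {K..} \<subseteq> {t. poly P t = 0}" using assms(2) by (auto simp flip: P)
  moreover have "infinite (of_nat ` {K..} :: complex set)"
    by (simp add: finite_image_iff inj_on_def infinite_Ici)
  ultimately have "P = 0" using poly_roots_finite finite_subset by blast
  then show ?thesis by (simp add: P)
qed

lemma polyfun_zero_on_Cspan:
  assumes "polyfun p" "finite S" and "\<And>x. x \<in> Nspan S \<Longrightarrow> p (b + ivec x) = 0" and "l \<in> Cspan S"
  shows "p (b + l) = 0"
proof -
  \<comment> \<open>The base point is quantified because a coefficient that has already become
    complex is absorbed into it.\<close>
  have *: "\<forall>b. (\<forall>c. p (b + (\<Sum>a\<in>S. of_nat (c a) *s ivec a)) = 0) \<longrightarrow>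
       (\<forall>c. p (b + (\<Sum>a\<in>S. c a *s ivec a)) = 0)"
    using assms(2)
  proof (induction S)
    case (insert s S)
    show ?case
    proof (intro allI impI)
      fix b c assume b: "\<forall>c. p (b + (\<Sum>a\<in>insert s S. of_nat (c a) *s ivec a)) = 0"
      have "p ((b + t *s ivec s) + (\<Sum>a\<in>S. of_nat (d a) *s ivec a)) = 0" for t d
      proof -
        have "p ((b + (\<Sum>a\<in>S. of_nat (d a) *s ivec a)) + of_nat k *s ivec s) = 0" for k
        proof -
          have "(\<Sum>a\<in>S. of_nat ((d(s := k)) a) *s ivec a :: complex^'a) = (\<Sum>a\<in>S. of_nat (d a) *s ivec a)"
            using insert by (intro sum.cong) auto
          with b[rule_format, of "d(s := k)"] insert show ?thesis by (simp add: add_ac)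
        qed
        from polyfun_line_zero[OF assms(1) this] show ?thesis by (simp add: add_ac)
      qed
      with insert.IH have "p ((b + c s *s ivec s) + (\<Sum>a\<in>S. c a *s ivec a)) = 0" by blast
      then show "p (b + (\<Sum>a\<in>insert s S. c a *s ivec a)) = 0"
        using insert by (simp add: add_ac)
    qed
  qed simp
  have "p (b + (\<Sum>a\<in>S. of_nat (c a) *s ivec a)) = 0" for c
  proof -
    have "(\<Sum>a\<in>S. of_nat (c a) *s a) \<in> Nspan S"
      by (rule Nspan_finiteI[OF assms(2) refl])
    from assms(3)[OF this] show ?thesis by (simp add: ivec_sum ivec_scale)
  qed
  with *[rule_format, of b] show ?thesis using assms(4) by (auto simp: Cspan_finite[OF assms(2)])
qed

text \<open>The integral domain property: on the line through \<open>x\<close> and \<open>y\<close>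
  the factor \<open>q\<close> is a nonzero polynomial in one variable, so \<open>p\<close> vanishes
  along that line.\<close>

lemma polyfun_mult_eq_zero:
  assumes "polyfun p" "polyfun q" and "\<And>x. p x * q x = 0" and "q y \<noteq> 0"
  shows "p x = 0"
proof -
  obtain P Q where P: "\<And>t. p (x + t *s (y - x)) = poly P t" and Q: "\<And>t. q (x + t *s (y - x)) = poly Q t"
    using polyfun_line[OF assms(1)] polyfun_line[OF assms(2)] by metis
  have "poly (P * Q) t = 0" for t using assms(3) by (simp flip: P Q)
  then have "P * Q = 0" using poly_all_0_iff_0 by blast
  moreover have "Q \<noteq> 0" using Q[of 1] assms(4) by auto
  ultimately show ?thesis using P[of 0] by simp
qed

text \<open>Each point of \<open>X\<close> differs from \<open>x\<close> in some coordinate, and the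
  corresponding linear factors are multiplied. Applied to finitely many weights, \<open>g(s)\<close>
  projects onto one weight component.\<close>

lemma polyfun_interpolate:
  assumes "finite X" "x \<notin> X"
  obtains g where "polyfun g" "g x = 1" "\<And>y. y \<in> X \<Longrightarrow> g y = 0"
proof -
  have "\<exists>i. y $ i \<noteq> x $ i" if "y \<in> X" for y
    using that assms(2) by (metis vec_eq_iff)
  then obtain i where i: "y \<in> X \<Longrightarrow> y $ i y \<noteq> x $ i y" for y by metis
  define g where "g = (\<lambda>u. \<Prod>y\<in>X. inverse (x $ i y - y $ i y) * (u $ i y - y $ i y))"
  show ?thesis
  proof
    show "polyfun g" unfolding g_def
      by (intro polyfun_prod polyfun_cmult polyfun_diff polyfun_nth polyfun_const)
    show "g x = 1" unfolding g_def using i by (intro prod.neutral) fastforce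
    show "g y = 0" if "y \<in> X" for y unfolding g_def using that assms(1) by (intro prod_zero) auto
  qed
qed

section \<open>Homogeneous differential operators\<close>

text \<open>The operator \<open>t^a p(s)\<close>.\<close>

definition shift_op :: "int^'n \<Rightarrow> (complex^'n \<Rightarrow> complex) \<Rightarrow> 'n::finite op" where
  "shift_op a p = (\<lambda>f z. p (ivec (z - a)) * f (z - a))"

text \<open>Moving \<open>t^b\<close> to the left past a polynomial in \<open>s\<close> translates
  its argument by \<open>b\<close>.\<close>

lemma shift_op_comp: "shift_op a p \<circ> shift_op b q = shift_op (a + b) (\<lambda>x. p (x + ivec b) * q x)"
  by (simp add: fun_eq_iff shift_op_def o_def ivec_diff ivec_add algebra_simps)

lemma shift_op_0_coord: "shift_op 0 (\<lambda>x. x $ i) = s_op i"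
  by (simp add: fun_eq_iff shift_op_def s_op_def)

lemma shift_op_0_const: "shift_op 0 (\<lambda>_. c) = scal_op c"
  by (simp add: fun_eq_iff shift_op_def scal_op_def)

lemma shift_op_add: "shift_op a (\<lambda>x. p x + q x) = (\<lambda>f z. shift_op a p f z + shift_op a q f z)"
  by (simp add: fun_eq_iff shift_op_def distrib_right)

text \<open>This is \<open>t^b \<partial>^b\<close> written as a polynomial in
  \<open>s\<close>.\<close>

definition falling :: "nat^'n \<Rightarrow> complex^'n \<Rightarrow> complex" where
  "falling b x = (\<Prod>i\<in>UNIV. \<Prod>k<b $ i. (x $ i - of_nat k))"

lemma mono_op_eq_shift_op: "mono_op a b = shift_op (a - (\<chi> i. int (b $ i))) (falling b)"
  by (simp add: fun_eq_iff mono_op_def shift_op_def falling_def Let_def algebra_simps)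

lemma polyfun_falling: "polyfun (falling b)"
  unfolding falling_def
  by (intro polyfun_prod polyfun_diff polyfun_nth polyfun_const)

lemma falling_Suc:
  "falling (b + axis i 1) x = (x $ i - of_nat (b $ i)) * falling b x"
proof -
  let ?g = "\<lambda>b j. \<Prod>k<b $ j. (x $ j - of_nat k)"
  have "falling (b + axis i 1) x = ?g (b + axis i 1) i * (\<Prod>j\<in>UNIV - {i}. ?g (b + axis i 1) j)"
    unfolding falling_def by (rule prod.remove) auto
  also have "(\<Prod>j\<in>UNIV - {i}. ?g (b + axis i 1) j) = (\<Prod>j\<in>UNIV - {i}. ?g b j)"
    by (rule prod.cong) (auto simp: axis_def)
  also have "?g (b + axis i 1) i = (x $ i - of_nat (b $ i)) * ?g b i"
    by (simp add: axis_def mult.commute)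
  finally show ?thesis
    unfolding falling_def by (simp add: prod.remove[of UNIV i] mult.assoc)
qed

text \<open>Linear combinations of falling factorials. That they exhaust the polynomials is the
  reason why every \<open>t^a p(s)\<close> belongs to the Weyl algebra.\<close>

inductive falling_comb :: "(complex^'n \<Rightarrow> complex) \<Rightarrow> bool" where
  falling_comb_0: "falling_comb (\<lambda>_. 0)"
| falling_comb_plus: "falling_comb p \<Longrightarrow> falling_comb (\<lambda>x. c * falling b x + p x)"

lemma falling_comb_add:
  assumes "falling_comb p" "falling_comb q"
  shows "falling_comb (\<lambda>x. p x + q x)"
  using assms(1) by induction (auto intro: assms(2) falling_comb.intros simp: add.assoc)

lemma falling_comb_coord: "falling_comb p \<Longrightarrow> falling_comb (\<lambda>x. x $ i * p x)"
proof (induction rule: falling_comb.induct)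
  case (falling_comb_plus p c b)
  \<comment> \<open>Write \<open>x $ i\<close> as \<open>(x $ i - b $ i) + b $ i\<close>: the first
    summand raises the falling factorial, the second is a scalar.\<close>
  have "x $ i * (c * falling b x + p x) =
      c * falling (b + axis i 1) x + (c * of_nat (b $ i) * falling b x + x $ i * p x)" for x
    unfolding falling_Suc by (simp add: algebra_simps)
  then show ?case using falling_comb_plus.IH by (simp add: falling_comb.intros)
qed (simp add: falling_comb_0)

lemma polyfun_falling_comb: "polyfun p \<Longrightarrow> falling_comb p"
proof (induction rule: polyfun.induct)
  case (polyfun_const c)
  then show ?case using falling_comb_plus[OF falling_comb_0, of c 0] by (simp add: falling_def)
qed (auto intro: falling_comb_coord falling_comb_add)

lemma Weyl_add_mono:
  assumes "P \<in> Weyl"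
  shows "(\<lambda>f z. c * mono_op a b f z + P f z) \<in> Weyl"
proof -
  obtain S d where S: "finite S" and P: "P = (\<lambda>f z. \<Sum>p\<in>S. d p * mono_op (fst p) (snd p) f z)"
    using assms unfolding Weyl_def by blast
  \<comment> \<open>The pair \<open>(a, b)\<close> may already occur in \<open>S\<close>, so the two
    coefficients are added.\<close>
  define d' where "d' p = (if p \<in> S then d p else 0) + (if p = (a, b) then c else 0)" for p
  have "c * mono_op a b f z + P f z = (\<Sum>p\<in>insert (a,b) S. d' p * mono_op (fst p) (snd p) f z)" for f z
  proof -
    have "(\<Sum>p\<in>insert (a,b) S. (if p = (a, b) then c else 0) * mono_op (fst p) (snd p) f z)
       = (\<Sum>p\<in>{(a,b)}. c * mono_op (fst p) (snd p) f z)"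
      using S by (intro sum_extend_zero[symmetric]) auto
    moreover have "(\<Sum>p\<in>insert (a,b) S. (if p \<in> S then d p else 0) * mono_op (fst p) (snd p) f z)
       = P f z"
      unfolding P using S by (intro sum_extend_zero[symmetric]) auto
    ultimately show ?thesis unfolding d'_def by (simp only: distrib_right sum.distrib) simp
  qed
  then show ?thesis unfolding Weyl_def using S by blast
qed

lemma shift_op_in_Weyl: "polyfun p \<Longrightarrow> shift_op a p \<in> Weyl"
proof -
  assume "polyfun p"
  then have "falling_comb p" by (rule polyfun_falling_comb)
  then show ?thesis
  proof induction
    case falling_comb_0
    show ?case unfolding Weyl_def
      by (intro CollectI exI[of _ "{}"]) (simp add: shift_op_def)
  next
    case (falling_comb_plus p c b)
    \<comment> \<open>Since \<open>\<partial>^b\<close> lowers the degree by \<open>b\<close>, the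
      exponent is \<open>a + b\<close> in order to end in degree \<open>a\<close>.\<close>
    from Weyl_add_mono[OF this(2), of c "a + (\<chi> i. int (b $ i))" b]
    show ?case
      by (simp add: mono_op_eq_shift_op shift_op_def distrib_right mult.assoc)
  qed
qed

text \<open>The grading of the Weyl algebra by \<int>^d: the operator
  \<open>t^a \<partial>^b\<close> has degree \<open>a - b\<close>, and terms of equal degree are
  collected.\<close>

lemma Weyl_decompose:
  assumes "P \<in> Weyl"
  obtains F p where "finite F" "\<And>a. polyfun (p a)" "P = (\<lambda>f z. \<Sum>a\<in>F. shift_op a (p a) f z)"
proof -
  obtain S d where S: "finite S" and P: "P = (\<lambda>f z. \<Sum>s\<in>S. d s * mono_op (fst s) (snd s) f z)"
    using assms unfolding Weyl_def by blast
  define sh :: "(int^'a) \<times> (nat^'a) \<Rightarrow> int^'a" where "sh s = fst s - (\<chi> i. int (snd s $ i))" for s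
  define p where "p a = (\<lambda>x. \<Sum>s\<in>{s\<in>S. sh s = a}. d s * falling (snd s) x)" for a
  show ?thesis
  proof
    show "finite (sh ` S)" using S by simp
    show "polyfun (p a)" for a unfolding p_def by (intro polyfun_sum polyfun_cmult polyfun_falling)
    show "P = (\<lambda>f z. \<Sum>a\<in>sh ` S. shift_op a (p a) f z)"
    proof (intro ext)
      fix f z
      have "P f z = (\<Sum>a\<in>sh ` S. \<Sum>s\<in>{s\<in>S. sh s = a}. d s * mono_op (fst s) (snd s) f z)"
        unfolding P by (rule sum.image_gen[OF S])
      also have "\<dots> = (\<Sum>a\<in>sh ` S. shift_op a (p a) f z)"
        by (intro sum.cong refl)
          (auto simp: p_def shift_op_def mono_op_eq_shift_op sum_distrib_right mult.assoc sh_def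
             intro!: sum.cong)
      finally show "P f z = (\<Sum>a\<in>sh ` S. shift_op a (p a) f z)" .
    qed
  qed
qed

text \<open>Test on monomials: \<open>t^a p(s)\<close> sends \<open>t^m\<close> to
  \<open>p(m) t^(m + a)\<close>.\<close>

lemma shift_op_in_DA_iff:
  assumes "polyfun p"
  shows "shift_op a p \<in> DA A \<longleftrightarrow> (\<forall>m\<in>Nspan A. p (ivec m) \<noteq> 0 \<longrightarrow> m + a \<in> Nspan A)"
proof
  assume *: "shift_op a p \<in> DA A"
  show "\<forall>m\<in>Nspan A. p (ivec m) \<noteq> 0 \<longrightarrow> m + a \<in> Nspan A"
  proof (intro ballI impI)
    fix m assume m: "m \<in> Nspan A" "p (ivec m) \<noteq> 0"
    have "(\<lambda>z. if z = m then 1 else 0) \<in> RA A"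
      using m by (auto simp: RA_def LP_def)
    with * have "shift_op a p (\<lambda>z. if z = m then 1 else 0) \<in> RA A"
      unfolding DA_def by blast
    then show "m + a \<in> Nspan A"
      unfolding RA_def shift_op_def using m by auto
  qed
next
  assume *: "\<forall>m\<in>Nspan A. p (ivec m) \<noteq> 0 \<longrightarrow> m + a \<in> Nspan A"
  have "shift_op a p f \<in> RA A" if f: "f \<in> RA A" for f
  proof -
    have "{z. shift_op a p f z \<noteq> 0} \<subseteq> (\<lambda>z. z + a) ` {z. f z \<noteq> 0}"
      by (force simp: shift_op_def image_iff intro: exI[of _ "_ - a"])
    moreover have "finite {z. f z \<noteq> 0}" using f by (simp add: RA_def LP_def)
    ultimately have "finite {z. shift_op a p f z \<noteq> 0}" using finite_subset by blast
    moreover have "z \<in> Nspan A" if "shift_op a p f z \<noteq> 0" for z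
    proof -
      from that have "p (ivec (z - a)) \<noteq> 0" "f (z - a) \<noteq> 0" by (auto simp: shift_op_def)
      with f * have "(z - a) + a \<in> Nspan A" unfolding RA_def by blast
      then show ?thesis by simp
    qed
    ultimately show ?thesis by (simp add: RA_def LP_def)
  qed
  with shift_op_in_Weyl[OF assms] show "shift_op a p \<in> DA A" unfolding DA_def by blast
qed

lemma shift_op_0_in_DA: "polyfun p \<Longrightarrow> shift_op 0 p \<in> DA A"
  by (simp add: shift_op_in_DA_iff)

text \<open>The subring inherits the grading. Applied to one monomial \<open>t^m\<close>, components
  of different degrees produce different monomials, so nothing cancels and each component preserves
  \<open>R_A\<close> by itself.\<close>

lemma DA_decompose:
  assumes "P \<in> DA A"
  obtains F p where "finite F" "\<And>a. polyfun (p a)" "\<And>a. a \<in> F \<Longrightarrow> shift_op a (p a) \<in> DA A"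
    "P = (\<lambda>f z. \<Sum>a\<in>F. shift_op a (p a) f z)"
proof -
  have "P \<in> Weyl" using assms by (simp add: DA_def)
  then obtain F p where Fp: "finite F" "\<And>a. polyfun (p a)"
      and P: "P = (\<lambda>f z. \<Sum>a\<in>F. shift_op a (p a) f z)"
    by (rule Weyl_decompose) blast
  have "shift_op a (p a) \<in> DA A" if a: "a \<in> F" for a
    unfolding shift_op_in_DA_iff[OF Fp(2)]
  proof (intro ballI impI)
    fix m assume m: "m \<in> Nspan A" "p a (ivec m) \<noteq> 0"
    let ?\<delta> = "\<lambda>z. if z = m then 1 else 0 :: complex"
    have "?\<delta> \<in> RA A" using m by (auto simp: RA_def LP_def)
    with assms have "P ?\<delta> \<in> RA A" unfolding DA_def by blast
    moreover have "P ?\<delta> (m + a) = p a (ivec m)"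
    proof -
      have "P ?\<delta> (m + a) = (\<Sum>b\<in>{a}. shift_op b (p b) ?\<delta> (m + a))"
        unfolding P using Fp(1) a
        by (intro sum_extend_zero[symmetric]) (auto simp: shift_op_def algebra_simps)
      then show ?thesis by (simp add: shift_op_def)
    qed
    ultimately show "m + a \<in> Nspan A" using m by (auto simp: RA_def)
  qed
  with Fp P show ?thesis using that by blast
qed

section \<open>Weight vectors\<close>

lemma Weyl_0: "(\<lambda>f z. 0) \<in> Weyl"
  unfolding Weyl_def by (intro CollectI exI[of _ "{}"]) simp

lemma Weyl_add:
  assumes "P \<in> Weyl" "Q \<in> Weyl"
  shows "(\<lambda>f z. P f z + Q f z) \<in> Weyl"
proof -
  obtain S d where S: "finite S" and P: "P = (\<lambda>f z. \<Sum>p\<in>S. d p * mono_op (fst p) (snd p) f z)"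
    using assms unfolding Weyl_def by blast
  have "(\<lambda>f z. (\<Sum>p\<in>S. d p * mono_op (fst p) (snd p) f z) + Q f z) \<in> Weyl"
    using S
  proof induction
    case (insert p S)
    then show ?case using Weyl_add_mono[OF insert.IH, of "d p" "fst p" "snd p"] by (simp add: add.assoc)
  qed (use assms in simp)
  then show ?thesis by (simp add: P)
qed

lemma Weyl_sum: "(\<And>i. i \<in> I \<Longrightarrow> P i \<in> Weyl) \<Longrightarrow> (\<lambda>f z. \<Sum>i\<in>I. P i f z) \<in> Weyl"
  by (induction I rule: infinite_finite_induct) (simp_all add: Weyl_0 Weyl_add)

text \<open>In homogeneous form composition is the translation rule \<open>shift_op_comp\<close>; no
  Leibniz formula for \<open>t^a \<partial>^b\<close> is required.\<close>

lemma Weyl_comp: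
  assumes "P \<in> Weyl" "Q \<in> Weyl"
  shows "P \<circ> Q \<in> Weyl"
proof -
  obtain F p where p: "finite F" "\<And>a. polyfun (p a)" "P = (\<lambda>f z. \<Sum>a\<in>F. shift_op a (p a) f z)"
    by (rule Weyl_decompose[OF assms(1)]) blast
  obtain G q where q: "finite G" "\<And>a. polyfun (q a)" "Q = (\<lambda>f z. \<Sum>a\<in>G. shift_op a (q a) f z)"
    by (rule Weyl_decompose[OF assms(2)]) blast
  have "P \<circ> Q = (\<lambda>f z. \<Sum>a\<in>F. \<Sum>b\<in>G. (shift_op a (p a) \<circ> shift_op b (q b)) f z)"
    by (simp add: p(3) q(3) fun_eq_iff shift_op_def sum_distrib_left)
  also have "\<dots> \<in> Weyl"
    unfolding shift_op_comp
    by (intro Weyl_sum shift_op_in_Weyl polyfun_mult polyfun_translate p(2) q(2))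
  finally show ?thesis .
qed

lemma RA_add:
  assumes "f \<in> RA A" "g \<in> RA A"
  shows "(\<lambda>z. f z + g z) \<in> RA A"
proof -
  have *: "{z. f z + g z \<noteq> 0} \<subseteq> {z. f z \<noteq> 0} \<union> {z. g z \<noteq> 0}" by auto
  with assms have "finite {z. f z + g z \<noteq> 0}"
    unfolding RA_def LP_def by (auto intro: finite_subset)
  then show ?thesis using assms * unfolding RA_def LP_def by blast
qed

lemma DA_add: "P \<in> DA A \<Longrightarrow> Q \<in> DA A \<Longrightarrow> (\<lambda>f z. P f z + Q f z) \<in> DA A"
  unfolding DA_def by (simp add: Weyl_add RA_add)

lemma DA_comp: "P \<in> DA A \<Longrightarrow> Q \<in> DA A \<Longrightarrow> P \<circ> Q \<in> DA A"
  unfolding DA_def by (simp add: Weyl_comp)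

lemma scal_op_in_DA: "scal_op c \<in> DA A"
  using shift_op_0_in_DA[OF polyfun_const] by (simp add: shift_op_0_const)

lemma zero_in_DA: "(\<lambda>f z. 0) \<in> DA A"
  using scal_op_in_DA[of 0 A] by (simp add: scal_op_def)

lemma DA_sum: "(\<And>i. i \<in> I \<Longrightarrow> P i \<in> DA A) \<Longrightarrow> (\<lambda>f z. \<Sum>i\<in>I. P i f z) \<in> DA A"
  by (induction I rule: infinite_finite_induct) (simp_all add: zero_in_DA DA_add)

lemma id_in_DA: "id \<in> DA A"
  using scal_op_in_DA[of 1 A] by (simp add: scal_op_def id_def)

text \<open>The degree \<open>a\<close> part of \<open>D(R_A)\<close> is \<open>t^a I\<close> for an ideal \<open>I\<close> of polynomials in \<open>s\<close>;
  the condition is that \<open>\<beta>\<close> is not a zero of \<open>I\<close>.\<close>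

definition reach :: "(int^'n) set \<Rightarrow> complex^'n \<Rightarrow> int^'n \<Rightarrow> bool" where
  "reach A \<beta> a \<longleftrightarrow> (\<exists>q. polyfun q \<and> shift_op a q \<in> DA A \<and> q \<beta> \<noteq> 0)"

section \<open>Weight vectors in a D(R_A)-module\<close>

text \<open>The carrier is only an abelian group. Complex scalars act through
  \<open>scal_op\<close>, and linearity over \<complex> becomes commutation with these
  operators.\<close>

locale D_module =
  fixes A :: "(int^'n) set" and act :: "'n op \<Rightarrow> 'b::ab_group_add \<Rightarrow> 'b"
  assumes dmod: "dmodule A act"
begin

lemma act_add_right: "P \<in> DA A \<Longrightarrow> act P (x + y) = act P x + act P y"
  and act_add_left: "P \<in> DA A \<Longrightarrow> Q \<in> DA A \<Longrightarrow> act (\<lambda>f z. P f z + Q f z) x = act P x + act Q x"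
  and act_comp: "P \<in> DA A \<Longrightarrow> Q \<in> DA A \<Longrightarrow> act P (act Q x) = act (P \<circ> Q) x"
  and act_id: "act id x = x"
  using dmod unfolding dmodule_def by auto

lemma act_zero_left: "act (\<lambda>f z. 0) x = 0"
  using act_add_left[OF zero_in_DA zero_in_DA, of x] by simp

lemma act_zero_right: "P \<in> DA A \<Longrightarrow> act P 0 = 0"
  using act_add_right[of P 0 0] by simp

lemma act_sum_left:
  "finite I \<Longrightarrow> (\<And>i. i \<in> I \<Longrightarrow> P i \<in> DA A) \<Longrightarrow>
    act (\<lambda>f z. \<Sum>i\<in>I. P i f z) x = (\<Sum>i\<in>I. act (P i) x)"
  by (induction I rule: finite_induct) (simp_all add: act_zero_left act_add_left DA_sum)

lemma act_sum_right:
  "finite I \<Longrightarrow> P \<in> DA A \<Longrightarrow> act P (\<Sum>i\<in>I. f i) = (\<Sum>i\<in>I. act P (f i))"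
  by (induction I rule: finite_induct) (simp_all add: act_zero_right act_add_right)

lemma act_scal_scal: "act (scal_op c) (act (scal_op d) x) = act (scal_op (c * d)) x"
  by (simp add: act_comp scal_op_in_DA) (simp add: scal_op_def o_def mult.assoc)

lemma act_scal_0: "act (scal_op 0) x = 0"
  by (simp add: scal_op_def act_zero_left)

lemma act_scal_1: "act (scal_op 1) x = x"
  using act_id by (simp add: scal_op_def id_def)

lemma act_scal_add: "act (scal_op (c + d)) x = act (scal_op c) x + act (scal_op d) x"
  using act_add_left[OF scal_op_in_DA scal_op_in_DA, of c d x] by (simp add: scal_op_def distrib_right)

lemma act_scal_eq_0: "c \<noteq> 0 \<Longrightarrow> act (scal_op c) x = 0 \<Longrightarrow> x = 0"
  using act_scal_scal[of "inverse c" c x] by (simp add: act_scal_1 act_zero_right scal_op_in_DA)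

lemma act_shift_scal:
  "shift_op a p \<in> DA A \<Longrightarrow> act (shift_op a p) (act (scal_op c) x) = act (scal_op c) (act (shift_op a p) x)"
  by (simp add: act_comp scal_op_in_DA) (simp add: scal_op_def shift_op_def o_def mult.left_commute)

definition weight_vec :: "complex^'n \<Rightarrow> 'b \<Rightarrow> bool" where
  "weight_vec \<beta> u \<longleftrightarrow> (\<forall>i. act (s_op i) u = act (scal_op (\<beta> $ i)) u)"

lemma weight_vec_polyfun:
  assumes "weight_vec \<beta> u" "polyfun p"
  shows "act (shift_op 0 p) u = act (scal_op (p \<beta>)) u"
  using assms(2)
proof induction
  case (polyfun_const c)
  show ?case by (simp add: shift_op_0_const)
next
  case (polyfun_coord p i)
  have "act (shift_op 0 (\<lambda>x. x $ i * p x)) u = act (shift_op 0 p) (act (s_op i) u)"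
    using polyfun_coord.hyps
    by (simp add: act_comp shift_op_0_in_DA polyfun_nth shift_op_comp mult.commute flip: shift_op_0_coord)
  also have "\<dots> = act (scal_op (\<beta> $ i)) (act (scal_op (p \<beta>)) u)"
    using assms(1) polyfun_coord by (simp add: weight_vec_def act_shift_scal shift_op_0_in_DA)
  finally show ?case by (simp add: act_scal_scal)
next
  case (polyfun_add p q)
  then show ?case by (simp add: shift_op_add act_add_left shift_op_0_in_DA act_scal_add)
qed

lemma weight_vec_shift:
  assumes "weight_vec \<beta> u" "shift_op a p \<in> DA A"
  shows "weight_vec (\<beta> + ivec a) (act (shift_op a p) u)"
  unfolding weight_vec_def
proof
  fix i
  let ?c = "\<lambda>x :: complex^'n. x $ i + of_int (a $ i)"
  have c: "polyfun ?c" by (intro polyfun_add polyfun_nth polyfun_const)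
  have "act (s_op i) (act (shift_op a p) u) = act (shift_op a p) (act (shift_op 0 ?c) u)"
    using assms(2) c
    by (simp add: act_comp shift_op_0_in_DA polyfun_nth shift_op_comp mult.commute flip: shift_op_0_coord)
  also have "\<dots> = act (scal_op ((\<beta> + ivec a) $ i)) (act (shift_op a p) u)"
    using assms c by (simp add: weight_vec_polyfun act_shift_scal)
  finally show "act (s_op i) (act (shift_op a p) u) = act (scal_op ((\<beta> + ivec a) $ i)) (act (shift_op a p) u)" .
qed

text \<open>Going from weight \<beta> to \<open>\<beta> + a\<close> and back has degree zero, hence
  acts as a scalar. Its two factors are the quantities whose nonvanishing \<open>reach\<close>
  expresses in the two directions.\<close>

lemma act_shift_shift:
  assumes "weight_vec \<beta> u" "polyfun p" "polyfun q" "shift_op a p \<in> DA A" "shift_op (- a) q \<in> DA A"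
  shows "act (shift_op (- a) q) (act (shift_op a p) u) = act (scal_op (q (\<beta> + ivec a) * p \<beta>)) u"
  using assms
  by (simp add: act_comp shift_op_comp weight_vec_polyfun polyfun_mult polyfun_translate)

text \<open>The summands have pairwise different weights, so a polynomial in \<open>s\<close> that
  is 1 at one of them and 0 at the others isolates a single summand.\<close>

lemma weight_component:
  assumes "weight_vec \<beta> u" "finite F" "\<And>a. a \<in> F \<Longrightarrow> shift_op a (p a) \<in> DA A"
  obtains g where "polyfun g" "g (\<beta> + ivec b) = 1"
    "act (shift_op 0 g) (\<Sum>a\<in>F. act (shift_op a (p a)) u) = (if b \<in> F then act (shift_op b (p b)) u else 0)"
proof -
  have "\<beta> + ivec b \<notin> (\<lambda>a. \<beta> + ivec a) ` (F - {b})" by auto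
  then obtain g where g: "polyfun g" "g (\<beta> + ivec b) = 1"
      "\<And>y. y \<in> (\<lambda>a. \<beta> + ivec a) ` (F - {b}) \<Longrightarrow> g y = 0"
    using polyfun_interpolate[of "(\<lambda>a. \<beta> + ivec a) ` (F - {b})" "\<beta> + ivec b"] assms(2)
    by (metis finite_Diff finite_imageI)
  have "act (shift_op 0 g) (\<Sum>a\<in>F. act (shift_op a (p a)) u) =
      (\<Sum>a\<in>F. act (scal_op (g (\<beta> + ivec a))) (act (shift_op a (p a)) u))"
    using assms g(1)
    by (auto simp: act_sum_right shift_op_0_in_DA weight_vec_polyfun[OF weight_vec_shift] intro!: sum.cong)
  also have "\<dots> = (\<Sum>a\<in>F. if a = b then act (shift_op b (p b)) u else 0)"
    using g(2,3) by (intro sum.cong) (auto simp: act_scal_0 act_scal_1)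
  also have "\<dots> = (if b \<in> F then act (shift_op b (p b)) u else 0)"
    using assms(2) by simp
  finally show ?thesis using that g by blast
qed

lemma simple_generated:
  assumes "dsimple A act" "u \<noteq> 0"
  obtains P where "P \<in> DA A" "y = act P u"
proof -
  have "dsubmodule A act {act P u | P. P \<in> DA A}"
    unfolding dsubmodule_def
  proof (intro conjI ballI)
    show "0 \<in> {act P u | P. P \<in> DA A}" using act_zero_left zero_in_DA by force
    fix x assume x: "x \<in> {act P u | P. P \<in> DA A}"
    show "x + w \<in> {act P u | P. P \<in> DA A}" if w: "w \<in> {act P u | P. P \<in> DA A}" for w
    proof -
      obtain P Q where "P \<in> DA A" "Q \<in> DA A" "x = act P u" "w = act Q u" using x w by blast
      then show ?thesis using act_add_left[of P Q u] DA_add[of P A Q] by force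
    qed
    show "act P x \<in> {act P u | P. P \<in> DA A}" if "P \<in> DA A" for P
      using x that act_comp DA_comp by fastforce
  qed
  moreover have "u \<in> {act P u | P. P \<in> DA A}" using id_in_DA act_id[of u, symmetric] by blast
  ultimately have "{act P u | P. P \<in> DA A} = UNIV"
    using assms unfolding dsimple_def by blast
  then show ?thesis using that by blast
qed

text \<open>Simplicity provides an operator that carries the vector of weight
  \<open>\<alpha> + a\<close> back to \<open>v\<close>. Comparing components of weight \<alpha>, its
  part of degree \<open>-a\<close> already does so, and the resulting scalar must be 1.\<close>

lemma simple_weight_reach:
  assumes "dsimple A act" "weight_vec \<alpha> v" "v \<noteq> 0"
    and q: "polyfun q" "shift_op a q \<in> DA A" and nz: "act (shift_op a q) v \<noteq> 0"
  obtains r where "polyfun r" "shift_op (- a) r \<in> DA A" "q \<alpha> \<noteq> 0" "r (\<alpha> + ivec a) \<noteq> 0"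
proof -
  let ?u = "act (shift_op a q) v"
  obtain P where P: "P \<in> DA A" "v = act P ?u" using simple_generated[OF assms(1) nz] .
  obtain F p where p: "finite F" "\<And>b. polyfun (p b)" "\<And>b. b \<in> F \<Longrightarrow> shift_op b (p b) \<in> DA A"
    "P = (\<lambda>f z. \<Sum>b\<in>F. shift_op b (p b) f z)" by (rule DA_decompose[OF P(1)]) blast
  have v: "v = (\<Sum>b\<in>F. act (shift_op b (p b)) ?u)"
    using P(2) p by (simp add: act_sum_left)
  have u: "weight_vec (\<alpha> + ivec a) ?u" by (rule weight_vec_shift[OF assms(2) q(2)])
  obtain g where g: "polyfun g" "g (\<alpha> + ivec a + ivec (- a)) = 1"
      "act (shift_op 0 g) (\<Sum>b\<in>F. act (shift_op b (p b)) ?u) =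
      (if - a \<in> F then act (shift_op (- a) (p (- a))) ?u else 0)"
    using weight_component[OF u p(1,3), of "- a"] .
  note g(3)[folded v]
  moreover
  have "act (shift_op 0 g) v = v"
    using weight_vec_polyfun[OF assms(2) g(1)] g(2) by (simp add: ivec_minus act_scal_1)
  ultimately have F: "- a \<in> F" and "v = act (shift_op (- a) (p (- a))) ?u"
    using assms(3) by (auto split: if_splits)
  then have "v = act (scal_op (p (- a) (\<alpha> + ivec a) * q \<alpha>)) v"
    using act_shift_shift[OF assms(2) q(1) p(2) q(2) p(3)[OF F]] by simp
  then have "p (- a) (\<alpha> + ivec a) * q \<alpha> \<noteq> 0" using assms(3) act_scal_0 by metis
  then show ?thesis using that[of "p (- a)"] p(2) p(3)[OF F] by auto
qed

text \<open>Every element of the module is a sum of vectors obtained from \<open>v\<close> by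
  homogeneous operators. Where such a vector is nonzero, its weight is reachable both ways, and
  there \<open>p(s)\<close> acts by a value of \<open>p\<close> that is zero.\<close>

lemma Ann_nonzero:
  assumes "dsimple A act" "weight_vec \<alpha> v" "v \<noteq> 0"
    and p: "polyfun p" "p x \<noteq> 0"
    and vanish: "\<And>a. reach A \<alpha> a \<Longrightarrow> reach A (\<alpha> + ivec a) (- a) \<Longrightarrow> p (\<alpha> + ivec a) = 0"
  shows "shift_op 0 p \<in> Ann A act"
proof -
  have "act (shift_op 0 p) y = 0" for y
  proof -
    obtain P where P: "P \<in> DA A" "y = act P v" using simple_generated[OF assms(1,3)] .
    obtain F q where q: "finite F" "\<And>b. polyfun (q b)" "\<And>b. b \<in> F \<Longrightarrow> shift_op b (q b) \<in> DA A"
      "P = (\<lambda>f z. \<Sum>b\<in>F. shift_op b (q b) f z)" by (rule DA_decompose[OF P(1)]) blast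
    have "act (shift_op 0 p) (act (shift_op b (q b)) v) = 0" if b: "b \<in> F" for b
    proof (cases "act (shift_op b (q b)) v = 0")
      case True
      then show ?thesis by (simp add: act_zero_right shift_op_0_in_DA p)
    next
      case False
      obtain r where "polyfun r" "shift_op (- b) r \<in> DA A" "q b \<alpha> \<noteq> 0" "r (\<alpha> + ivec b) \<noteq> 0"
        using simple_weight_reach[OF assms(1-3) q(2) q(3)[OF b] False] .
      then have "p (\<alpha> + ivec b) = 0" using q(2) q(3)[OF b] vanish unfolding reach_def by metis
      then show ?thesis
        using weight_vec_polyfun[OF weight_vec_shift[OF assms(2) q(3)[OF b]] p(1)]
        by (simp add: act_scal_0)
    qed
    then show ?thesis using P(2) q p(1) by (simp add: act_sum_left act_sum_right shift_op_0_in_DA)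
  qed
  then show ?thesis unfolding Ann_def using shift_op_0_in_DA[OF p(1)] by blast
qed

text \<open>A homogeneous part \<open>t^b p(s)\<close> kills every vector \<open>u\<close> of weight
  \<beta>, but this does not yet give \<open>p(\<beta>) = 0\<close>, because
  \<open>\<beta> + b\<close> need not be a weight. Returning by an operator
  \<open>t^(-b) r(s)\<close> yields the scalar \<open>r(\<beta> + b) p(\<beta>)\<close>, which
  vanishes on a dense set. As \<open>r\<close> is not identically zero, \<open>p\<close> is.\<close>

lemma Ann_zero:
  assumes "weight_vec \<alpha> v" "v \<noteq> 0"
    and reach: "\<And>a. a \<in> G \<Longrightarrow> reach A \<alpha> a \<and> reach A (\<alpha> + ivec a) (- a)"
    and dense: "\<And>p x. polyfun p \<Longrightarrow> (\<And>a. a \<in> G \<Longrightarrow> p (\<alpha> + ivec a) = 0) \<Longrightarrow> p x = 0"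
    and nonzero: "\<And>a. \<exists>r y. polyfun r \<and> shift_op a r \<in> DA A \<and> r y \<noteq> 0"
  shows "Ann A act = {\<lambda>f z. 0}"
proof -
  have "P = (\<lambda>f z. 0)" if "P \<in> Ann A act" for P
  proof -
    have P: "P \<in> DA A" "\<And>x. act P x = 0" using that by (auto simp: Ann_def)
    obtain F p where p: "finite F" "\<And>b. polyfun (p b)" "\<And>b. b \<in> F \<Longrightarrow> shift_op b (p b) \<in> DA A"
      "P = (\<lambda>f z. \<Sum>b\<in>F. shift_op b (p b) f z)" by (rule DA_decompose[OF P(1)]) blast
    have "p b x = 0" if b: "b \<in> F" for b x
    proof -
      obtain r y where r: "polyfun r" "shift_op (- b) r \<in> DA A" "r y \<noteq> 0" using nonzero by blast
      let ?r = "\<lambda>x. r (x + ivec b)"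
      have "p b (\<alpha> + ivec a) * ?r (\<alpha> + ivec a) = 0" if a: "a \<in> G" for a
      proof -
        let ?\<beta> = "\<alpha> + ivec a"
        obtain q q' where q: "polyfun q" "shift_op a q \<in> DA A" "q \<alpha> \<noteq> 0"
            and q': "polyfun q'" "shift_op (- a) q' \<in> DA A" "q' ?\<beta> \<noteq> 0"
          using reach[OF a] unfolding reach_def by metis
        define u where "u = act (shift_op a q) v"
        have u: "weight_vec ?\<beta> u" unfolding u_def by (rule weight_vec_shift[OF assms(1) q(2)])
        \<comment> \<open>\<open>q'\<close> carries \<open>u\<close> back to a nonzero multiple of
          \<open>v\<close>, so \<open>u\<close> itself is nonzero.\<close>
        have "act (shift_op (- a) q') u \<noteq> 0"
          unfolding u_def act_shift_shift[OF assms(1) q(1) q'(1) q(2) q'(2)]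
          using act_scal_eq_0[of "q' ?\<beta> * q \<alpha>" v] q(3) q'(3) assms(2) by auto
        then have u0: "u \<noteq> 0" using act_zero_right[OF q'(2)] by auto
        obtain g where "polyfun g" "g (?\<beta> + ivec b) = 1"
            "act (shift_op 0 g) (\<Sum>c\<in>F. act (shift_op c (p c)) u) =
            (if b \<in> F then act (shift_op b (p b)) u else 0)"
          using weight_component[OF u p(1,3), of b] .
        moreover have "(\<Sum>c\<in>F. act (shift_op c (p c)) u) = 0"
          using P(2)[of u] p by (simp add: act_sum_left)
        ultimately have "act (shift_op b (p b)) u = 0"
          using b by (simp add: act_zero_right shift_op_0_in_DA)
        with act_shift_shift[OF u p(2) r(1) p(3)[OF b] r(2)]
        have "act (scal_op (r (?\<beta> + ivec b) * p b ?\<beta>)) u = 0"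
          by (simp add: act_zero_right r(2))
        with u0 show ?thesis using act_scal_eq_0[of "r (?\<beta> + ivec b) * p b ?\<beta>" u] by auto
      qed
      then have "p b x * ?r x = 0" for x
        by (rule dense[OF polyfun_mult[OF p(2) polyfun_translate[OF r(1)]]])
      from polyfun_mult_eq_zero[OF p(2) polyfun_translate[OF r(1)] this, of "y - ivec b" x]
      show ?thesis using r(3) by simp
    qed
    then show ?thesis unfolding p(4) by (simp add: fun_eq_iff shift_op_def)
  qed
  moreover have "(\<lambda>f z. 0) \<in> Ann A act"
    unfolding Ann_def by (simp add: zero_in_DA act_zero_left)
  ultimately show ?thesis by blast
qed

end

section \<open>Cones, facets and their primitive forms\<close>

text \<open>Needed twice: for the coefficients of a combination in
  \<open>multiple_of_combination\<close> and for the coordinates of a facet normal in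
  \<open>is_Fform_exists\<close>.\<close>

lemma Dirichlet_approx_finite:
  fixes \<theta> :: "'i \<Rightarrow> real"
  assumes "finite I" "\<epsilon> > 0"
  obtains q :: nat and p :: "'i \<Rightarrow> int"
    where "q > 0" "\<And>i. i \<in> I \<Longrightarrow> \<bar>of_nat q * \<theta> i - of_int (p i)\<bar> < \<epsilon>"
proof -
  obtain h where h: "bij_betw h {0..<card I} I"
    using ex_bij_betw_nat_finite[OF assms(1)] by blast
  define N where "N = nat \<lceil>1 / \<epsilon>\<rceil>"
  have N: "N > 0" "1 / real N \<le> \<epsilon>"
  proof -
    show "N > 0" using assms(2) by (simp add: N_def)
    have "1 / \<epsilon> \<le> real N" using assms(2) by (simp add: N_def)
    then show "1 / real N \<le> \<epsilon>" using assms(2) \<open>N > 0\<close> by (simp add: field_simps)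
  qed
  obtain q p where q: "0 < q" and
    p: "\<And>i. i < card I \<Longrightarrow> \<bar>of_int q * \<theta> (h i) - of_int (p i)\<bar> < 1 / N"
    using Dirichlet_approx_simult[OF N(1), of "card I" "\<lambda>i. \<theta> (h i)"] by metis
  define g where "g = the_inv_into {0..<card I} h"
  have g: "g i < card I" "h (g i) = i" if "i \<in> I" for i
    using that h the_inv_into_into[of h "{0..<card I}" i "{0..<card I}"] f_the_inv_into_f_bij_betw[OF h]
    unfolding g_def bij_betw_def by auto
  show ?thesis
  proof (rule that[of "nat q" "\<lambda>i. p (g i)"])
    show "nat q > 0" using q by simp
    show "\<bar>of_nat (nat q) * \<theta> i - of_int (p (g i))\<bar> < \<epsilon>" if "i \<in> I" for i
      using p[OF g(1)[OF that]] g(2)[OF that] N(2) q by simp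
  qed
qed

lemma abs_sum_mult_le: "\<bar>\<Sum>i\<in>I. f i * g i\<bar> \<le> (\<Sum>i\<in>I. \<bar>f i\<bar> * \<bar>g i\<bar>)"
  for f g :: "'i \<Rightarrow> real"
  by (simp add: sum_abs flip: abs_mult)

lemma finite_int_box: "finite {z :: int^'n. \<forall>i. \<bar>z $ i\<bar> \<le> B}"
proof (rule finite_subset)
  show "{z :: int^'n. \<forall>i. \<bar>z $ i\<bar> \<le> B} \<subseteq> vec_lambda ` (UNIV \<rightarrow>\<^sub>E {-B..B})"
  proof
    fix z :: "int^'n" assume "z \<in> {z. \<forall>i. \<bar>z $ i\<bar> \<le> B}"
    then have "vec_nth z \<in> UNIV \<rightarrow>\<^sub>E {-B..B}" by (auto simp: abs_le_iff minus_le_iff)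
    moreover have "z = vec_lambda (vec_nth z)" by simp
    ultimately show "z \<in> vec_lambda ` (UNIV \<rightarrow>\<^sub>E {-B..B})" by blast
  qed
qed (intro finite_imageI finite_PiE; simp)

text \<open>The remainder has the fractional parts as coefficients, so its size does not depend on
  \<open>c\<close>. Hence only finitely many remainders occur, which serves both the conductor and
  the finiteness of the index.\<close>

lemma round_combination:
  fixes S :: "(int^'n) set"
  assumes "(ivec x :: real^'n) = (\<Sum>a\<in>S. c a *\<^sub>R ivec a)"
  shows "\<bar>(x - (\<Sum>a\<in>S. \<lfloor>c a\<rfloor> *s a)) $ i\<bar> \<le> (\<Sum>a\<in>S. \<Sum>i\<in>UNIV. \<bar>a $ i\<bar>)"
proof -
  let ?r = "x - (\<Sum>a\<in>S. \<lfloor>c a\<rfloor> *s a)"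
  have "real_of_int (x $ i) = (\<Sum>a\<in>S. c a * of_int (a $ i))"
    using arg_cong[OF assms, of "\<lambda>v. v $ i"] by simp
  then have "real_of_int (?r $ i) = (\<Sum>a\<in>S. (c a - \<lfloor>c a\<rfloor>) * of_int (a $ i))"
    by (simp add: left_diff_distrib sum_subtractf)
  then have "real_of_int \<bar>?r $ i\<bar> \<le> (\<Sum>a\<in>S. \<bar>c a - \<lfloor>c a\<rfloor>\<bar> * \<bar>of_int (a $ i)\<bar>)"
    by (simp only: abs_sum_mult_le of_int_abs)
  also have "\<dots> \<le> (\<Sum>a\<in>S. 1 * of_int (\<Sum>i\<in>UNIV. \<bar>a $ i\<bar>))"
  proof (intro sum_mono mult_mono)
    fix a :: "int^'n"
    have "\<bar>a $ i\<bar> \<le> (\<Sum>i\<in>UNIV. \<bar>a $ i\<bar>)" by (rule member_le_sum) auto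
    then show "\<bar>real_of_int (a $ i)\<bar> \<le> of_int (\<Sum>i\<in>UNIV. \<bar>a $ i\<bar>)" by linarith
    show "\<bar>c a - \<lfloor>c a\<rfloor>\<bar> \<le> 1" by linarith
  qed auto
  also have "\<dots> = of_int (\<Sum>a\<in>S. \<Sum>i\<in>UNIV. \<bar>a $ i\<bar>)" by simp
  finally show ?thesis by (simp only: of_int_le_iff)
qed

text \<open>By simultaneous approximation, some multiple of a real combination of integer vectors
  lies within distance less than one of an integral combination, hence equals it.\<close>

lemma multiple_of_combination:
  fixes S :: "(int^'n) set"
  assumes "finite S" "(ivec x :: real^'n) = (\<Sum>a\<in>S. c a *\<^sub>R ivec a)"
  obtains q :: nat and p where "q > 0" "of_nat q *s x = (\<Sum>a\<in>S. p a *s a)"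
    "\<forall>a\<in>S. \<bar>real q * c a - of_int (p a)\<bar> < 1"
proof -
  \<comment> \<open>With coefficient errors below \<open>1 / B\<close> the total error in each
    coordinate is below 1; the summand 1 keeps \<open>B\<close> positive and makes this
    strict.\<close>
  define B where "B = 1 + (\<Sum>a\<in>S. \<Sum>i\<in>UNIV. \<bar>a $ i\<bar>)"
  have B: "B \<ge> 1" unfolding B_def by (simp add: sum_nonneg)
  then have "1 / real_of_int B > 0" by simp
  then obtain q p where q: "q > 0" and p: "\<And>a. a \<in> S \<Longrightarrow> \<bar>real q * c a - of_int (p a)\<bar> < 1 / B"
    using Dirichlet_approx_finite[of S "1 / B" c] assms(1) by metis
  have B1: "1 / real_of_int B \<le> 1" using B by simp
  have "\<bar>(of_nat q *s x - (\<Sum>a\<in>S. p a *s a)) $ i\<bar> < 1" for i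
  proof -
    have "real_of_int (x $ i) = (\<Sum>a\<in>S. c a * of_int (a $ i))"
      using arg_cong[OF assms(2), of "\<lambda>v. v $ i"] by simp
    then have "real_of_int ((of_nat q *s x - (\<Sum>a\<in>S. p a *s a)) $ i) =
        (\<Sum>a\<in>S. (real q * c a - of_int (p a)) * of_int (a $ i))"
      by (simp add: sum_distrib_left left_diff_distrib sum_subtractf mult.assoc)
    then have "real_of_int \<bar>(of_nat q *s x - (\<Sum>a\<in>S. p a *s a)) $ i\<bar>
        \<le> (\<Sum>a\<in>S. \<bar>real q * c a - of_int (p a)\<bar> * \<bar>of_int (a $ i)\<bar>)"
      by (simp only: abs_sum_mult_le of_int_abs)
    also have "\<dots> \<le> (\<Sum>a\<in>S. (1 / B) * of_int (\<Sum>i\<in>UNIV. \<bar>a $ i\<bar>))"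
    proof (intro sum_mono mult_mono)
      fix a assume "a \<in> S"
      then show "\<bar>real q * c a - of_int (p a)\<bar> \<le> 1 / B" using p by fastforce
      have "\<bar>a $ i\<bar> \<le> (\<Sum>i\<in>UNIV. \<bar>a $ i\<bar>)" by (rule member_le_sum) auto
      then show "\<bar>real_of_int (a $ i)\<bar> \<le> of_int (\<Sum>i\<in>UNIV. \<bar>a $ i\<bar>)" by linarith
    qed (use B in auto)
    also have "\<dots> = real_of_int (\<Sum>a\<in>S. \<Sum>i\<in>UNIV. \<bar>a $ i\<bar>) / real_of_int B"
      by (simp add: sum_divide_distrib)
    also have "\<dots> < 1" using B by (subst divide_less_eq_1_pos) (simp_all add: B_def del: of_int_sum)
    finally show ?thesis by linarith
  qed
  then have "(of_nat q *s x - (\<Sum>a\<in>S. p a *s a)) $ i = 0" for i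
    by (metis zabs_less_one_iff)
  then have "of_nat q *s x - (\<Sum>a\<in>S. p a *s a) = 0" by (simp only: vec_eq_iff zero_index simp_thms)
  then show ?thesis using that[of q p] q p B1 by fastforce
qed

lemma inner_ivec: "inner (ivec k :: real^'n) (ivec z) = of_int (\<Sum>i\<in>UNIV. k $ i * z $ i)"
  by (simp add: inner_vec_def)

text \<open>The values of the form \<open>k\<close> are a subgroup of the integers. Its least
  positive element \<open>m\<close> divides all values, in particular the coordinates of
  \<open>k\<close>, and dividing by \<open>m\<close> makes the form surjective.\<close>

lemma primitive_multiple:
  fixes k :: "int^'n"
  assumes "k \<noteq> 0"
  obtains m :: int and k' :: "int^'n" where "m > 0" "k = m *s k'"
    "range (\<lambda>z. inner (ivec k' :: real^'n) (ivec z)) = \<int>"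
proof -
  define f where "f z = (\<Sum>i\<in>UNIV. k $ i * z $ i)" for z :: "int^'n"
  have f_add: "f (y + z) = f y + f z" and f_scale: "f (c *s y) = c * f y" for y z c
    by (simp_all add: f_def algebra_simps sum.distrib sum_distrib_left)
  have f_axis: "f (axis i 1) = k $ i" for i
    by (simp add: f_def axis_def if_distrib[of "\<lambda>x. _ * x"] cong: if_cong)
  obtain i where i: "k $ i \<noteq> 0" using assms by (auto simp: vec_eq_iff)
  define Q where "Q n \<longleftrightarrow> n > 0 \<and> (\<exists>z. f z = int n)" for n
  have "f ((k $ i) *s axis i 1) = (k $ i) * (k $ i)" by (simp only: f_scale f_axis)
  then have "Q (nat (k $ i * k $ i))" unfolding Q_def using i
    by (auto simp: zero_less_mult_iff intro!: exI[of _ "(k $ i) *s axis i 1"])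
  then have Q: "Q (LEAST n. Q n)" by (rule LeastI)
  define m where "m = int (LEAST n. Q n)"
  obtain z0 where z0: "f z0 = m" and m: "m > 0" using Q unfolding Q_def m_def by auto
  have dvd: "m dvd f z" for z
  proof (rule ccontr)
    assume "\<not> m dvd f z"
    then have "f z mod m > 0" using m by (metis dvd_eq_mod_eq_0 order_le_less pos_mod_sign)
    \<comment> \<open>The remainder of a division by \<open>m\<close> is again a value of the form,
      smaller than the least positive one.\<close>
    moreover have "f (z + (- (f z div m)) *s z0) = f z mod m"
      unfolding f_add f_scale z0 by (simp add: minus_mult_div_eq_mod[symmetric])
    ultimately have "Q (nat (f z mod m))" unfolding Q_def
      by (auto intro!: exI[of _ "z + (- (f z div m)) *s z0"])
    then have "(LEAST n. Q n) \<le> nat (f z mod m)" by (rule Least_le)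
    moreover have "f z mod m < m" using m by simp
    ultimately show False using m unfolding m_def by linarith
  qed
  define k' where "k' = (\<chi> i. k $ i div m)"
  have k: "k = m *s k'" using dvd[of "axis _ 1"] by (simp add: k'_def vec_eq_iff f_axis)
  define f' where "f' z = (\<Sum>i\<in>UNIV. k' $ i * z $ i)" for z :: "int^'n"
  have "f z = m * f' z" for z unfolding f_def f'_def by (subst k) (simp add: sum_distrib_left mult.assoc)
  with z0 m have f': "f' z0 = 1" by simp
  have "range (\<lambda>z. inner (ivec k' :: real^'n) (ivec z)) = \<int>"
  proof (intro subset_antisym subsetI)
    fix r :: real assume "r \<in> \<int>"
    then obtain n where "r = of_int n" by (rule Ints_cases)
    moreover have "inner (ivec k' :: real^'n) (ivec (n *s z0)) = of_int (n * f' z0)"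
      by (simp add: inner_ivec f'_def sum_distrib_left algebra_simps)
    ultimately show "r \<in> range (\<lambda>z. inner (ivec k' :: real^'n) (ivec z))"
      using f' by (auto intro!: image_eqI[of _ _ "n *s z0"])
  qed (auto simp: inner_ivec)
  with m k show ?thesis by (rule that)
qed

section \<open>The cone of A and its faces\<close>

locale affine_monoid =
  fixes A :: "(int^'n::finite) set"
  assumes fin: "finite A" and gen: "Zspan A = UNIV"
begin

lemma fin_Aface: "finite (Aface A \<tau>)"
  using fin by (simp add: Aface_def)

lemma Aface_subset: "Aface A \<tau> \<subseteq> A"
  by (auto simp: Aface_def)

lemma cone_cases:
  assumes "x \<in> cone A"
  obtains c where "\<And>a. a \<in> A \<Longrightarrow> 0 \<le> c a" "x = (\<Sum>a\<in>A. c a *\<^sub>R ivec a)"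
  using assms unfolding cone_finite[OF fin] by (auto simp: scalar_mult_eq_scaleR)

lemma coneI: "(\<And>a. a \<in> A \<Longrightarrow> 0 \<le> c a) \<Longrightarrow> (\<Sum>a\<in>A. c a *\<^sub>R ivec a) \<in> cone A"
  unfolding cone_finite[OF fin] by (auto simp: scalar_mult_eq_scaleR)

lemma convex_cone_cone: "convex_cone (cone A)"
  unfolding convex_cone_iff
proof (intro conjI ballI allI impI)
  show "0 \<in> cone A" using coneI[of "\<lambda>_. 0"] by simp
  fix x assume "x \<in> cone A"
  then obtain c where c: "\<And>a. a \<in> A \<Longrightarrow> 0 \<le> c a" "x = (\<Sum>a\<in>A. c a *\<^sub>R ivec a)"
    by (rule cone_cases) blast
  show "t *\<^sub>R x \<in> cone A" if "0 \<le> t" for t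
    using coneI[of "\<lambda>a. t * c a"] c that by (simp add: scaleR_sum_right)
  fix y assume "y \<in> cone A"
  then obtain d where d: "\<And>a. a \<in> A \<Longrightarrow> 0 \<le> d a" "y = (\<Sum>a\<in>A. d a *\<^sub>R ivec a)"
    by (rule cone_cases) blast
  show "x + y \<in> cone A"
    using coneI[of "\<lambda>a. c a + d a"] c d by (simp add: scaleR_add_left sum.distrib)
qed

lemmas cone_0 = convex_cone_contains_0[OF convex_cone_cone]

lemma cone_scale: "x \<in> cone A \<Longrightarrow> 0 \<le> c \<Longrightarrow> c *\<^sub>R x \<in> cone A"
  using convex_cone_cone unfolding convex_cone_iff by blast

lemma ivec_in_cone: "a \<in> A \<Longrightarrow> ivec a \<in> cone A"
  unfolding cone_def
  by (intro CollectI exI[of _ "{a}"] exI[of _ "\<lambda>_. 1"]) simp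

lemma ivec_Nspan_in_cone: "x \<in> Nspan A \<Longrightarrow> ivec x \<in> cone A"
proof -
  assume "x \<in> Nspan A"
  then obtain c where "x = (\<Sum>a\<in>A. of_nat (c a) *s a)" by (auto simp: Nspan_finite[OF fin])
  then have "(ivec x :: real^'n) = (\<Sum>a\<in>A. real (c a) *\<^sub>R ivec a)"
    by (simp add: ivec_sum ivec_scale scalar_mult_eq_scaleR)
  then show ?thesis using coneI[of "\<lambda>a. real (c a)"] by simp
qed

text \<open>Makes the cone a polyhedron, whose boundary is a union of facets.\<close>

lemma cone_eq_hull: "cone A = convex_cone hull (ivec ` A)"
proof
  show "cone A \<subseteq> convex_cone hull (ivec ` A)"
  proof
    fix x assume "x \<in> cone A"
    then obtain c where c: "\<And>a. a \<in> A \<Longrightarrow> 0 \<le> c a" "x = (\<Sum>a\<in>A. c a *\<^sub>R ivec a)"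
      by (rule cone_cases) blast
    have "(\<Sum>a\<in>S. c a *\<^sub>R ivec a) \<in> convex_cone hull (ivec ` A)" if "S \<subseteq> A" for S
      using finite_subset[OF that fin] that
      by (induction S rule: finite_induct)
        (simp_all add: convex_cone_hull_add convex_cone_hull_mul convex_cone_hull_contains_0 c(1)
          hull_inc[OF imageI])
    then show "x \<in> convex_cone hull (ivec ` A)" using c(2) by auto
  qed
  show "convex_cone hull (ivec ` A) \<subseteq> cone A"
    by (intro hull_minimal convex_cone_cone) (auto intro: ivec_in_cone)
qed

lemma polyhedron_cone: "polyhedron (cone A)"
  unfolding cone_eq_hull by (intro polyhedron_convex_cone_hull finite_imageI fin)

lemma span_generators: "span (ivec ` A :: (real^'n) set) = UNIV"
proof -
  have "axis i 1 \<in> span (ivec ` A :: (real^'n) set)" for i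
  proof -
    have "axis i 1 \<in> Zspan A" using gen by simp
    then obtain c where "axis i 1 = (\<Sum>a\<in>A. c a *s a)" by (auto simp: Zspan_finite[OF fin])
    then have "(ivec (axis i 1) :: real^'n) = (\<Sum>a\<in>A. of_int (c a) *\<^sub>R ivec a)"
      by (simp add: ivec_sum ivec_scale scalar_mult_eq_scaleR)
    moreover have "(ivec (axis i 1) :: real^'n) = axis i 1" by (simp add: vec_eq_iff axis_def)
    moreover have "(\<Sum>a\<in>A. of_int (c a) *\<^sub>R ivec a) \<in> span (ivec ` A :: (real^'n) set)"
      by (intro span_sum span_scale span_base imageI)
    ultimately show ?thesis by simp
  qed
  then have "Basis \<subseteq> span (ivec ` A :: (real^'n) set)" by (auto simp: Basis_vec_def)
  then show ?thesis by (metis span_Basis span_minimal subspace_span top.extremum_uniqueI)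
qed

lemma span_cone: "span (cone A) = UNIV"
proof -
  have "ivec ` A \<subseteq> cone A" using ivec_in_cone by auto
  from span_mono[OF this] span_generators show ?thesis by auto
qed

lemma exists_generator_nonzero:
  fixes w :: "real^'n"
  assumes "w \<noteq> 0"
  obtains a where "a \<in> A" "inner w (ivec a) \<noteq> 0"
proof -
  have False if "\<forall>a\<in>A. inner w (ivec a) = 0"
  proof -
    have "span (ivec ` A) \<subseteq> {x. inner w x = 0}"
      by (rule span_minimal) (use that in \<open>auto simp: subspace_hyperplane\<close>)
    then have "w \<in> {x. inner w x = 0}" unfolding span_generators by blast
    then show False using assms by simp
  qed
  then show ?thesis using that by blast
qed

lemma nonneg_form_zero_iff:
  assumes "\<And>a. a \<in> A \<Longrightarrow> 0 \<le> inner w (ivec a)" "\<And>a. a \<in> A \<Longrightarrow> 0 \<le> c a"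
  shows "inner w (\<Sum>a\<in>A. c a *\<^sub>R ivec a) = 0 \<longleftrightarrow> (\<forall>a\<in>A. c a = 0 \<or> inner w (ivec a) = 0)"
proof -
  have "inner w (\<Sum>a\<in>A. c a *\<^sub>R ivec a) = (\<Sum>a\<in>A. c a * inner w (ivec a))"
    by (simp add: inner_sum_right)
  then show ?thesis using assms fin by (simp add: sum_nonneg_eq_0_iff)
qed

lemma nonneg_form_cone:
  assumes "\<And>a. a \<in> A \<Longrightarrow> 0 \<le> inner w (ivec a)" "x \<in> cone A"
  shows "0 \<le> inner w x"
  using assms(2) by (rule cone_cases) (auto simp: inner_sum_right intro!: sum_nonneg mult_nonneg_nonneg assms(1))

lemma faceE:
  assumes "face A \<tau>"
  obtains w where "\<And>x. x \<in> cone A \<Longrightarrow> 0 \<le> inner w x" "\<tau> = {x \<in> cone A. inner w x = 0}"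
  using assms unfolding face_def by blast

lemma face_subset: "face A \<tau> \<Longrightarrow> \<tau> \<subseteq> cone A"
  by (auto simp: face_def)

text \<open>The supporting form is nonnegative on the generators and zero at \<open>x\<close>, so a
  generator off the face can only have coefficient 0.\<close>

lemma face_generated:
  assumes "face A \<tau>" "x \<in> \<tau>"
  obtains c where "\<And>a. a \<in> A \<Longrightarrow> 0 \<le> c a" "\<And>a. a \<in> A - Aface A \<tau> \<Longrightarrow> c a = 0" "x = (\<Sum>a\<in>A. c a *\<^sub>R ivec a)"
proof -
  obtain w where w: "\<And>x. x \<in> cone A \<Longrightarrow> 0 \<le> inner w x" "\<tau> = {x \<in> cone A. inner w x = 0}"
    by (rule faceE[OF assms(1)]) blast
  obtain c where c: "\<And>a. a \<in> A \<Longrightarrow> 0 \<le> c a" "x = (\<Sum>a\<in>A. c a *\<^sub>R ivec a)"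
    by (rule cone_cases[of x]) (use assms(2) w(2) in blast)+
  have "inner w x = 0" using assms(2) w(2) by simp
  then have "\<forall>a\<in>A. c a = 0 \<or> inner w (ivec a) = 0"
    using nonneg_form_zero_iff[of w c] c w(1)[OF ivec_in_cone] by auto
  then have "c a = 0" if "a \<in> A - Aface A \<tau>" for a
    using that ivec_in_cone[of a] by (auto simp: Aface_def w(2))
  with c show ?thesis using that by blast
qed

text \<open>By \<open>face_generated\<close> a face is the cone over the generators on it. Faces are
  thus encoded by subsets of \<open>A\<close>, which bounds their number.\<close>

lemma face_subset_iff:
  assumes "face A \<tau>" "face A \<sigma>"
  shows "\<tau> \<subseteq> \<sigma> \<longleftrightarrow> Aface A \<tau> \<subseteq> Aface A \<sigma>"
proof
  assume *: "Aface A \<tau> \<subseteq> Aface A \<sigma>"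
  obtain w where w: "\<And>x. x \<in> cone A \<Longrightarrow> 0 \<le> inner w x" "\<sigma> = {x \<in> cone A. inner w x = 0}"
    by (rule faceE[OF assms(2)]) blast
  show "\<tau> \<subseteq> \<sigma>"
  proof
    fix x assume x: "x \<in> \<tau>"
    obtain c where c: "\<And>a. a \<in> A \<Longrightarrow> 0 \<le> c a" "\<And>a. a \<in> A - Aface A \<tau> \<Longrightarrow> c a = 0"
        "x = (\<Sum>a\<in>A. c a *\<^sub>R ivec a)"
      by (rule face_generated[OF assms(1) x]) blast
    have "\<forall>a\<in>A. c a = 0 \<or> inner w (ivec a) = 0"
    proof
      fix a assume "a \<in> A"
      then show "c a = 0 \<or> inner w (ivec a) = 0"
        using c(2)[of a] * w(2) by (cases "a \<in> Aface A \<tau>") (auto simp: Aface_def)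
    qed
    then have "inner w x = 0"
      unfolding c(3) using nonneg_form_zero_iff[of w c] c(1) w(1)[OF ivec_in_cone] by auto
    then show "x \<in> \<sigma>" using face_subset[OF assms(1)] x w(2) by auto
  qed
qed (auto simp: Aface_def)

lemma face_eqI: "face A \<tau> \<Longrightarrow> face A \<sigma> \<Longrightarrow> Aface A \<tau> = Aface A \<sigma> \<Longrightarrow> \<tau> = \<sigma>"
  using face_subset_iff by (metis subset_antisym order_refl)

section \<open>Facets, their primitive forms and the half-spaces they define\<close>

definition facets :: "(real^'n) set set" where
  "facets = {\<sigma>. facet A \<sigma>}"

lemma facet_face: "\<sigma> \<in> facets \<Longrightarrow> face A \<sigma>"
  by (simp add: facets_def facet_def)

lemma finite_facets: "finite facets"
proof (rule inj_on_finite)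
  show "inj_on (Aface A) facets" using face_eqI facet_face by (meson inj_onI)
  show "Aface A ` facets \<subseteq> Pow A" using Aface_subset by blast
qed (simp add: fin)

lemma facet_span:
  assumes "\<sigma> \<in> facets" "w \<noteq> 0" "\<And>x. x \<in> \<sigma> \<Longrightarrow> inner w x = 0"
  shows "span \<sigma> = {x. inner w x = 0}"
proof -
  have "dim \<sigma> = CARD('n) - 1" using assms(1) by (simp add: facets_def facet_def)
  moreover have "dim {x. inner w x = 0} = CARD('n) - 1" using dim_hyperplane[OF assms(2)] by simp
  moreover have "span \<sigma> \<subseteq> {x. inner w x = 0}"
    by (rule span_minimal) (use assms(3) in \<open>auto simp: subspace_hyperplane\<close>)
  ultimately show ?thesis
    by (intro subspace_dim_equal) (auto simp: subspace_hyperplane)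
qed

definition is_Fform :: "(real^'n) set \<Rightarrow> real^'n \<Rightarrow> bool" where
  "is_Fform \<sigma> w \<longleftrightarrow> (\<forall>x\<in>cone A. 0 \<le> inner w x) \<and> (\<forall>x\<in>\<sigma>. inner w x = 0) \<and>
     range (\<lambda>z. inner w (ivec z)) = \<int>"

lemma is_Fform_nonzero: "is_Fform \<sigma> w \<Longrightarrow> w \<noteq> 0"
proof
  assume "is_Fform \<sigma> w" "w = 0"
  then have "(1::real) \<in> range (\<lambda>z. inner w (ivec z :: real^'n))" unfolding is_Fform_def by simp
  then show False using \<open>w = 0\<close> by simp
qed

text \<open>Both forms have the kernel \<open>span \<sigma>\<close>, hence are proportional.
  Nonnegativity makes the factor nonnegative, and equal value groups make it a unit of the
  integers.\<close>

lemma is_Fform_unique: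
  assumes "\<sigma> \<in> facets" "is_Fform \<sigma> w" "is_Fform \<sigma> w'"
  shows "w' = w"
proof -
  have nz: "w \<noteq> 0" using assms(2) is_Fform_nonzero by blast
  have span: "span \<sigma> = {x. inner w x = 0}"
    using facet_span[OF assms(1) nz] assms(2) by (simp add: is_Fform_def)
  have span': "span \<sigma> = {x. inner w' x = 0}"
    using facet_span[OF assms(1) is_Fform_nonzero[OF assms(3)]] assms(3) by (simp add: is_Fform_def)
  \<comment> \<open>\<open>w' - t w\<close> is orthogonal to \<open>w\<close>, so it lies in the
    common kernel and is orthogonal to itself.\<close>
  define t where "t = inner w' w / inner w w"
  have "inner w (w' - t *\<^sub>R w) = 0"
    using nz by (simp add: t_def inner_diff_right inner_commute)
  moreover from this have "inner w' (w' - t *\<^sub>R w) = 0" using span span' by blast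
  ultimately have "inner (w' - t *\<^sub>R w) (w' - t *\<^sub>R w) = 0" by (simp add: inner_diff_left)
  then have t: "w' = t *\<^sub>R w" by simp
  obtain a where a: "a \<in> A" "inner w (ivec a) \<noteq> 0" using exists_generator_nonzero[OF nz] .
  then have "inner w (ivec a) > 0" "0 \<le> inner w' (ivec a)"
    using assms(2,3) ivec_in_cone[OF a(1)] by (auto simp: is_Fform_def order_less_le)
  then have "t \<ge> 0" by (simp add: t zero_le_mult_iff)
  obtain z1 z2 where z: "inner w (ivec z1) = 1" "inner w' (ivec z2) = 1"
    using assms(2,3) unfolding is_Fform_def by (metis (no_types, lifting) Ints_1 imageE)
  have "t \<in> \<int>" using assms(3) z(1) unfolding is_Fform_def t by (metis (no_types, lifting) inner_scaleR_left mult.right_neutral rangeI)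
  moreover have "t * inner w (ivec z2) = 1" using z(2) by (simp add: t)
  moreover have "inner w (ivec z2) \<in> \<int>" using assms(2) unfolding is_Fform_def by blast
  ultimately have "t = 1" using \<open>t \<ge> 0\<close>
    by (smt (verit) Ints_cases mult_minus_left of_int_mult of_int_1 of_int_eq_iff zmult_eq_1_iff of_int_0_le_iff)
  then show ?thesis using t by simp
qed

lemma is_Fform_exists:
  assumes "\<sigma> \<in> facets"
  obtains w where "is_Fform \<sigma> w"
proof -
  obtain w where w: "\<And>x. x \<in> cone A \<Longrightarrow> 0 \<le> inner w x" "\<sigma> = {x \<in> cone A. inner w x = 0}"
    by (rule faceE[OF facet_face[OF assms]]) blast
  have "w \<noteq> 0"
  proof
    assume "w = 0"
    then have "\<sigma> = cone A" using w(2) by simp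
    then have "dim (cone A) = CARD('n) - 1" using assms by (simp add: facets_def facet_def)
    moreover have "dim (cone A) = CARD('n)" using span_cone by (metis DIM_cart DIM_real dim_UNIV dim_span mult.right_neutral)
    ultimately show False using zero_less_card_finite[where 'a='n] by linarith
  qed
  then obtain a0 where "a0 \<in> A" "inner w (ivec a0) \<noteq> 0" using exists_generator_nonzero by blast
  then have a0: "a0 \<in> A" "inner w (ivec a0) > 0" using w(1)[OF ivec_in_cone] by (auto simp: order_less_le)
  \<comment> \<open>Scaled to the value 1 at a generator off the facet: \<open>q\<close> times this
    value is at least 1, so an error below 1 leaves it positive and the integral form is
    nonzero.\<close>
  define u where "u = (1 / inner w (ivec a0)) *\<^sub>R w"
  have u: "inner u (ivec a0) = 1" "\<And>x. x \<in> cone A \<Longrightarrow> 0 \<le> inner u x" "\<And>x. x \<in> \<sigma> \<Longrightarrow> inner u x = 0"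
    using a0 w by (auto simp: u_def)
  \<comment> \<open>\<open>B\<close> exceeds the sum of the absolute coordinates of every generator,
    so coordinate errors below \<open>1 / B\<close> change the value on a generator by less than
    1.\<close>
  define B where "B = 1 + (\<Sum>a\<in>A. \<Sum>i\<in>UNIV. \<bar>a $ i\<bar>)"
  have B: "(\<Sum>i\<in>UNIV. \<bar>a $ i\<bar>) < B" "B > 0" if "a \<in> A" for a
  proof -
    have "(\<Sum>i\<in>UNIV. \<bar>a $ i\<bar>) \<le> (\<Sum>a\<in>A. \<Sum>i\<in>UNIV. \<bar>a $ i\<bar>)"
      using member_le_sum[OF that, of "\<lambda>a. \<Sum>i\<in>UNIV. \<bar>a $ i\<bar>"] fin by (simp add: sum_nonneg)
    then show "(\<Sum>i\<in>UNIV. \<bar>a $ i\<bar>) < B" unfolding B_def by simp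
    show "B > 0" unfolding B_def by (intro add_pos_nonneg sum_nonneg) auto
  qed
  have "1 / real_of_int B > 0" using B(2)[OF a0(1)] by simp
  then obtain q p where q: "q > 0" and p: "\<And>i. \<bar>real q * u $ i - of_int (p i)\<bar> < 1 / B"
    using Dirichlet_approx_finite[of "UNIV :: 'n set" "1 / B" "\<lambda>i. u $ i"] by (metis UNIV_I finite)
  define k where "k = (\<chi> i. p i)"
  text \<open>An integer vector this close to a multiple of the normal is nonnegative on the integer
    vectors of the generating set, and vanishes where the normal does.\<close>
  have close: "\<bar>inner (ivec k :: real^'n) (ivec a) - real q * inner u (ivec a)\<bar> < 1" if a: "a \<in> A" for a
  proof -
    have "inner (ivec k :: real^'n) (ivec a) - real q * inner u (ivec a) =
        (\<Sum>i\<in>UNIV. (of_int (p i) - real q * u $ i) * of_int (a $ i))"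
      by (simp add: inner_vec_def k_def sum_distrib_left sum_subtractf left_diff_distrib mult.assoc)
    then have "\<bar>inner (ivec k :: real^'n) (ivec a) - real q * inner u (ivec a)\<bar>
        \<le> (\<Sum>i\<in>UNIV. \<bar>of_int (p i) - real q * u $ i\<bar> * \<bar>of_int (a $ i)\<bar>)"
      by (simp only: abs_sum_mult_le of_int_abs)
    also have "\<dots> \<le> (\<Sum>i\<in>UNIV. (1 / B) * \<bar>of_int (a $ i)\<bar>)"
      using p by (intro sum_mono mult_right_mono) (auto simp: abs_minus_commute order_less_imp_le)
    also have "\<dots> = real_of_int (\<Sum>i\<in>UNIV. \<bar>a $ i\<bar>) / B" by (simp add: sum_divide_distrib)
    also have "\<dots> < 1" using B[OF a] by (simp add: field_simps del: of_int_sum)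
    finally show ?thesis .
  qed
  have int: "inner (ivec k) (ivec a :: real^'n) \<in> \<int>" for a unfolding inner_ivec by (rule Ints_of_int)
  have kpos: "0 \<le> inner (ivec k) (ivec a :: real^'n)" if "a \<in> A" for a
  proof -
    have "real q * inner u (ivec a) \<ge> 0" using u(2)[OF ivec_in_cone[OF that]] by simp
    then have "inner (ivec k) (ivec a :: real^'n) > -1" using close[OF that] by linarith
    then show ?thesis using int[of a] by (auto elim!: Ints_cases)
  qed
  have "inner (ivec k) (ivec a0 :: real^'n) > 0"
    using close[OF a0(1)] u(1) q by (simp add: abs_less_iff)
  then have "k \<noteq> 0" by auto
  have kzero: "inner (ivec k) (ivec a :: real^'n) = 0" if "a \<in> A" "inner u (ivec a) = 0" for a
    using close[OF that(1)] that(2) int[of a] by (auto elim!: Ints_cases)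
  obtain m k' where k': "m > 0" "k = m *s k'" "range (\<lambda>z. inner (ivec k' :: real^'n) (ivec z)) = \<int>"
    using primitive_multiple[OF \<open>k \<noteq> 0\<close>] .
  have scale: "inner (ivec k) x = of_int m * inner (ivec k') x" for x :: "real^'n"
    unfolding k'(2) by (simp add: ivec_scale scalar_mult_eq_scaleR)
  have "is_Fform \<sigma> (ivec k')"
    unfolding is_Fform_def
  proof (intro conjI ballI)
    fix x assume "x \<in> cone A"
    then have "0 \<le> inner (ivec k) x" using nonneg_form_cone kpos by blast
    then show "0 \<le> inner (ivec k') x" using k'(1) by (simp add: scale zero_le_mult_iff)
  next
    fix x assume x: "x \<in> \<sigma>"
    obtain c where c: "\<And>a. a \<in> A \<Longrightarrow> 0 \<le> c a" "\<And>a. a \<in> A - Aface A \<sigma> \<Longrightarrow> c a = 0"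
        "x = (\<Sum>a\<in>A. c a *\<^sub>R ivec a)"
      by (rule face_generated[OF facet_face[OF assms] x]) blast
    have "c a = 0 \<or> inner (ivec k) (ivec a :: real^'n) = 0" if "a \<in> A" for a
      using c(2)[of a] kzero[OF that u(3)] that by (auto simp: Aface_def)
    then have "inner (ivec k) x = 0"
      unfolding c(3) using nonneg_form_zero_iff[of "ivec k" c] c(1) kpos by auto
    then show "inner (ivec k') x = 0" using k'(1) by (simp add: scale)
  qed (rule k'(3))
  then show ?thesis by (rule that)
qed

lemma is_Fform_Fform: "\<sigma> \<in> facets \<Longrightarrow> is_Fform \<sigma> (Fform A \<sigma>)"
  unfolding Fform_def is_Fform_def[symmetric]
  by (metis is_Fform_exists is_Fform_unique theI)

lemma Fform_nonneg: "\<sigma> \<in> facets \<Longrightarrow> x \<in> cone A \<Longrightarrow> 0 \<le> inner (Fform A \<sigma>) x"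
  and Fform_zero: "\<sigma> \<in> facets \<Longrightarrow> x \<in> \<sigma> \<Longrightarrow> inner (Fform A \<sigma>) x = 0"
  and Fform_range: "\<sigma> \<in> facets \<Longrightarrow> range (\<lambda>z. inner (Fform A \<sigma>) (ivec z)) = \<int>"
  using is_Fform_Fform[of \<sigma>] unfolding is_Fform_def by blast+

lemma span_facet: "\<sigma> \<in> facets \<Longrightarrow> span \<sigma> = {x. inner (Fform A \<sigma>) x = 0}"
  by (intro facet_span is_Fform_nonzero[OF is_Fform_Fform] Fform_zero)

lemma facet_eq:
  assumes "\<sigma> \<in> facets"
  shows "\<sigma> = {x \<in> cone A. inner (Fform A \<sigma>) x = 0}"
proof -
  obtain w where w: "\<sigma> = {x \<in> cone A. inner w x = 0}"
    by (rule faceE[OF facet_face[OF assms]]) blast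
  have "span \<sigma> \<subseteq> {x. inner w x = 0}"
    by (rule span_minimal) (use w in \<open>auto simp: subspace_hyperplane\<close>)
  then show ?thesis using span_facet[OF assms] w Fform_zero[OF assms] by blast
qed

lemma facet_subset_eq:
  assumes "\<sigma> \<in> facets" "\<sigma>' \<in> facets" "\<sigma> \<subseteq> \<sigma>'"
  shows "\<sigma>' = \<sigma>"
proof -
  have "is_Fform \<sigma> (Fform A \<sigma>')"
    using is_Fform_Fform[OF assms(2)] assms(3) unfolding is_Fform_def by blast
  then have "Fform A \<sigma>' = Fform A \<sigma>"
    by (rule is_Fform_unique[OF assms(1) is_Fform_Fform[OF assms(1)]])
  then show ?thesis using facet_eq[OF assms(1)] facet_eq[OF assms(2)] by simp
qed

text \<open>The segment from an interior point to \<open>x\<close> meets the boundary in a point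
  \<open>y\<close> on some facet. The form of that facet is positive at the interior point and zero
  at \<open>y\<close>, hence negative at \<open>x\<close>.\<close>

lemma facet_separates:
  assumes "x \<notin> cone A"
  obtains \<sigma> where "\<sigma> \<in> facets" "inner (Fform A \<sigma>) x < 0"
proof -
  have convex: "convex (cone A)" using convex_cone_cone by (simp add: convex_cone_def)
  have hull: "affine hull (cone A) = UNIV"
    using span_cone affine_hull_span_0[of "cone A"] hull_inc[OF cone_0] by metis
  have rel: "rel_interior (cone A) = interior (cone A)" by (rule rel_interior_interior[OF hull])
  obtain c where c: "c \<in> interior (cone A)"
    using rel_interior_eq_empty[OF convex] rel cone_0 by blast
  have "closed_segment c x \<inter> frontier (cone A) \<noteq> {}"
    using assms c interior_subset[of "cone A"]
    by (intro connected_Int_frontier) (auto intro!: exI[of _ c] exI[of _ x])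
  then obtain y where y: "y \<in> closed_segment c x" "y \<in> frontier (cone A)" by blast
  have closed: "closed (cone A)" by (rule polyhedron_imp_closed[OF polyhedron_cone])
  have "y \<in> cone A - rel_interior (cone A)"
    using y(2) closed by (simp add: frontier_def rel)
  then obtain \<sigma> where \<sigma>: "\<sigma> facet_of cone A" "y \<in> \<sigma>"
    unfolding rel_boundary_of_polyhedron[OF polyhedron_cone] by blast
  then have "\<sigma> exposed_face_of cone A"
    using exposed_face_of_polyhedron[OF polyhedron_cone] by (simp add: facet_of_def)
  then obtain a b where ab: "cone A \<subseteq> {x. inner a x \<le> b}" "\<sigma> = cone A \<inter> {x. inner a x = b}"
    unfolding exposed_face_of_def by blast
  have "y \<in> cone A" using \<sigma>(2) ab(2) by simp
  \<comment> \<open>The supporting hyperplane passes through the origin: \<open>2 y\<close> in the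
    cone gives \<open>2 b \<le> b\<close>, and 0 in the cone gives \<open>0 \<le> b\<close>.\<close>
  then have "2 *\<^sub>R y \<in> cone A" by (rule cone_scale) simp
  with ab \<sigma>(2) cone_0 have "inner a (2 *\<^sub>R y) \<le> b" "inner a y = b" "inner a 0 \<le> b" by blast+
  then have b: "b = 0" by simp
  have "face A \<sigma>"
    unfolding face_def by (rule exI[of _ "- a"]) (use ab b in \<open>auto\<close>)
  moreover have "dim \<sigma> = CARD('n) - 1"
  proof -
    have "0 \<in> \<sigma>" using ab(2) b cone_0 by simp
    then have "aff_dim \<sigma> = int (dim \<sigma>)" by (intro aff_dim_zero hull_inc)
    moreover have "aff_dim (cone A) = CARD('n)"
      using aff_dim_affine_hull[of "cone A"] hull by simp
    ultimately show ?thesis using \<sigma>(1) by (simp add: facet_of_def) linarith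
  qed
  ultimately have fac: "\<sigma> \<in> facets" by (simp add: facets_def facet_def)
  let ?w = "Fform A \<sigma>"
  have nz: "?w \<noteq> 0" using is_Fform_Fform[OF fac] is_Fform_nonzero by blast
  have pos: "inner ?w c > 0"
  proof -
    obtain e where e: "e > 0" "cball c e \<subseteq> cone A" using c mem_interior_cball by blast
    \<comment> \<open>A small step against \<open>?w\<close> lowers the form strictly and stays in
      the cone, so the form is positive at \<open>c\<close>.\<close>
    have "c - (e / norm ?w) *\<^sub>R ?w \<in> cball c e" using e nz by (simp add: dist_norm)
    then have "0 \<le> inner ?w (c - (e / norm ?w) *\<^sub>R ?w)" using e Fform_nonneg[OF fac] by blast
    moreover have "(e / norm ?w) * inner ?w ?w > 0" using e nz by simp
    ultimately show ?thesis by (simp add: inner_diff_right)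
  qed
  obtain u where u: "0 \<le> u" "u \<le> 1" "y = (1 - u) *\<^sub>R c + u *\<^sub>R x"
    using y(1) by (auto simp: in_segment)
  have "u \<noteq> 1" using u(3) \<open>y \<in> cone A\<close> assms by auto
  have "inner ?w y = 0" by (rule Fform_zero[OF fac \<sigma>(2)])
  then have "(1 - u) * inner ?w c + u * inner ?w x = 0" by (simp add: u(3) inner_add_right)
  moreover have "(1 - u) * inner ?w c > 0" using pos u \<open>u \<noteq> 1\<close> by simp
  ultimately have "u * inner ?w x < 0" by linarith
  then have "inner ?w x < 0" using u(1) by (simp add: mult_less_0_iff)
  with fac show ?thesis by (rule that)
qed

text \<open>The floor only changes the type, since on a facet form the value is already an
  integer.\<close>

definition Fint :: "(real^'n) set \<Rightarrow> int^'n \<Rightarrow> int"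
  where "Fint \<sigma> z = \<lfloor>inner (Fform A \<sigma>) (ivec z)\<rfloor>"

lemma of_int_Fint: "\<sigma> \<in> facets \<Longrightarrow> real_of_int (Fint \<sigma> z) = inner (Fform A \<sigma>) (ivec z)"
  using Fform_range[of \<sigma>] unfolding Fint_def by (intro of_int_floor) blast

lemma Fint_add: "\<sigma> \<in> facets \<Longrightarrow> Fint \<sigma> (y + z) = Fint \<sigma> y + Fint \<sigma> z"
  and Fint_diff: "\<sigma> \<in> facets \<Longrightarrow> Fint \<sigma> (y - z) = Fint \<sigma> y - Fint \<sigma> z"
  and Fint_scale: "\<sigma> \<in> facets \<Longrightarrow> Fint \<sigma> (k *s z) = k * Fint \<sigma> z"
  by (simp_all flip: of_int_eq_iff[where 'a=real]
      add: of_int_Fint ivec_add ivec_diff ivec_scale inner_add_right inner_diff_right scalar_mult_eq_scaleR)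

lemma Fint_surj:
  assumes "\<sigma> \<in> facets"
  obtains z where "Fint \<sigma> z = k"
proof -
  have "real_of_int k \<in> range (\<lambda>z. inner (Fform A \<sigma>) (ivec z))" using Fform_range[OF assms] by simp
  then show ?thesis using that of_int_Fint[OF assms] by (metis (no_types, lifting) imageE of_int_eq_iff)
qed

lemma in_cone_iff: "ivec z \<in> cone A \<longleftrightarrow> (\<forall>\<sigma>\<in>facets. 0 \<le> Fint \<sigma> z)"
proof
  assume "ivec z \<in> cone A"
  then show "\<forall>\<sigma>\<in>facets. 0 \<le> Fint \<sigma> z"
    using Fform_nonneg by (simp add: Fint_def)
next
  assume *: "\<forall>\<sigma>\<in>facets. 0 \<le> Fint \<sigma> z"
  show "ivec z \<in> cone A"
  proof (rule ccontr)
    assume "ivec z \<notin> cone A"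
    then obtain \<sigma> where "\<sigma> \<in> facets" "inner (Fform A \<sigma>) (ivec z) < 0" using facet_separates by blast
    then show False using * of_int_Fint[of \<sigma> z] by (metis not_less of_int_0_le_iff)
  qed
qed

lemma Fint_Nspan: "\<sigma> \<in> facets \<Longrightarrow> x \<in> Nspan A \<Longrightarrow> 0 \<le> Fint \<sigma> x"
  using ivec_Nspan_in_cone in_cone_iff by blast

lemma Fint_0: "\<sigma> \<in> facets \<Longrightarrow> Fint \<sigma> 0 = 0"
  by (simp add: Fint_def)

lemma Fint_sum: "\<sigma> \<in> facets \<Longrightarrow> Fint \<sigma> (sum f I) = (\<Sum>i\<in>I. Fint \<sigma> (f i))"
  by (induction I rule: infinite_finite_induct) (simp_all add: Fint_0 Fint_add)

lemma Fint_eq_0_iff: "\<sigma> \<in> facets \<Longrightarrow> a \<in> A \<Longrightarrow> Fint \<sigma> a = 0 \<longleftrightarrow> a \<in> Aface A \<sigma>"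
proof -
  assume \<sigma>: "\<sigma> \<in> facets" and a: "a \<in> A"
  have "Fint \<sigma> a = 0 \<longleftrightarrow> inner (Fform A \<sigma>) (ivec a) = 0"
    using of_int_Fint[OF \<sigma>, of a] by (metis of_int_0 of_int_eq_iff)
  then show ?thesis using facet_eq[OF \<sigma>] a ivec_in_cone[OF a] by (auto simp: Aface_def)
qed

lemma Fint_Zspan_face: "\<sigma> \<in> facets \<Longrightarrow> \<tau> \<subseteq> \<sigma> \<Longrightarrow> z \<in> Zspan (Aface A \<tau>) \<Longrightarrow> Fint \<sigma> z = 0"
proof -
  assume \<sigma>: "\<sigma> \<in> facets" "\<tau> \<subseteq> \<sigma>" and "z \<in> Zspan (Aface A \<tau>)"
  then obtain c where z: "z = (\<Sum>a\<in>Aface A \<tau>. c a *s a)" by (auto simp: Zspan_finite fin_Aface)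
  have "Fint \<sigma> a = 0" if "a \<in> Aface A \<tau>" for a
    using that \<sigma> Fint_eq_0_iff[OF \<sigma>(1), of a] by (auto simp: Aface_def)
  then show ?thesis unfolding z using \<sigma>(1) by (simp add: Fint_sum Fint_scale)
qed

section \<open>Lattice points of the cone\<close>

text \<open>Rounding the coefficients down leaves one of finitely many remainders, and each of
  these can be moved into the monoid.\<close>

lemma conductor:
  obtains c where "c \<in> Nspan A" "\<And>z. ivec z \<in> cone A \<Longrightarrow> c + z \<in> Nspan A"
proof -
  define B where "B = (\<Sum>a\<in>A. \<Sum>i\<in>UNIV. \<bar>a $ i\<bar>)"
  define R where "R = {r :: int^'n. \<forall>i. \<bar>r $ i\<bar> \<le> B}"
  have R: "finite R" unfolding R_def by (rule finite_int_box)
  \<comment> \<open>Each \<open>r\<close> is a difference \<open>x - y\<close> of monoid elements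
    because \<open>A\<close> generates the group, and \<open>y\<close> moves it into the
    monoid.\<close>
  have "\<exists>n. n \<in> Nspan A \<and> n + r \<in> Nspan A" for r
  proof -
    obtain x y where "x \<in> Nspan A" "y \<in> Nspan A" "r = x - y"
      using Zspan_eq_Nspan_diff[OF fin, of r] gen by blast
    then show ?thesis by (intro exI[of _ y]) simp
  qed
  then obtain n where n: "\<And>r. n r \<in> Nspan A" "\<And>r. n r + r \<in> Nspan A" by metis
  show ?thesis
  proof (rule that[of "sum n R"])
    show "sum n R \<in> Nspan A" using n fin by (intro Nspan_sum) auto
    fix z assume "ivec z \<in> cone A"
    then obtain c where c: "\<And>a. a \<in> A \<Longrightarrow> 0 \<le> c a" "(ivec z :: real^'n) = (\<Sum>a\<in>A. c a *\<^sub>R ivec a)"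
      by (rule cone_cases) blast
    define x where "x = (\<Sum>a\<in>A. \<lfloor>c a\<rfloor> *s a)"
    have "x = (\<Sum>a\<in>A. of_nat (nat \<lfloor>c a\<rfloor>) *s a)"
      using c(1) by (simp add: x_def)
    then have x: "x \<in> Nspan A" by (rule Nspan_finiteI[OF fin])
    have "z - x \<in> R" unfolding R_def B_def x_def
      using round_combination[OF c(2)] by blast
    then have "sum n R = n (z - x) + sum n (R - {z - x})" using R by (rule sum.remove[rotated])
    \<comment> \<open>The summand attached to the actual remainder repairs it; all other summands
      are in the monoid anyway.\<close>
    then have "sum n R + z = x + (n (z - x) + (z - x)) + sum n (R - {z - x})" by simp
    also have "\<dots> \<in> Nspan A" by (intro Nspan_add Nspan_sum n x fin)
    finally show "sum n R + z \<in> Nspan A" .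
  qed
qed

text \<open>A threshold common to all faces. Modulo \<open>\<int>(A \<inter> \<tau>)\<close> large
  values on the facets through \<tau> are enough, since the remaining forms can be raised at
  will.\<close>

definition conducts :: "int \<Rightarrow> bool" where
  "conducts M \<longleftrightarrow> (\<forall>\<tau> z. face A \<tau> \<longrightarrow> (\<forall>\<sigma>\<in>facets. \<tau> \<subseteq> \<sigma> \<longrightarrow> M \<le> Fint \<sigma> z) \<longrightarrow>
     (\<exists>a\<in>Nspan A. \<exists>y\<in>Zspan (Aface A \<tau>). z = a + y))"

text \<open>The sum \<open>s\<close> of the generators on \<tau> has value 0 on the facets through
  \<tau> and at least 1 on all others. Hence \<open>z - c + K s\<close> lies in the cone for large
  \<open>K\<close>, and the conductor \<open>c\<close> moves it into the monoid.\<close>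

lemma exists_conducts:
  obtains M where "M > 0" "conducts M"
proof -
  obtain c where c: "c \<in> Nspan A" "\<And>z. ivec z \<in> cone A \<Longrightarrow> c + z \<in> Nspan A" by (rule conductor) blast
  \<comment> \<open>Dominates the values of all facet forms at the conductor; the 1 makes it
    positive.\<close>
  define M where "M = 1 + (\<Sum>\<sigma>\<in>facets. Fint \<sigma> c)"
  have M: "Fint \<sigma> c \<le> M" if "\<sigma> \<in> facets" for \<sigma>
    using member_le_sum[OF that, of "\<lambda>\<sigma>. Fint \<sigma> c"] finite_facets Fint_Nspan[OF _ c(1)]
    by (simp add: M_def)
  have "conducts M" unfolding conducts_def
  proof (intro allI impI)
    fix \<tau> z assume \<tau>: "face A \<tau>" and "\<forall>\<sigma>\<in>facets. \<tau> \<subseteq> \<sigma> \<longrightarrow> M \<le> Fint \<sigma> z"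
    then have z: "\<And>\<sigma>. \<sigma> \<in> facets \<Longrightarrow> \<tau> \<subseteq> \<sigma> \<Longrightarrow> M \<le> Fint \<sigma> z" by blast
    define s where "s = (\<Sum>a\<in>Aface A \<tau>. a)"
    define K where "K = (\<Sum>\<sigma>\<in>facets. \<bar>Fint \<sigma> (z - c)\<bar>)"
    have K: "\<bar>Fint \<sigma> (z - c)\<bar> \<le> K" if "\<sigma> \<in> facets" for \<sigma>
      unfolding K_def using finite_facets that by (intro member_le_sum) auto
    have "K \<ge> 0" unfolding K_def by (intro sum_nonneg) auto
    have s: "s \<in> Nspan (Aface A \<tau>)" unfolding s_def
      by (intro Nspan_sum Nspan_superset fin_Aface)
    have Fs: "Fint \<sigma> s \<ge> 1" if \<sigma>: "\<sigma> \<in> facets" "\<not> \<tau> \<subseteq> \<sigma>" for \<sigma>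
    proof -
      obtain a where a: "a \<in> Aface A \<tau>" "a \<notin> Aface A \<sigma>"
        using face_subset_iff[OF \<tau> facet_face] \<sigma> by blast
      have nn: "0 \<le> Fint \<sigma> b" if "b \<in> Aface A \<tau>" for b
        using that Fint_Nspan[OF \<sigma>(1)] Nspan_superset Aface_subset by blast
      have "Fint \<sigma> a \<noteq> 0" using a Fint_eq_0_iff[OF \<sigma>(1)] Aface_subset by blast
      with nn[OF a(1)] have "1 \<le> Fint \<sigma> a" by simp
      also have "\<dots> \<le> (\<Sum>a\<in>Aface A \<tau>. Fint \<sigma> a)"
        using a(1) nn fin_Aface by (intro member_le_sum) auto
      finally show ?thesis unfolding s_def Fint_sum[OF \<sigma>(1)] .
    qed
    have "0 \<le> Fint \<sigma> (z - c + K *s s)" if \<sigma>: "\<sigma> \<in> facets" for \<sigma>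
    proof (cases "\<tau> \<subseteq> \<sigma>")
      case True
      have "Fint \<sigma> s = 0" using Fint_Zspan_face[OF \<sigma> True] s Nspan_subset_Zspan by blast
      then show ?thesis using z[OF \<sigma> True] M[OF \<sigma>] \<sigma> by (simp add: Fint_add Fint_diff Fint_scale)
    next
      case False
      have "K * 1 \<le> K * Fint \<sigma> s" using \<open>K \<ge> 0\<close> Fs[OF \<sigma> False] by (rule mult_left_mono[rotated])
      then show ?thesis using K[OF \<sigma>] \<sigma> by (simp add: Fint_add Fint_scale)
    qed
    then have "c + (z - c + K *s s) \<in> Nspan A" by (intro c(2)) (simp add: in_cone_iff)
    moreover have "- (K *s s) \<in> Zspan (Aface A \<tau>)"
      using Nspan_scale[OF fin_Aface s, of "nat K"] Nspan_subset_Zspan \<open>K \<ge> 0\<close>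
      by (intro Zspan_uminus fin_Aface) auto
    moreover have "z = (c + (z - c + K *s s)) + - (K *s s)" by simp
    ultimately show "\<exists>a\<in>Nspan A. \<exists>y\<in>Zspan (Aface A \<tau>). z = a + y" by blast
  qed
  moreover have "M > 0"
    unfolding M_def using sum_nonneg[of facets "\<lambda>\<sigma>. Fint \<sigma> c"] Fint_Nspan[OF _ c(1)] by simp
  ultimately show ?thesis using that by blast
qed

text \<open>The integral coefficients of the multiple differ by less than 1 from nonnegative
  numbers, so they are nonnegative.\<close>

lemma cone_multiple_in_Nspan:
  assumes "ivec x \<in> cone A"
  obtains m :: nat where "m > 0" "of_nat m *s x \<in> Nspan A"
proof -
  obtain c where c: "\<And>a. a \<in> A \<Longrightarrow> 0 \<le> c a" "(ivec x :: real^'n) = (\<Sum>a\<in>A. c a *\<^sub>R ivec a)"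
    by (rule cone_cases[OF assms]) blast
  obtain q p where q: "q > 0" "of_nat q *s x = (\<Sum>a\<in>A. p a *s a)"
      and p: "\<forall>a\<in>A. \<bar>real q * c a - of_int (p a)\<bar> < 1"
    using multiple_of_combination[OF fin c(2)] .
  have "p a \<ge> 0" if "a \<in> A" for a
  proof -
    have "0 \<le> real q * c a" using c(1)[OF that] by simp
    then have "real_of_int (p a) > -1" using p that by fastforce
    then show ?thesis by linarith
  qed
  then have "of_nat q *s x = (\<Sum>a\<in>A. of_nat (nat (p a)) *s a)" unfolding q(2) by (intro sum.cong) auto
  then have "of_nat q *s x \<in> Nspan A" by (rule Nspan_finiteI[OF fin])
  with q(1) show ?thesis by (rule that)
qed

text \<open>\<tau> is the intersection of the facets that contain \<open>S\<close>, so the sum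
  \<open>s\<close> of \<open>S\<close> is positive on all other facet forms. For
  \<open>z = x - y\<close> with \<open>x\<close> and \<open>y\<close> in
  \<open>\<nat>(A \<inter> \<tau>)\<close>, a multiple of \<open>s\<close> minus \<open>y\<close>
  then lies in the cone, and a further multiple lies in the monoid.\<close>

lemma smallest_face:
  assumes "S \<subseteq> A"
  obtains \<tau> where "face A \<tau>" "S \<subseteq> Aface A \<tau>"
    "\<And>z. z \<in> Zspan (Aface A \<tau>) \<Longrightarrow> \<exists>s\<in>Nspan S. s + z \<in> Nspan A"
proof -
  have fS: "finite S" using assms fin by (rule finite_subset)
  define T where "T = {\<sigma> \<in> facets. S \<subseteq> Aface A \<sigma>}"
  have T: "finite T" "T \<subseteq> facets" unfolding T_def using finite_facets by auto
  \<comment> \<open>A sum of nonnegative forms vanishes only where each of them does, so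
    \<open>w\<close> exposes the intersection; an empty \<open>T\<close> yields the whole
    cone.\<close>
  define w where "w = (\<Sum>\<sigma>\<in>T. Fform A \<sigma>)"
  define \<tau> where "\<tau> = {x \<in> cone A. inner w x = 0}"
  have nn: "0 \<le> inner (Fform A \<sigma>) x" if "\<sigma> \<in> T" "x \<in> cone A" for \<sigma> x
    using that T Fform_nonneg by blast
  have wx: "inner w x = (\<Sum>\<sigma>\<in>T. inner (Fform A \<sigma>) x)" for x by (simp add: w_def inner_sum_left)
  have face: "face A \<tau>" unfolding face_def \<tau>_def
    by (intro exI[of _ w]) (auto simp: wx intro!: sum_nonneg nn)
  have \<tau>: "x \<in> \<tau> \<longleftrightarrow> x \<in> cone A \<and> (\<forall>\<sigma>\<in>T. inner (Fform A \<sigma>) x = 0)" for x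
    using T(1) nn[of _ x] by (auto simp: \<tau>_def wx sum_nonneg_eq_0_iff)
  have S\<tau>: "S \<subseteq> Aface A \<tau>"
    using assms ivec_in_cone Fform_zero by (auto simp: Aface_def \<tau> T_def subset_iff)
  have sub: "\<tau> \<subseteq> \<sigma>" if "\<sigma> \<in> T" for \<sigma>
    using that facet_eq[of \<sigma>] T(2) \<tau> by blast
  define s where "s = (\<Sum>a\<in>S. a)"
  have s: "s \<in> Nspan S" unfolding s_def by (intro Nspan_sum Nspan_superset fS)
  have Fs: "Fint \<sigma> s \<ge> 1" if \<sigma>: "\<sigma> \<in> facets" "\<sigma> \<notin> T" for \<sigma>
  proof -
    obtain a where a: "a \<in> S" "a \<notin> Aface A \<sigma>" using \<sigma> by (auto simp: T_def)
    have nn: "0 \<le> Fint \<sigma> b" if "b \<in> S" for b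
      using that Fint_Nspan[OF \<sigma>(1)] Nspan_superset assms by blast
    have "Fint \<sigma> a \<noteq> 0" using a Fint_eq_0_iff[OF \<sigma>(1)] assms by blast
    with nn[OF a(1)] have "1 \<le> Fint \<sigma> a" by simp
    also have "\<dots> \<le> (\<Sum>a\<in>S. Fint \<sigma> a)"
      using a(1) nn fS by (intro member_le_sum) auto
    finally show ?thesis unfolding s_def Fint_sum[OF \<sigma>(1)] .
  qed
  have "\<exists>s\<in>Nspan S. s + z \<in> Nspan A" if z: "z \<in> Zspan (Aface A \<tau>)" for z
  proof -
    obtain x y where xy: "x \<in> Nspan (Aface A \<tau>)" "y \<in> Nspan (Aface A \<tau>)" "z = x - y"
      using Zspan_eq_Nspan_diff[OF fin_Aface z] .
    have xyA: "x \<in> Nspan A" "y \<in> Nspan A" using xy Nspan_mono[OF Aface_subset] by blast+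
    define K where "K = nat (\<Sum>\<sigma>\<in>facets. Fint \<sigma> y)"
    have K: "Fint \<sigma> y \<le> int K" if "\<sigma> \<in> facets" for \<sigma>
      using member_le_sum[OF that, of "\<lambda>\<sigma>. Fint \<sigma> y"] finite_facets Fint_Nspan[OF _ xyA(2)]
      by (simp add: K_def)
    have "0 \<le> Fint \<sigma> (of_nat K *s s - y)" if \<sigma>: "\<sigma> \<in> facets" for \<sigma>
    proof (cases "\<sigma> \<in> T")
      case True
      have "s \<in> Nspan (Aface A \<tau>)" using s Nspan_mono[OF S\<tau>] by blast
      then have "Fint \<sigma> s = 0" "Fint \<sigma> y = 0"
        using Fint_Zspan_face[OF \<sigma> sub[OF True]] xy(2) Nspan_subset_Zspan by blast+
      then show ?thesis using \<sigma> by (simp add: Fint_diff Fint_scale)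
    next
      case False
      have "int K * 1 \<le> int K * Fint \<sigma> s" using Fs[OF \<sigma> False] by (intro mult_left_mono) auto
      then show ?thesis using K[OF \<sigma>] \<sigma> by (simp add: Fint_diff Fint_scale)
    qed
    then have "ivec (of_nat K *s s - y) \<in> cone A" by (simp add: in_cone_iff)
    then obtain m where m: "m > 0" "of_nat m *s (of_nat K *s s - y) \<in> Nspan A"
      using cone_multiple_in_Nspan by blast
    \<comment> \<open>Multiplying by \<open>m\<close> subtracts \<open>y\<close> not once but
      \<open>m\<close> times; the surplus \<open>(m - 1) y\<close> is returned to keep the
      difference \<open>x - y\<close>.\<close>
    have "of_nat (m * K) *s s + z = of_nat m *s (of_nat K *s s - y) + of_nat (m - 1) *s y + x"
      using m(1) by (simp add: xy(3) vec_eq_iff right_diff_distrib left_diff_distrib of_nat_diff mult.assoc)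
    also have "\<dots> \<in> Nspan A" by (intro Nspan_add Nspan_scale fin m(2) xyA)
    finally show ?thesis using Nspan_scale[OF fS s] by blast
  qed
  with face S\<tau> show ?thesis by (rule that)
qed

end

section \<open>The sets \<open>E\<^sub>\<tau>(\<alpha>)\<close>\<close>

text \<open>Bilinear, without conjugation, so that it is a polynomial function of
  \<open>x\<close>.\<close>

definition pairing :: "complex^'n \<Rightarrow> complex^'n \<Rightarrow> complex" where
  "pairing w x = (\<Sum>i\<in>UNIV. w $ i * x $ i)"

lemma pairing_add: "pairing w (x + y) = pairing w x + pairing w y"
  and pairing_diff: "pairing w (x - y) = pairing w x - pairing w y"
  and pairing_scale: "pairing w (c *s x) = c * pairing w x"
  and pairing_diff_left: "pairing (w - v) x = pairing w x - pairing v x"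
  and pairing_scale_left: "pairing (c *s w) x = c * pairing w x"
  by (simp_all add: pairing_def algebra_simps sum.distrib sum_subtractf sum_distrib_left)

lemma pairing_sum: "pairing w (sum f I) = (\<Sum>i\<in>I. pairing w (f i))"
  by (induction I rule: infinite_finite_induct) (simp_all add: pairing_add, simp_all add: pairing_def)

lemma polyfun_pairing: "polyfun (pairing w)"
  unfolding pairing_def by (intro polyfun_sum polyfun_cmult polyfun_nth)

lemma pairing_Cspan:
  "finite S \<Longrightarrow> (\<And>s. s \<in> S \<Longrightarrow> pairing w (ivec s) = 0) \<Longrightarrow> x \<in> Cspan S \<Longrightarrow> pairing w x = 0"
  by (auto simp: Cspan_finite pairing_sum pairing_scale)

lemma Cspan_insert:
  assumes "finite S" "x - c *s ivec s \<in> Cspan S"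
  shows "x \<in> Cspan (insert s S)"
proof -
  have "c *s ivec s \<in> Cspan (insert s S)" unfolding Cspan_def
    by (intro CollectI exI[of _ "{s}"] exI[of _ "\<lambda>_. c"]) simp
  moreover have "x - c *s ivec s \<in> Cspan (insert s S)"
    using assms(2) Cspan_mono[of S "insert s S"] by blast
  ultimately show ?thesis using Cspan_add[of "insert s S"] assms(1) by fastforce
qed

text \<open>Duality by elimination. If \<open>w\<close> is nonzero at the new generator
  \<open>s\<close>, then \<open>l\<close> is corrected by a multiple of \<open>s\<close> until
  \<open>w\<close> vanishes on it, and the functional \<open>v\<close> found for the corrected
  vector is corrected by a multiple of \<open>w\<close> until it vanishes at
  \<open>s\<close>.\<close>

lemma Cspan_separate:
  fixes l :: "complex^'n"
  assumes "finite S" "l \<notin> Cspan S"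
  obtains w where "pairing w l \<noteq> 0" "\<forall>s\<in>S. pairing w (ivec s) = 0"
proof -
  have "\<exists>w. pairing w l \<noteq> 0 \<and> (\<forall>s\<in>S. pairing w (ivec s) = 0)"
    using assms
  proof (induction S arbitrary: l)
    case empty
    then have "l \<noteq> 0" by auto
    then obtain i where "l $ i \<noteq> 0" by (auto simp: vec_eq_iff)
    then show ?case
      by (intro exI[of _ "axis i 1"])
        (simp add: pairing_def axis_def if_distrib[of "\<lambda>x. x * _"] cong: if_cong)
  next
    case (insert s S)
    have "l \<notin> Cspan S" using insert.prems Cspan_mono[of S "insert s S"] by blast
    then obtain w where w: "pairing w l \<noteq> 0" "\<forall>s\<in>S. pairing w (ivec s) = 0"
      using insert.IH by blast
    show ?case
    proof (cases "pairing w (ivec s) = 0")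
      case True
      with w show ?thesis by auto
    next
      case False
      define c where "c = pairing w l / pairing w (ivec s)"
      have "l - c *s ivec s \<notin> Cspan S" using Cspan_insert[OF insert.hyps(1)] insert.prems by blast
      then obtain v where v: "pairing v (l - c *s ivec s) \<noteq> 0" "\<forall>s\<in>S. pairing v (ivec s) = 0"
        using insert.IH by blast
      define d where "d = pairing v (ivec s) / pairing w (ivec s)"
      have "pairing (v - d *s w) (ivec s) = 0"
        using False by (simp add: pairing_diff_left pairing_scale_left d_def)
      moreover have "pairing (v - d *s w) l = pairing v (l - c *s ivec s)"
        by (simp add: pairing_diff_left pairing_scale_left pairing_diff pairing_scale c_def d_def)
      ultimately show ?thesis using v w
        by (intro exI[of _ "v - d *s w"]) (auto simp: pairing_diff_left pairing_scale_left)
    qed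
  qed
  then show ?thesis using that by blast
qed

lemma ivec_QZ_in_Cspan:
  assumes "y \<in> QZ S"
  shows "ivec y \<in> Cspan S"
proof -
  obtain T and c :: "int^'a \<Rightarrow> rat" where T: "finite T" "T \<subseteq> S" "ivec y = (\<Sum>a\<in>T. c a *s ivec a)"
    using assms unfolding QZ_def by blast
  have "(ivec y :: complex^'a) = (\<Sum>a\<in>T. of_rat (c a) *s ivec a)"
  proof (rule iffD2[OF vec_eq_iff], rule allI)
    fix i
    have "of_rat ((ivec y :: rat^'a) $ i) = (of_rat (\<Sum>a\<in>T. c a * of_int (a $ i)) :: complex)"
      unfolding T(3) by simp
    then show "(ivec y :: complex^'a) $ i = (\<Sum>a\<in>T. of_rat (c a) *s ivec a) $ i"
      by (simp add: of_rat_sum of_rat_mult)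
  qed
  with T show ?thesis unfolding Cspan_def
    by (intro CollectI exI[of _ T] exI[of _ "\<lambda>a. of_rat (c a)"]) simp
qed

lemma ivec_in_Cspan_real:
  assumes "finite S" "ivec y \<in> Cspan S"
  obtains c where "(ivec y :: real^'n) = (\<Sum>a\<in>S. c a *\<^sub>R ivec a)"
proof -
  obtain c where c: "(ivec y :: complex^'n) = (\<Sum>a\<in>S. c a *s ivec a)"
    using assms(2) by (auto simp: Cspan_finite[OF assms(1)])
  have "(ivec y :: real^'n) = (\<Sum>a\<in>S. Re (c a) *\<^sub>R ivec a)"
  proof (rule iffD2[OF vec_eq_iff], rule allI)
    fix i
    show "(ivec y :: real^'n) $ i = (\<Sum>a\<in>S. Re (c a) *\<^sub>R ivec a) $ i"
      using arg_cong[OF c, of "\<lambda>v. Re (v $ i)"] by simp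
  qed
  then show ?thesis by (rule that)
qed

text \<open>Coefficients descend from complex to real by taking real parts, and from real to
  rational by \<open>multiple_of_combination\<close>. The lattice that defines the index thereby
  becomes comparable with the complex span in \<open>Eset\<close>.\<close>

lemma QZ_iff:
  assumes "finite S"
  shows "y \<in> QZ S \<longleftrightarrow> ivec y \<in> Cspan S"
proof
  assume "ivec y \<in> Cspan S"
  then obtain c where c: "(ivec y :: real^'a) = (\<Sum>a\<in>S. c a *\<^sub>R ivec a)"
    using ivec_in_Cspan_real[OF assms] by blast
  obtain q :: nat and p where q: "q > 0" "of_nat q *s y = (\<Sum>a\<in>S. p a *s a)"
    using multiple_of_combination[OF assms c] .
  have "(ivec y :: rat^'a) = (\<Sum>a\<in>S. (of_int (p a) / of_nat q) *s ivec a)"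
  proof (rule iffD2[OF vec_eq_iff], rule allI)
    fix i
    have "of_nat q * (of_int (y $ i) :: rat) = (\<Sum>a\<in>S. of_int (p a) * of_int (a $ i))"
      using arg_cong[OF q(2), of "\<lambda>v. of_int (v $ i) :: rat"] by simp
    then show "(ivec y :: rat^'a) $ i = (\<Sum>a\<in>S. (of_int (p a) / of_nat q) *s ivec a) $ i"
      using q(1) by (simp add: field_simps flip: sum_divide_distrib)
  qed
  then show "y \<in> QZ S" unfolding QZ_def using assms
    by (intro CollectI exI[of _ S] exI[of _ "\<lambda>a. of_int (p a) / of_nat q"]) simp
qed (rule ivec_QZ_in_Cspan)

definition coset :: "(int^'n) set \<Rightarrow> complex^'n \<Rightarrow> (complex^'n) set" where
  "coset S l = {l + ivec z | z. z \<in> Zspan S}"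

lemma coset_eq_iff:
  assumes "finite S"
  shows "coset S l = coset S l' \<longleftrightarrow> (\<exists>z\<in>Zspan S. l' = l + ivec z)"
proof
  assume "coset S l = coset S l'"
  moreover have "l' \<in> coset S l'" unfolding coset_def by (intro CollectI exI[of _ 0]) simp
  ultimately show "\<exists>z\<in>Zspan S. l' = l + ivec z" unfolding coset_def by blast
next
  assume "\<exists>z\<in>Zspan S. l' = l + ivec z"
  then obtain z where z: "z \<in> Zspan S" "l' = l + ivec z" by blast
  show "coset S l = coset S l'"
  proof (intro subset_antisym subsetI)
    fix x assume "x \<in> coset S l"
    then obtain y where "y \<in> Zspan S" "x = l + ivec y" unfolding coset_def by blast
    then show "x \<in> coset S l'" unfolding coset_def z(2)
      using Zspan_diff[OF assms, of y z] z(1)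
      by (intro CollectI exI[of _ "y - z"]) (simp add: ivec_diff)
  next
    fix x assume "x \<in> coset S l'"
    then obtain y where "y \<in> Zspan S" "x = l + ivec z + ivec y" unfolding coset_def z(2) by blast
    then show "x \<in> coset S l" unfolding coset_def
      using Zspan_add[OF assms z(1), of y]
      by (intro CollectI exI[of _ "z + y"]) (simp add: ivec_add)
  qed
qed

context affine_monoid
begin

text \<open>\<open>E_\<tau>(\<alpha>)\<close> on representatives instead of cosets; by
  \<open>in_E_add\<close> it depends only on the coset of \<open>l\<close>.\<close>

definition in_E :: "(real^'n) set \<Rightarrow> complex^'n \<Rightarrow> complex^'n \<Rightarrow> bool" where
  "in_E \<tau> \<alpha> l \<longleftrightarrow> l \<in> Cspan (Aface A \<tau>) \<and>
     (\<exists>a\<in>Nspan A. \<exists>z\<in>Zspan (Aface A \<tau>). \<alpha> - l = ivec (a + z))"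

lemma Eset_eq: "Eset A \<tau> \<alpha> = {coset (Aface A \<tau>) l | l. in_E \<tau> \<alpha> l}"
  unfolding Eset_def coset_def in_E_def by auto

lemma in_E_add:
  assumes "in_E \<tau> \<alpha> l" "y \<in> Zspan (Aface A \<tau>)"
  shows "in_E \<tau> \<alpha> (l + ivec y)"
proof -
  obtain a z where az: "a \<in> Nspan A" "z \<in> Zspan (Aface A \<tau>)" "\<alpha> - l = ivec (a + z)"
    and l: "l \<in> Cspan (Aface A \<tau>)"
    using assms(1) unfolding in_E_def by blast
  have "\<alpha> - (l + ivec y) = (\<alpha> - l) - ivec y" by simp
  also have "\<dots> = ivec (a + (z - y))" unfolding az(3) by (simp add: ivec_add ivec_diff)
  finally have "\<alpha> - (l + ivec y) = ivec (a + (z - y))" .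
  then show ?thesis unfolding in_E_def
    using az(1) Zspan_diff[OF fin_Aface az(2) assms(2)]
      Cspan_add[OF fin_Aface l ivec_Zspan_in_Cspan[OF assms(2)]] by blast
qed

lemma coset_in_Eset_iff: "coset (Aface A \<tau>) l \<in> Eset A \<tau> \<alpha> \<longleftrightarrow> in_E \<tau> \<alpha> l"
proof
  assume "coset (Aface A \<tau>) l \<in> Eset A \<tau> \<alpha>"
  then obtain l' where "in_E \<tau> \<alpha> l'" "coset (Aface A \<tau>) l' = coset (Aface A \<tau>) l"
    unfolding Eset_eq by auto
  then show "in_E \<tau> \<alpha> l" using in_E_add[of \<tau> \<alpha> l'] by (auto simp: coset_eq_iff[OF fin_Aface])
qed (auto simp: Eset_eq)

text \<open>The cosets of all \<open>l\<close> with \<open>\<alpha> - l\<close> integral form a set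
  \<open>T\<close>, the translate by \<open>l0\<close> of a finite group whose order is the index.
  Since \<open>E_\<tau>(\<alpha>)\<close> is a subset of \<open>T\<close>, it has as many elements
  only if it equals \<open>T\<close>.\<close>

lemma Efull_iff:
  assumes "l0 \<in> Cspan (Aface A \<tau>)" "\<alpha> - l0 = ivec z0"
  shows "Efull A \<tau> \<alpha> \<longleftrightarrow> (\<forall>l\<in>Cspan (Aface A \<tau>). (\<exists>z. \<alpha> - l = ivec z) \<longrightarrow> in_E \<tau> \<alpha> l)"
proof -
  let ?S = "Aface A \<tau>"
  define T where "T = {coset ?S l | l. l \<in> Cspan ?S \<and> (\<exists>z. \<alpha> - l = ivec z)}"
  define QQ where "QQ = {{y + z | z. z \<in> Zspan ?S} | y. y \<in> QZ ?S}"
  define f where "f C = (\<lambda>y. l0 + ivec y) ` C" for C :: "(int^'n) set"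
  have fy: "f {y + z | z. z \<in> Zspan ?S} = coset ?S (l0 + ivec y)" for y
    unfolding f_def coset_def by (force simp: ivec_add add.assoc image_iff)
  have "f ` QQ = T"
  proof (intro subset_antisym subsetI)
    fix C assume "C \<in> f ` QQ"
    then obtain y where y: "y \<in> QZ ?S" "C = coset ?S (l0 + ivec y)"
      unfolding QQ_def using fy by auto
    have "l0 + ivec y \<in> Cspan ?S"
      using assms(1) y(1) QZ_iff[OF fin_Aface] Cspan_add[OF fin_Aface] by blast
    moreover have "\<alpha> - (l0 + ivec y) = ivec (z0 - y)" using assms(2) by (simp add: ivec_diff algebra_simps)
    ultimately show "C \<in> T" unfolding T_def y(2) by blast
  next
    fix C assume "C \<in> T"
    then obtain l z where l: "l \<in> Cspan ?S" "\<alpha> - l = ivec z" "C = coset ?S l" unfolding T_def by blast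
    have eq: "l = l0 + ivec (z0 - z)" using assms(2) l(2) by (simp add: ivec_diff algebra_simps)
    then have "ivec (z0 - z) = l - l0" by simp
    then have "z0 - z \<in> QZ ?S" using QZ_iff[OF fin_Aface] Cspan_diff[OF fin_Aface l(1) assms(1)] by simp
    then show "C \<in> f ` QQ" unfolding l(3) eq QQ_def using fy[of "z0 - z", symmetric] by blast
  qed
  moreover have "inj_on f QQ"
    unfolding f_def by (intro inj_onI) (simp add: inj_image_eq_iff inj_def)
  moreover have "finite QQ"
  proof (rule finite_subset)
    \<comment> \<open>Rounding moves every representative into a fixed box of integer vectors, so
      there are finitely many cosets.\<close>
    define B where "B = (\<Sum>a\<in>?S. \<Sum>i\<in>UNIV. \<bar>a $ i\<bar>)"
    show "finite ((\<lambda>y. {y + z | z. z \<in> Zspan ?S}) ` {z :: int^'n. \<forall>i. \<bar>z $ i\<bar> \<le> B})"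
      by (intro finite_imageI finite_int_box)
    show "QQ \<subseteq> (\<lambda>y. {y + z | z. z \<in> Zspan ?S}) ` {z :: int^'n. \<forall>i. \<bar>z $ i\<bar> \<le> B}"
    proof
      fix C assume "C \<in> QQ"
      then obtain y where y: "y \<in> QZ ?S" "C = {y + z | z. z \<in> Zspan ?S}" unfolding QQ_def by blast
      obtain c where "(ivec y :: real^'n) = (\<Sum>a\<in>?S. c a *\<^sub>R ivec a)"
        using ivec_in_Cspan_real[OF fin_Aface] y(1) QZ_iff[OF fin_Aface] by blast
      from round_combination[OF this]
      have box: "\<bar>(y - (\<Sum>a\<in>?S. \<lfloor>c a\<rfloor> *s a)) $ i\<bar> \<le> B" for i unfolding B_def .
      define s where "s = (\<Sum>a\<in>?S. \<lfloor>c a\<rfloor> *s a)"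
      have s: "s \<in> Zspan ?S" unfolding s_def by (rule Zspan_finiteI[OF fin_Aface refl])
      have "C = {(y - s) + z | z. z \<in> Zspan ?S}"
      proof (intro subset_antisym subsetI)
        fix x assume "x \<in> C"
        then obtain z where "z \<in> Zspan ?S" "x = y + z" unfolding y(2) by blast
        then have "s + z \<in> Zspan ?S" "x = (y - s) + (s + z)" using Zspan_add[OF fin_Aface s] by auto
        then show "x \<in> {(y - s) + z | z. z \<in> Zspan ?S}" by blast
      next
        fix x assume "x \<in> {(y - s) + z | z. z \<in> Zspan ?S}"
        then obtain z where "z \<in> Zspan ?S" "x = (y - s) + z" by blast
        then have "z - s \<in> Zspan ?S" "x = y + (z - s)" using Zspan_diff[OF fin_Aface _ s] by auto
        then show "x \<in> C" unfolding y(2) by blast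
      qed
      then show "C \<in> (\<lambda>y. {y + z | z. z \<in> Zspan ?S}) ` {z :: int^'n. \<forall>i. \<bar>z $ i\<bar> \<le> B}"
        using box unfolding s_def by blast
    qed
  qed
  ultimately have T: "card T = face_index A \<tau>" "finite T"
    unfolding face_index_def QQ_def[symmetric] by (auto simp: card_image)
  have sub: "Eset A \<tau> \<alpha> \<subseteq> T"
    unfolding Eset_eq T_def in_E_def by blast
  have "Efull A \<tau> \<alpha> \<longleftrightarrow> T \<subseteq> Eset A \<tau> \<alpha>"
    unfolding Efull_def T(1)[symmetric] using card_subset_eq[OF T(2) sub] sub by auto
  also have "\<dots> \<longleftrightarrow> (\<forall>l\<in>Cspan ?S. (\<exists>z. \<alpha> - l = ivec z) \<longrightarrow> in_E \<tau> \<alpha> l)"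
    unfolding T_def using coset_in_Eset_iff[of \<tau> _ \<alpha>] by blast
  finally show ?thesis .
qed

text \<open>A polynomial vanishing on \<open>b + \<nat>(A \<inter> \<tau>)\<close> vanishes on \<open>b + \<complex>(A \<inter> \<tau>)\<close>.\<close>

lemma in_E_reach:
  assumes "reach A \<alpha> a" "in_E \<tau> \<alpha> l"
  shows "in_E \<tau> (\<alpha> + ivec a) l"
proof (rule ccontr)
  assume neg: "\<not> in_E \<tau> (\<alpha> + ivec a) l"
  let ?S = "Aface A \<tau>"
  obtain q where q: "polyfun q" "shift_op a q \<in> DA A" "q \<alpha> \<noteq> 0"
    using assms(1) unfolding reach_def by blast
  obtain b z where bz: "b \<in> Nspan A" "z \<in> Zspan ?S" "\<alpha> - l = ivec (b + z)" and l: "l \<in> Cspan ?S"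
    using assms(2) unfolding in_E_def by blast
  \<comment> \<open>If \<open>q\<close> were nonzero here, the operator would put
    \<open>b + x + a\<close> into the monoid, which would witness \<open>l\<close> for
    \<open>\<alpha> + a\<close>.\<close>
  have "q (ivec b + ivec x) = 0" if x: "x \<in> Nspan ?S" for x
  proof (rule ccontr)
    assume "q (ivec b + ivec x) \<noteq> 0"
    moreover have "b + x \<in> Nspan A" using bz(1) x Nspan_mono[OF Aface_subset] Nspan_add[OF fin] by blast
    ultimately have "b + x + a \<in> Nspan A"
      using q(2) unfolding shift_op_in_DA_iff[OF q(1)] by (simp add: ivec_add)
    moreover have "z - x \<in> Zspan ?S"
      using bz(2) x Nspan_subset_Zspan Zspan_diff[OF fin_Aface] by blast
    moreover have "\<alpha> + ivec a - l = ivec ((b + x + a) + (z - x))"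
      using bz(3) by (simp add: ivec_add ivec_diff algebra_simps)
    ultimately show False using neg l unfolding in_E_def by blast
  qed
  note vanish = this
  have "ivec z + l \<in> Cspan ?S"
    by (intro Cspan_add fin_Aface ivec_Zspan_in_Cspan bz(2) l)
  from polyfun_zero_on_Cspan[OF q(1) fin_Aface vanish this]
  have "q (ivec b + (ivec z + l)) = 0" .
  moreover have "ivec b + (ivec z + l) = \<alpha>" using bz(3) by (simp add: ivec_add algebra_simps)
  ultimately show False using q(3) by simp
qed

text \<open>Induction over \<open>S\<close>, treating all translates \<open>b + \<nat>S\<close>. If
  some point \<open>b + n\<close> stays in the monoid after adding \<open>a\<close>, so does every
  point beyond it; all others have a coefficient below that of \<open>n\<close> and lie in finitely
  many translates with one generator fewer, whose polynomials are multiplied. If no point stays, one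
  linear form constant on the translate must separate it from \<alpha>.\<close>

lemma reach_if_in_E:
  assumes "\<And>\<tau> l. face A \<tau> \<Longrightarrow> in_E \<tau> \<alpha> l \<Longrightarrow> in_E \<tau> (\<alpha> + ivec a) l"
  shows "reach A \<alpha> a"
proof -
  have "\<forall>b\<in>Nspan A. \<exists>q. polyfun q \<and> q \<alpha> \<noteq> 0 \<and>
      (\<forall>x\<in>Nspan S. b + x + a \<notin> Nspan A \<longrightarrow> q (ivec (b + x)) = 0)" if "S \<subseteq> A" for S
    using finite_subset[OF that fin] that
  proof (induction S rule: finite_psubset_induct)
    case (psubset S)
    show ?case
    proof
      fix b assume b: "b \<in> Nspan A"
      show "\<exists>q. polyfun q \<and> q \<alpha> \<noteq> 0 \<and>
          (\<forall>x\<in>Nspan S. b + x + a \<notin> Nspan A \<longrightarrow> q (ivec (b + x)) = 0)"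
      proof (cases "\<exists>n\<in>Nspan S. b + n + a \<in> Nspan A")
        case True
        then obtain n where n: "b + (\<Sum>s\<in>S. of_nat (n s) *s s) + a \<in> Nspan A"
          by (auto simp: Nspan_finite[OF psubset.hyps])
        have "\<forall>s\<in>S. \<forall>j. \<exists>q. polyfun q \<and> q \<alpha> \<noteq> 0 \<and>
          (\<forall>x\<in>Nspan (S - {s}). b + of_nat j *s s + x + a \<notin> Nspan A \<longrightarrow> q (ivec (b + of_nat j *s s + x)) = 0)"
        proof (intro ballI allI)
          fix s j assume s: "s \<in> S"
          have "b + of_nat j *s s \<in> Nspan A"
            using Nspan_add[OF fin b Nspan_scale[OF fin Nspan_superset]] s psubset.prems by blast
          moreover have "S - {s} \<subset> S" "S - {s} \<subseteq> A" using s psubset.prems by auto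
          ultimately show "\<exists>q. polyfun q \<and> q \<alpha> \<noteq> 0 \<and>
            (\<forall>x\<in>Nspan (S - {s}). b + of_nat j *s s + x + a \<notin> Nspan A \<longrightarrow> q (ivec (b + of_nat j *s s + x)) = 0)"
            using psubset.IH[of "S - {s}"] by blast
        qed
        then obtain Q where Q: "\<And>s j. s \<in> S \<Longrightarrow> polyfun (Q s j) \<and> Q s j \<alpha> \<noteq> 0 \<and>
          (\<forall>x\<in>Nspan (S - {s}). b + of_nat j *s s + x + a \<notin> Nspan A \<longrightarrow> Q s j (ivec (b + of_nat j *s s + x)) = 0)"
          by metis
        define q where "q = (\<lambda>x. \<Prod>s\<in>S. \<Prod>j<n s. Q s j x)"
        show ?thesis
        proof (intro exI[of _ q] conjI ballI impI)
          show "polyfun q" unfolding q_def by (intro polyfun_prod) (use Q in blast)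
          show "q \<alpha> \<noteq> 0" unfolding q_def using Q psubset.hyps by simp
          fix x assume x: "x \<in> Nspan S" and nx: "b + x + a \<notin> Nspan A"
          obtain c where c: "x = (\<Sum>s\<in>S. of_nat (c s) *s s)"
            using x by (auto simp: Nspan_finite[OF psubset.hyps])
          have "\<exists>s\<in>S. c s < n s"
          proof (rule ccontr)
            assume "\<not> (\<exists>s\<in>S. c s < n s)"
            then have "x = (\<Sum>s\<in>S. of_nat (n s) *s s) + (\<Sum>s\<in>S. of_nat (c s - n s) *s s)"
              unfolding c
              by (simp flip: sum.distrib vector_sadd_rdistrib add: of_nat_diff not_less)
            then have "b + x + a =
                (b + (\<Sum>s\<in>S. of_nat (n s) *s s) + a) + (\<Sum>s\<in>S. of_nat (c s - n s) *s s)" by simp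
            moreover have "(\<Sum>s\<in>S. of_nat (c s - n s) *s s) \<in> Nspan A"
              by (rule subsetD[OF Nspan_mono[OF psubset.prems] Nspan_finiteI[OF psubset.hyps refl]])
            ultimately have "b + x + a \<in> Nspan A" by (simp only: Nspan_add[OF fin n])
            with nx show False by simp
          qed
          then obtain s where s: "s \<in> S" "c s < n s" by blast
          define x' where "x' = (\<Sum>s\<in>S - {s}. of_nat (c s) *s s)"
          have x': "x' \<in> Nspan (S - {s})" unfolding x'_def
            using psubset.hyps by (intro Nspan_finiteI[OF _ refl]) simp
          have bx: "b + x = b + of_nat (c s) *s s + x'"
            unfolding c x'_def using sum.remove[OF psubset.hyps s(1)] by simp
          have "Q s (c s) (ivec (b + x)) = 0" using Q[OF s(1), of "c s"] x' nx unfolding bx by blast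
          then show "q (ivec (b + x)) = 0"
            unfolding q_def using s psubset.hyps by auto
        qed
      next
        case False
        have fS: "finite S" by (rule psubset.hyps)
        obtain \<tau> where \<tau>: "face A \<tau>" "S \<subseteq> Aface A \<tau>"
          and sh: "\<forall>z\<in>Zspan (Aface A \<tau>). \<exists>s\<in>Nspan S. s + z \<in> Nspan A"
          by (rule smallest_face[OF psubset.prems]) blast
        \<comment> \<open>Otherwise \<open>\<alpha> - b\<close> represents an element of
          \<open>E_\<tau>(\<alpha>)\<close>, hence of \<open>E_\<tau>(\<alpha> + a)\<close>, so
          \<open>b + a = a' + z\<close> with \<open>z\<close> in
          \<open>\<int>(A \<inter> \<tau>)\<close>. Clearing \<open>z\<close> by an element
          \<open>s\<close> of \<nat>S puts \<open>b + s + a\<close> into the monoid, against the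
          case assumption.\<close>
        have "\<alpha> - ivec b \<notin> Cspan S"
        proof
          assume "\<alpha> - ivec b \<in> Cspan S"
          then have l: "\<alpha> - ivec b \<in> Cspan (Aface A \<tau>)" using Cspan_mono[OF \<tau>(2)] by blast
          have "in_E \<tau> \<alpha> (\<alpha> - ivec b)" unfolding in_E_def
            using l b by (intro conjI bexI[of _ b] bexI[of _ 0]) auto
          then have "in_E \<tau> (\<alpha> + ivec a) (\<alpha> - ivec b)" by (rule assms[OF \<tau>(1)])
          then obtain a' z where az: "a' \<in> Nspan A" "z \<in> Zspan (Aface A \<tau>)"
              "\<alpha> + ivec a - (\<alpha> - ivec b) = ivec (a' + z)" unfolding in_E_def by blast
          from az(3) have "(ivec (b + a) :: complex^'n) = ivec (a' + z)" by (simp add: ivec_add algebra_simps)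
          then have ba: "b + a = a' + z" by (simp only: ivec_eq_iff)
          obtain s where s: "s \<in> Nspan S" "s + z \<in> Nspan A" using sh az(2) by blast
          have "b + s + a = (b + a) + s" by (simp add: algebra_simps)
          also have "\<dots> = a' + (s + z)" unfolding ba by (simp add: algebra_simps)
          finally have "b + s + a \<in> Nspan A" by (simp only: Nspan_add[OF fin az(1) s(2)])
          with s(1) False show False by blast
        qed
        then obtain w where w: "pairing w (\<alpha> - ivec b) \<noteq> 0" "\<forall>s\<in>S. pairing w (ivec s) = 0"
          using Cspan_separate[OF fS] by blast
        have "pairing w (ivec x) = 0" if "x \<in> Nspan S" for x
          using pairing_Cspan[OF fS, of w "ivec x"] w(2) ivec_Zspan_in_Cspan[of x S] Nspan_subset_Zspan[of S] that
          by blast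
        then show ?thesis using w(1)
          by (intro exI[of _ "\<lambda>x. pairing w (x + - ivec b)"] conjI polyfun_translate polyfun_pairing)
            (auto simp: ivec_add)
      qed
    qed
  qed
  from this[OF order_refl] obtain q where "polyfun q" "q \<alpha> \<noteq> 0"
      "\<forall>x\<in>Nspan A. 0 + x + a \<notin> Nspan A \<longrightarrow> q (ivec (0 + x)) = 0"
    using Nspan_0 by blast
  then show ?thesis unfolding reach_def by (intro exI[of _ q]) (auto simp: shift_op_in_DA_iff)
qed

end

section \<open>Zariski density of an equivalence class\<close>

context affine_monoid
begin

lemma FC_pairing: "FC A \<sigma> x = pairing (\<chi> i. complex_of_real (Fform A \<sigma> $ i)) x"
  by (simp add: FC_def pairing_def)

lemma FC_add: "FC A \<sigma> (x + y) = FC A \<sigma> x + FC A \<sigma> y"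
  and FC_diff: "FC A \<sigma> (x - y) = FC A \<sigma> x - FC A \<sigma> y"
  by (simp_all add: FC_pairing pairing_add pairing_diff)

lemma polyfun_FC: "polyfun (FC A \<sigma>)"
  unfolding FC_pairing by (rule polyfun_pairing)

lemma FC_ivec: "\<sigma> \<in> facets \<Longrightarrow> FC A \<sigma> (ivec z) = of_int (Fint \<sigma> z)"
proof -
  assume "\<sigma> \<in> facets"
  then have "complex_of_real (of_int (Fint \<sigma> z)) = complex_of_real (inner (Fform A \<sigma>) (ivec z))"
    by (simp only: of_int_Fint)
  also have "\<dots> = FC A \<sigma> (ivec z)" by (simp add: FC_def inner_vec_def)
  finally show ?thesis by simp
qed

lemma FC_Cspan_zero:
  assumes "\<sigma> \<in> facets" "\<tau> \<subseteq> \<sigma>" "l \<in> Cspan (Aface A \<tau>)"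
  shows "FC A \<sigma> l = 0"
  unfolding FC_pairing
proof (rule pairing_Cspan[OF fin_Aface _ assms(3)])
  fix s assume "s \<in> Aface A \<tau>"
  then have "s \<in> Aface A \<sigma>" "s \<in> A" using assms(2) by (auto simp: Aface_def)
  then show "pairing (\<chi> i. complex_of_real (Fform A \<sigma> $ i)) (ivec s) = 0"
    using FC_ivec[OF assms(1), of s] Fint_eq_0_iff[OF assms(1), of s] by (simp add: FC_pairing)
qed

text \<open>By duality: a functional that vanishes on the generators of the facet has real and
  imaginary parts vanishing on \<open>span \<sigma>\<close>, so it is a complex multiple of
  \<open>F_\<sigma>\<close>.\<close>

lemma FC_zero_imp_Cspan:
  assumes "\<sigma> \<in> facets" "FC A \<sigma> l = 0"
  shows "l \<in> Cspan (Aface A \<sigma>)"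
proof (rule ccontr)
  assume "l \<notin> Cspan (Aface A \<sigma>)"
  then obtain w where w: "pairing w l \<noteq> 0" "\<forall>s\<in>Aface A \<sigma>. pairing w (ivec s) = 0"
    using Cspan_separate[OF fin_Aface] by blast
  let ?F = "Fform A \<sigma>"
  have nz: "?F \<noteq> 0" using is_Fform_Fform[OF assms(1)] is_Fform_nonzero by blast
  have multiple: "\<exists>t. v = t *\<^sub>R ?F" if v: "\<And>s. s \<in> Aface A \<sigma> \<Longrightarrow> inner v (ivec s) = 0" for v
  proof -
    have "inner v x = 0" if x: "x \<in> \<sigma>" for x
    proof -
      obtain c where c: "\<And>a. a \<in> A - Aface A \<sigma> \<Longrightarrow> c a = 0" "x = (\<Sum>a\<in>A. c a *\<^sub>R ivec a)"
        by (rule face_generated[OF facet_face[OF assms(1)] x]) blast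
      have "c a * inner v (ivec a) = 0" if "a \<in> A" for a
        using c(1)[of a] v[of a] that by (cases "a \<in> Aface A \<sigma>") auto
      then have "(\<Sum>a\<in>A. c a * inner v (ivec a)) = 0" by (intro sum.neutral) blast
      then show ?thesis unfolding c(2) by (simp add: inner_sum_right)
    qed
    then have "span \<sigma> \<subseteq> {x. inner v x = 0}"
      by (intro span_minimal) (auto simp: subspace_hyperplane)
    then have ker: "inner v x = 0" if "inner ?F x = 0" for x
      using that span_facet[OF assms(1)] by blast
    define t where "t = inner v ?F / inner ?F ?F"
    have "inner ?F (v - t *\<^sub>R ?F) = 0"
      using nz by (simp add: t_def inner_diff_right inner_commute)
    moreover from this have "inner v (v - t *\<^sub>R ?F) = 0" by (rule ker)
    ultimately have "inner (v - t *\<^sub>R ?F) (v - t *\<^sub>R ?F) = 0" by (simp add: inner_diff_left)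
    then show ?thesis by (intro exI[of _ t]) simp
  qed
  have "inner (\<chi> i. Re (w $ i)) (ivec s) = Re (pairing w (ivec s))"
      "inner (\<chi> i. Im (w $ i)) (ivec s) = Im (pairing w (ivec s))" for s
    by (simp_all add: inner_vec_def pairing_def)
  then obtain t t' where t: "(\<chi> i. Re (w $ i)) = t *\<^sub>R ?F" "(\<chi> i. Im (w $ i)) = t' *\<^sub>R ?F"
    using multiple[of "\<chi> i. Re (w $ i)"] multiple[of "\<chi> i. Im (w $ i)"] w(2) by auto
  have "w = Complex t t' *s (\<chi> i. complex_of_real (?F $ i))"
    using t by (simp add: vec_eq_iff complex_eq_iff)
  then have "pairing w l = Complex t t' * FC A \<sigma> l"
    by (simp add: FC_pairing pairing_scale_left)
  with w(1) assms(2) show False by simp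
qed

lemma FC_in_E:
  assumes "\<sigma> \<in> facets" "\<tau> \<subseteq> \<sigma>" "l \<in> Cspan (Aface A \<tau>)" "\<alpha> - l = ivec z"
  shows "FC A \<sigma> \<alpha> = of_int (Fint \<sigma> z)"
  using FC_diff[of \<sigma> \<alpha> l] FC_Cspan_zero[OF assms(1-3)] FC_ivec[OF assms(1)] assms(4) by simp

text \<open>For a facet the kernel of \<open>F_\<sigma>\<close> is
  \<open>\<complex>(A \<inter> \<sigma>)\<close>, so a value in \<open>F_\<sigma>(\<nat>A)\<close>
  means that \<open>E_\<sigma>(\<alpha>)\<close> is nonempty. This makes \<open>Fplus\<close> an
  invariant of the class.\<close>

lemma Fplus_iff_in_E: "\<sigma> \<in> Fplus A \<alpha> \<longleftrightarrow> \<sigma> \<in> facets \<and> (\<exists>l. in_E \<sigma> \<alpha> l)"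
proof
  assume "\<sigma> \<in> Fplus A \<alpha>"
  then obtain a where a: "\<sigma> \<in> facets" "a \<in> Nspan A" "FC A \<sigma> \<alpha> = FC A \<sigma> (ivec a)"
    unfolding Fplus_def facets_def by blast
  have "\<alpha> - ivec a \<in> Cspan (Aface A \<sigma>)"
    using a(3) by (intro FC_zero_imp_Cspan a(1)) (simp add: FC_diff)
  then have "in_E \<sigma> \<alpha> (\<alpha> - ivec a)" unfolding in_E_def
    using a(2) by (intro conjI bexI[of _ a] bexI[of _ 0]) auto
  with a(1) show "\<sigma> \<in> facets \<and> (\<exists>l. in_E \<sigma> \<alpha> l)" by blast
next
  assume "\<sigma> \<in> facets \<and> (\<exists>l. in_E \<sigma> \<alpha> l)"
  then obtain l a z where \<sigma>: "\<sigma> \<in> facets" and l: "l \<in> Cspan (Aface A \<sigma>)"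
    and az: "a \<in> Nspan A" "z \<in> Zspan (Aface A \<sigma>)" "\<alpha> - l = ivec (a + z)"
    unfolding in_E_def by blast
  have "FC A \<sigma> \<alpha> = FC A \<sigma> (ivec a)"
    using FC_in_E[OF \<sigma> order_refl l az(3)] FC_ivec[OF \<sigma>] Fint_Zspan_face[OF \<sigma> order_refl az(2)]
    by (simp add: Fint_add[OF \<sigma>])
  with \<sigma> az(1) show "\<sigma> \<in> Fplus A \<alpha>" unfolding Fplus_def facets_def by blast
qed

lemma Fplus_facets: "\<sigma> \<in> Fplus A \<alpha> \<Longrightarrow> \<sigma> \<in> facets"
  and Fminus_facets: "\<sigma> \<in> Fminus A \<alpha> \<Longrightarrow> \<sigma> \<in> facets"
  by (auto simp: Fplus_def Fminus_def facets_def)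

lemma Fplus_nonneg:
  assumes "\<sigma> \<in> Fplus A \<alpha>"
  obtains n where "0 \<le> n" "FC A \<sigma> \<alpha> = of_int n"
  using assms FC_ivec[of \<sigma>] Fint_Nspan[of \<sigma>] unfolding Fplus_def facets_def by auto

lemma Fminus_iff: "\<sigma> \<in> Fminus A \<alpha> \<longleftrightarrow> \<sigma> \<in> facets \<and> FC A \<sigma> \<alpha> \<in> \<int> \<and> \<sigma> \<notin> Fplus A \<alpha>"
  by (auto simp: Fplus_def Fminus_def facets_def)

definition equivalent :: "complex^'n \<Rightarrow> complex^'n \<Rightarrow> bool" where
  "equivalent \<alpha> \<beta> \<longleftrightarrow> (\<forall>\<tau> l. face A \<tau> \<longrightarrow> (in_E \<tau> \<alpha> l \<longleftrightarrow> in_E \<tau> \<beta> l))"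

lemma equivalent_iff_reach:
  "equivalent \<alpha> (\<alpha> + ivec a) \<longleftrightarrow> reach A \<alpha> a \<and> reach A (\<alpha> + ivec a) (- a)"
proof -
  have shift_back: "\<alpha> + ivec a + ivec (- a) = \<alpha>" by (simp add: ivec_minus)
  show ?thesis unfolding equivalent_def
    using in_E_reach[of \<alpha> a] in_E_reach[of "\<alpha> + ivec a" "- a"]
      reach_if_in_E[of \<alpha> a] reach_if_in_E[of "\<alpha> + ivec a" "- a"] unfolding shift_back by blast
qed

lemma equivalent_Fplus: "equivalent \<alpha> \<beta> \<Longrightarrow> Fplus A \<alpha> = Fplus A \<beta>"
  by (rule set_eqI) (use facet_face in \<open>unfold equivalent_def Fplus_iff_in_E, blast\<close>)

text \<open>The product of the linear factors \<open>F_\<sigma> - k\<close>. No factor is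
  identically zero, because \<open>F_\<sigma>\<close> takes the values 0 and 1, and there are no
  zero divisors.\<close>

lemma hyperplanes:
  assumes "finite H" "fst ` H \<subseteq> facets"
  obtains p x where "polyfun p" "p x \<noteq> 0" "\<forall>y. \<forall>(\<sigma>, k)\<in>H. FC A \<sigma> y = k \<longrightarrow> p y = 0"
proof -
  define P where "P H = (\<lambda>x. \<Prod>h\<in>H. FC A (fst h) x - snd h)" for H :: "((real^'n) set \<times> complex) set"
  have poly: "polyfun (\<lambda>x. FC A (fst h) x - snd h)" for h
    by (intro polyfun_diff polyfun_FC polyfun_const)
  then have P: "polyfun (P H)" for H unfolding P_def by (intro polyfun_prod)
  have "\<exists>x. P H x \<noteq> 0"
    using assms
  proof (induction H rule: finite_induct)
    case empty
    then show ?case by (simp add: P_def)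
  next
    case (insert h H)
    then obtain y where y: "P H y \<noteq> 0" by auto
    have h: "fst h \<in> facets" using insert.prems by simp
    obtain z where z: "Fint (fst h) z = 1" using Fint_surj[OF h] .
    have "\<exists>x. FC A (fst h) x - snd h \<noteq> 0"
    proof (rule ccontr)
      assume "\<nexists>x. FC A (fst h) x - snd h \<noteq> 0"
      then have "FC A (fst h) (ivec z) = FC A (fst h) (ivec 0)" by simp
      then show False unfolding FC_ivec[OF h] z Fint_0[OF h] by simp
    qed
    then have "\<exists>x. (FC A (fst h) x - snd h) * P H x \<noteq> 0"
      using polyfun_mult_eq_zero[OF poly P, of h H y] y by blast
    then show ?case using insert.hyps by (simp add: P_def)
  qed
  then obtain x where "P H x \<noteq> 0" by blast
  moreover have "P H y = 0" if "(\<sigma>, k) \<in> H" "FC A \<sigma> y = k" for y \<sigma> k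
    unfolding P_def using assms(1) that by (intro prod_zero) force+
  ultimately show ?thesis using that P by blast
qed

text \<open>Let \<open>r\<close> vanish where some facet form takes a value from 0 to
  \<open>B - 1\<close>, with \<open>B\<close> bounding all values at \<open>a - c\<close>. Points of
  \<nat>A off these hyperplanes stay in the cone after adding \<open>a - c\<close>, and the
  conductor \<open>c\<close> then gives \<open>m + a\<close> in \<nat>A.\<close>

lemma exists_operator:
  obtains r y where "polyfun r" "shift_op a r \<in> DA A" "r y \<noteq> 0"
proof -
  obtain c where c: "c \<in> Nspan A" "\<forall>z. ivec z \<in> cone A \<longrightarrow> c + z \<in> Nspan A"
    by (rule conductor) blast
  define B where "B = (\<Sum>\<sigma>\<in>facets. \<bar>Fint \<sigma> (a - c)\<bar>)"
  have B: "\<bar>Fint \<sigma> (a - c)\<bar> \<le> B" if "\<sigma> \<in> facets" for \<sigma>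
    unfolding B_def using finite_facets that by (intro member_le_sum) auto
  obtain r y where r: "polyfun r" "r y \<noteq> 0"
      "\<forall>y. \<forall>(\<sigma>, k)\<in>facets \<times> of_int ` {0..<B}. FC A \<sigma> y = k \<longrightarrow> r y = 0"
    by (rule hyperplanes[of "facets \<times> of_int ` {0..<B}"]) (use finite_facets in auto)
  have "shift_op a r \<in> DA A"
    unfolding shift_op_in_DA_iff[OF r(1)]
  proof (intro ballI impI)
    fix m assume m: "m \<in> Nspan A" "r (ivec m) \<noteq> 0"
    show "m + a \<in> Nspan A"
    proof (rule ccontr)
      assume "m + a \<notin> Nspan A"
      then have "\<not> ivec (m + (a - c)) \<in> cone A" using c(2)[rule_format, of "m + (a - c)"] by auto
      then obtain \<sigma> where \<sigma>: "\<sigma> \<in> facets" "Fint \<sigma> m + Fint \<sigma> (a - c) < 0"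
        unfolding in_cone_iff by (auto simp: Fint_add not_le)
      then have "0 \<le> Fint \<sigma> m" "Fint \<sigma> m < B" using B[OF \<sigma>(1)] Fint_Nspan[OF \<sigma>(1) m(1)] by auto
      then have "(\<sigma>, FC A \<sigma> (ivec m)) \<in> facets \<times> of_int ` {0..<B}"
        using \<sigma>(1) FC_ivec[OF \<sigma>(1), of m] by simp
      then have "r (ivec m) = 0" using r(3) by blast
      with m(2) show False by simp
    qed
  qed
  with r show ?thesis using that by blast
qed

text \<open>A facet is contained in no other facet, so the threshold is a condition on its own form
  only. Consequently a facet of \<open>Fminus\<close> has form values below
  \<open>M\<close>.\<close>

lemma Fplus_if_large:
  assumes M: "conducts M"
    and "\<sigma> \<in> facets" "FC A \<sigma> \<alpha> = of_int k" "M \<le> k"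
  shows "\<sigma> \<in> Fplus A \<alpha>"
proof -
  obtain z where z: "Fint \<sigma> z = k" using Fint_surj[OF assms(2)] .
  have "\<forall>\<sigma>'\<in>facets. \<sigma> \<subseteq> \<sigma>' \<longrightarrow> M \<le> Fint \<sigma>' z"
    using facet_subset_eq[OF assms(2)] z assms(4) by auto
  then obtain a y where "a \<in> Nspan A" "y \<in> Zspan (Aface A \<sigma>)" "z = a + y"
    using M facet_face[OF assms(2)] unfolding conducts_def by blast
  moreover from this have "Fint \<sigma> a = k"
    using z Fint_Zspan_face[OF assms(2) order_refl] by (simp add: Fint_add[OF assms(2)])
  ultimately show ?thesis
    using assms(2,3) FC_ivec[OF assms(2)] unfolding Fplus_def facets_def by force
qed

text \<open>Outside \<open>FaceSet\<close> the sets \<open>E_\<tau>\<close> are always empty, so the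
  failure is a missing element \<open>l\<close> for some \<tau> in \<open>FaceSet\<close>. It is
  missing throughout the class, so at each point some facet form through \<tau> is below
  \<open>M\<close>. As these facets belong to \<open>Fplus\<close>, the values are natural numbers,
  leaving finitely many hyperplanes.\<close>

lemma not_dense_if_not_extreme:
  assumes "\<not> extreme A \<alpha>"
  obtains p x where "polyfun p" "p x \<noteq> 0"
    "\<And>a. equivalent \<alpha> (\<alpha> + ivec a) \<Longrightarrow> p (\<alpha> + ivec a) = 0"
proof -
  obtain M where M: "M > 0" "conducts M" using exists_conducts .
  have empty: "Eset A \<tau> \<alpha> = {}" if "face A \<tau>" "\<tau> \<notin> FaceSet A \<alpha>" for \<tau>
  proof (rule ccontr)
    assume "Eset A \<tau> \<alpha> \<noteq> {}"
    then obtain l where "in_E \<tau> \<alpha> l" by (auto simp: Eset_eq)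
    then obtain b z where l: "l \<in> Cspan (Aface A \<tau>)" and bz: "b \<in> Nspan A" "z \<in> Zspan (Aface A \<tau>)"
        "\<alpha> - l = ivec (b + z)"
      unfolding in_E_def by blast
    have "\<sigma> \<in> Fplus A \<alpha>" if \<sigma>: "facet A \<sigma> \<and> \<tau> \<subseteq> \<sigma>" for \<sigma>
    proof -
      have "\<sigma> \<in> facets" using \<sigma> by (simp add: facets_def)
      moreover have sub: "Aface A \<tau> \<subseteq> Aface A \<sigma>" using \<sigma> by (auto simp: Aface_def)
      have "in_E \<sigma> \<alpha> l" unfolding in_E_def
        using subsetD[OF Cspan_mono[OF sub] l] subsetD[OF Zspan_mono[OF sub] bz(2)] bz(1,3) by blast
      ultimately show ?thesis unfolding Fplus_iff_in_E by blast
    qed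
    then have "\<tau> \<in> FaceSet A \<alpha>" unfolding FaceSet_def using that(1) l bz(3) by blast
    with that(2) show False by simp
  qed
  then obtain \<tau> where \<tau>: "face A \<tau>" "\<tau> \<in> FaceSet A \<alpha>" "\<not> Efull A \<tau> \<alpha>"
    using assms unfolding extreme_def by blast
  have fplus: "\<sigma> \<in> Fplus A \<alpha>" if "\<sigma> \<in> facets" "\<tau> \<subseteq> \<sigma>" for \<sigma>
    using \<tau>(2) that unfolding FaceSet_def facets_def by blast
  obtain l0 z0 where "l0 \<in> Cspan (Aface A \<tau>)" "\<alpha> - l0 = ivec z0"
    using \<tau>(2) unfolding FaceSet_def by blast
  then obtain l z where l: "l \<in> Cspan (Aface A \<tau>)" "\<alpha> - l = ivec z" "\<not> in_E \<tau> \<alpha> l"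
    using Efull_iff \<tau>(3) by blast
  obtain p x where p: "polyfun p" "p x \<noteq> 0"
      "\<forall>y. \<forall>(\<sigma>, k)\<in>facets \<times> of_int ` {0..<M}. FC A \<sigma> y = k \<longrightarrow> p y = 0"
    by (rule hyperplanes[of "facets \<times> of_int ` {0..<M}"]) (use finite_facets in auto)
  have "p (\<alpha> + ivec a) = 0" if eq: "equivalent \<alpha> (\<alpha> + ivec a)" for a
  proof -
    let ?\<beta> = "\<alpha> + ivec a"
    have \<beta>l: "?\<beta> - l = ivec (z + a)" using l(2) by (simp add: ivec_add algebra_simps)
    have "\<not> in_E \<tau> ?\<beta> l" using l(3) eq \<tau>(1) unfolding equivalent_def by blast
    then have "\<not> (\<exists>b\<in>Nspan A. \<exists>y\<in>Zspan (Aface A \<tau>). z + a = b + y)"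
      using l(1) \<beta>l unfolding in_E_def by auto
    then obtain \<sigma> where \<sigma>: "\<sigma> \<in> facets" "\<tau> \<subseteq> \<sigma>" "Fint \<sigma> (z + a) < M"
      using M(2) \<tau>(1) unfolding conducts_def by (meson not_le)
    have FC: "FC A \<sigma> ?\<beta> = of_int (Fint \<sigma> (z + a))" by (rule FC_in_E[OF \<sigma>(1,2) l(1) \<beta>l])
    have "\<sigma> \<in> Fplus A ?\<beta>" using fplus[OF \<sigma>(1,2)] equivalent_Fplus[OF eq] by simp
    then obtain n where "0 \<le> n" "FC A \<sigma> ?\<beta> = of_int n" by (rule Fplus_nonneg)
    then have "0 \<le> Fint \<sigma> (z + a)" using FC by simp
    then have "(\<sigma>, FC A \<sigma> ?\<beta>) \<in> facets \<times> of_int ` {0..<M}" using \<sigma> FC by simp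
    then show ?thesis using p(3) by blast
  qed
  with p show ?thesis using that by blast
qed

text \<open>By Gordan's theorem, an empty cone yields a nontrivial nonnegative relation between the
  forms \<open>\<plusminus>F\<^sub>\<sigma>\<close>, each of which is bounded below on the class.\<close>

lemma not_dense_if_Rpos_empty:
  assumes "Rpos A \<alpha> = {}"
  obtains p x where "polyfun p" "p x \<noteq> 0"
    "\<And>a. equivalent \<alpha> (\<alpha> + ivec a) \<Longrightarrow> p (\<alpha> + ivec a) = 0"
proof -
  obtain M where M: "M > 0" "conducts M" using exists_conducts .
  \<comment> \<open>The signs turn \<open>Rpos\<close> into the common positive half-space of all
    \<open>v\<close> in \<open>V\<close>.\<close>
  define V where "V = Fform A ` Fplus A \<alpha> \<union> (\<lambda>\<sigma>. - Fform A \<sigma>) ` Fminus A \<alpha>"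
  have fin_F: "finite (Fplus A \<alpha>)" "finite (Fminus A \<alpha>)"
    using finite_subset[OF _ finite_facets] Fplus_facets Fminus_facets by blast+
  then have V: "finite V" unfolding V_def by simp
  have "0 \<in> convex hull V"
  proof (rule ccontr)
    assume "0 \<notin> convex hull V"
    moreover have "closed (convex hull V)"
      using finite_imp_compact_convex_hull[OF V] compact_imp_closed by blast
    ultimately obtain g b where "0 < b" "\<forall>x\<in>convex hull V. inner g x > b"
      using separating_hyperplane_closed_0[OF convex_convex_hull] by blast
    then have "\<forall>v\<in>V. inner v g > 0" by (metis hull_inc inner_commute order_less_trans)
    then have "\<forall>\<sigma>\<in>Fplus A \<alpha>. inner (Fform A \<sigma>) g > 0" "\<forall>\<sigma>\<in>Fminus A \<alpha>. inner (- Fform A \<sigma>) g > 0"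
      unfolding V_def by blast+
    then have "g \<in> Rpos A \<alpha>" unfolding Rpos_def by simp
    with assms show False by simp
  qed
  then obtain u where u: "\<forall>v\<in>V. 0 \<le> u v" "sum u V = 1" "(\<Sum>v\<in>V. u v *\<^sub>R v) = 0"
    unfolding convex_hull_finite[OF V] by blast
  have "\<exists>v0\<in>V. u v0 \<noteq> 0"
  proof (rule ccontr)
    assume "\<not> (\<exists>v0\<in>V. u v0 \<noteq> 0)"
    then have "sum u V = 0" by (intro sum.neutral) auto
    with u(2) show False by simp
  qed
  then obtain v0 where v0: "v0 \<in> V" "u v0 > 0" using u(1) by (metis order_less_le)
  have "\<exists>n. FC A \<sigma> \<alpha> = of_int n" if "\<sigma> \<in> Fplus A \<alpha> \<union> Fminus A \<alpha>" for \<sigma>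
    using that Fplus_nonneg[of \<sigma> \<alpha>] by (auto simp: Fminus_iff elim!: Ints_cases)
  then obtain n where n: "\<And>\<sigma>. \<sigma> \<in> Fplus A \<alpha> \<union> Fminus A \<alpha> \<Longrightarrow> FC A \<sigma> \<alpha> = of_int (n \<sigma>)" by metis
  \<comment> \<open>On the class, plus forms are nonnegative and minus forms are below
    \<open>M\<close>; subtracting the values at \<alpha> bounds every signed form of the
    displacement \<open>a\<close> below by \<open>-L\<close>.\<close>
  define L where "L = M + (\<Sum>\<sigma>\<in>Fplus A \<alpha> \<union> Fminus A \<alpha>. \<bar>n \<sigma>\<bar>)"
  have L: "M + \<bar>n \<sigma>\<bar> \<le> L" if "\<sigma> \<in> Fplus A \<alpha> \<union> Fminus A \<alpha>" for \<sigma>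
    using member_le_sum[OF that, of "\<lambda>\<sigma>. \<bar>n \<sigma>\<bar>"] fin_F by (simp add: L_def)
  have lower: "inner v (ivec a) \<ge> - real_of_int L"
    if v: "v \<in> V" and eq: "equivalent \<alpha> (\<alpha> + ivec a)" for v a
  proof -
    from v consider \<sigma> where "\<sigma> \<in> Fplus A \<alpha>" "v = Fform A \<sigma>" | \<sigma> where "\<sigma> \<in> Fminus A \<alpha>" "v = - Fform A \<sigma>"
      unfolding V_def by blast
    then show ?thesis
    proof cases
      case (1 \<sigma>)
      have \<sigma>: "\<sigma> \<in> facets" by (rule Fplus_facets[OF 1(1)])
      have "\<sigma> \<in> Fplus A (\<alpha> + ivec a)" using equivalent_Fplus[OF eq] 1(1) by simp
      then obtain m where "0 \<le> m" "FC A \<sigma> (\<alpha> + ivec a) = of_int m" by (rule Fplus_nonneg)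
      then have "complex_of_int (n \<sigma> + Fint \<sigma> a) = of_int m"
        using n[of \<sigma>] 1(1) FC_ivec[OF \<sigma>] by (simp add: FC_add)
      then have "n \<sigma> + Fint \<sigma> a = m" by (simp only: of_int_eq_iff)
      then have "Fint \<sigma> a \<ge> - L" using \<open>0 \<le> m\<close> L[of \<sigma>] 1(1) M(1) by auto
      then show ?thesis unfolding 1(2) of_int_Fint[OF \<sigma>, symmetric] by linarith
    next
      case (2 \<sigma>)
      have \<sigma>: "\<sigma> \<in> facets" by (rule Fminus_facets[OF 2(1)])
      have "FC A \<sigma> (\<alpha> + ivec a) = of_int (n \<sigma> + Fint \<sigma> a)"
        using n[of \<sigma>] 2(1) FC_ivec[OF \<sigma>] by (simp add: FC_add)
      moreover have "\<sigma> \<notin> Fplus A (\<alpha> + ivec a)"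
        using equivalent_Fplus[OF eq] 2(1) by (simp add: Fminus_iff)
      ultimately have "n \<sigma> + Fint \<sigma> a < M" using Fplus_if_large[OF M(2) \<sigma>] by (meson not_le)
      then have "- Fint \<sigma> a \<ge> - L" using L[of \<sigma>] 2(1) by auto
      then show ?thesis unfolding 2(2) inner_minus_left of_int_Fint[OF \<sigma>, symmetric] by linarith
    qed
  qed
  obtain \<sigma>0 where \<sigma>0: "\<sigma>0 \<in> facets" "v0 = Fform A \<sigma>0 \<or> v0 = - Fform A \<sigma>0"
    using v0(1) Fplus_facets Fminus_facets unfolding V_def by blast
  \<comment> \<open>In the relation the terms other than \<open>v0\<close> contribute at least
    \<open>-L\<close>, so \<open>v0\<close> is at most \<open>L / u v0\<close>; from below it is
    bounded by \<open>-L\<close>.\<close>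
  define K where "K = max L \<lceil>L / u v0\<rceil>"
  have bound: "\<bar>Fint \<sigma>0 a\<bar> \<le> K" if eq: "equivalent \<alpha> (\<alpha> + ivec a)" for a
  proof -
    have "0 = inner (\<Sum>v\<in>V. u v *\<^sub>R v) (ivec a)" using u(3) by simp
    also have "\<dots> = (\<Sum>v\<in>V. u v * inner v (ivec a))" by (simp add: inner_sum_left)
    also have "\<dots> = u v0 * inner v0 (ivec a) + (\<Sum>v\<in>V - {v0}. u v * inner v (ivec a))"
      by (rule sum.remove[OF V v0(1)])
    also have "(\<Sum>v\<in>V - {v0}. u v * inner v (ivec a)) \<ge> (\<Sum>v\<in>V - {v0}. u v * - real_of_int L)"
      using lower[OF _ eq] u(1) by (intro sum_mono mult_left_mono) auto
    moreover have "(\<Sum>v\<in>V - {v0}. u v * - real_of_int L) \<ge> - real_of_int L"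
    proof -
      have "(\<Sum>v\<in>V - {v0}. u v) \<le> 1" using u(1,2) V v0 by (simp add: sum_diff1)
      moreover have "0 \<le> real_of_int L" using L_def M(1) by (simp add: sum_nonneg)
      ultimately have "(\<Sum>v\<in>V - {v0}. u v) * real_of_int L \<le> 1 * real_of_int L" by (rule mult_right_mono)
      then show ?thesis by (simp add: sum_negf sum_distrib_right)
    qed
    ultimately have "u v0 * inner v0 (ivec a) \<le> L" by linarith
    then have "inner v0 (ivec a) \<le> L / u v0" using v0(2) by (simp add: field_simps)
    moreover have "L / u v0 \<le> K" "real_of_int L \<le> K" unfolding K_def by (simp_all add: le_max_iff_disj) linarith
    ultimately have "\<bar>inner v0 (ivec a)\<bar> \<le> K" using lower[OF v0(1) eq] by linarith
    then have "\<bar>real_of_int (Fint \<sigma>0 a)\<bar> \<le> K"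
      using \<sigma>0(2) by (auto simp: of_int_Fint[OF \<sigma>0(1)])
    then show ?thesis by linarith
  qed
  let ?H = "{\<sigma>0} \<times> (\<lambda>k. FC A \<sigma>0 \<alpha> + of_int k) ` {-K..K}"
  obtain p x where p: "polyfun p" "p x \<noteq> 0"
      "\<forall>y. \<forall>(\<sigma>, k)\<in>?H. FC A \<sigma> y = k \<longrightarrow> p y = 0"
    by (rule hyperplanes[of ?H]) (use \<sigma>0(1) in auto)
  have "p (\<alpha> + ivec a) = 0" if eq: "equivalent \<alpha> (\<alpha> + ivec a)" for a
  proof -
    have "(\<sigma>0, FC A \<sigma>0 (\<alpha> + ivec a)) \<in> ?H"
      using bound[OF eq] by (intro SigmaI image_eqI[of _ _ "Fint \<sigma>0 a"])
        (auto simp: FC_add FC_ivec[OF \<sigma>0(1)] abs_le_iff)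
    then show ?thesis using p(3) by blast
  qed
  with p show ?thesis using that by blast
qed

text \<open>For \<tau> in \<open>FaceSet\<close> both \<open>E\<close>-sets are full: at \<alpha> by
  extremality, at \<open>\<alpha> + a\<close> by the threshold. For any other \<tau>, an element at
  \<open>\<alpha> + a\<close> would make the forms through \<tau> integral at \<alpha>, so one of
  them belongs to \<open>Fminus\<close>; but its value at \<open>\<alpha> + a\<close> is
  negative.\<close>

lemma equivalent_if_deep:
  assumes M: "conducts M"
    and ext: "extreme A \<alpha>"
    and plus: "\<forall>\<sigma>\<in>Fplus A \<alpha>. M \<le> Fint \<sigma> a"
    and minus: "\<forall>\<sigma>\<in>Fminus A \<alpha>. \<forall>n. FC A \<sigma> \<alpha> = of_int n \<longrightarrow> n + Fint \<sigma> a < 0"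
  shows "equivalent \<alpha> (\<alpha> + ivec a)"
  unfolding equivalent_def
proof (intro allI impI)
  fix \<tau> l assume \<tau>: "face A \<tau>"
  let ?\<beta> = "\<alpha> + ivec a"
  show "in_E \<tau> \<alpha> l \<longleftrightarrow> in_E \<tau> ?\<beta> l"
  proof (cases "\<tau> \<in> FaceSet A \<alpha>")
    case True
    have fplus: "\<sigma> \<in> Fplus A \<alpha>" if "\<sigma> \<in> facets" "\<tau> \<subseteq> \<sigma>" for \<sigma>
      using True that unfolding FaceSet_def facets_def by blast
    obtain l0 z0 where "l0 \<in> Cspan (Aface A \<tau>)" "\<alpha> - l0 = ivec z0"
      using True unfolding FaceSet_def by blast
    then have 1: "in_E \<tau> \<alpha> l" if "l \<in> Cspan (Aface A \<tau>)" "\<alpha> - l = ivec z" for z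
      using Efull_iff ext \<tau> True that unfolding extreme_def by blast
    have 2: "in_E \<tau> ?\<beta> l" if l: "l \<in> Cspan (Aface A \<tau>)" "\<alpha> - l = ivec z" for z
    proof -
      have "M \<le> Fint \<sigma> (z + a)" if \<sigma>: "\<sigma> \<in> facets" "\<tau> \<subseteq> \<sigma>" for \<sigma>
      proof -
        obtain n where "0 \<le> n" "FC A \<sigma> \<alpha> = of_int n" using Fplus_nonneg[OF fplus[OF \<sigma>]] .
        then have "0 \<le> Fint \<sigma> z" using FC_in_E[OF \<sigma> l] by simp
        then show ?thesis using plus fplus[OF \<sigma>] \<sigma>(1) by (fastforce simp: Fint_add)
      qed
      then obtain b y where "b \<in> Nspan A" "y \<in> Zspan (Aface A \<tau>)" "z + a = b + y"
        using M \<tau> unfolding conducts_def by blast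
      moreover have "?\<beta> - l = ivec (z + a)" using l(2) by (simp add: ivec_add algebra_simps)
      ultimately show ?thesis unfolding in_E_def using l(1) by auto
    qed
    show ?thesis
    proof
      assume "in_E \<tau> \<alpha> l"
      then show "in_E \<tau> ?\<beta> l" using 2 unfolding in_E_def[of \<tau> \<alpha>] by blast
    next
      assume "in_E \<tau> ?\<beta> l"
      then obtain b y where "l \<in> Cspan (Aface A \<tau>)" "?\<beta> - l = ivec (b + y)" unfolding in_E_def by blast
      moreover from this have "\<alpha> - l = ivec (b + y - a)" by (simp add: ivec_diff algebra_simps)
      ultimately show "in_E \<tau> \<alpha> l" using 1 by blast
    qed
  next
    case False
    have "\<not> in_E \<tau> \<alpha> l" using ext \<tau> False coset_in_Eset_iff[of \<tau> l \<alpha>] unfolding extreme_def by auto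
    moreover have "\<not> in_E \<tau> ?\<beta> l"
    proof
      assume "in_E \<tau> ?\<beta> l"
      then obtain b y where l: "l \<in> Cspan (Aface A \<tau>)" and hb: "b \<in> Nspan A" "y \<in> Zspan (Aface A \<tau>)"
          "?\<beta> - l = ivec (b + y)" unfolding in_E_def by blast
      have \<alpha>l: "\<alpha> - l = ivec (b + y - a)" using hb(3) by (simp add: ivec_diff algebra_simps)
      then obtain \<sigma> where \<sigma>: "\<sigma> \<in> facets" "\<tau> \<subseteq> \<sigma>" "\<sigma> \<notin> Fplus A \<alpha>"
        using False \<tau> l unfolding FaceSet_def facets_def by blast
      have FC: "FC A \<sigma> \<alpha> = of_int (Fint \<sigma> (b + y - a))" by (rule FC_in_E[OF \<sigma>(1,2) l \<alpha>l])
      then have "\<sigma> \<in> Fminus A \<alpha>" using \<sigma> by (simp add: Fminus_iff)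
      with minus FC have "Fint \<sigma> (b + y - a) + Fint \<sigma> a < 0" by blast
      then have "Fint \<sigma> b < 0"
        using Fint_Zspan_face[OF \<sigma>(1,2) hb(2)] by (simp add: Fint_add[OF \<sigma>(1)] Fint_diff[OF \<sigma>(1)])
      with Fint_Nspan[OF \<sigma>(1) hb(1)] show False by simp
    qed
    ultimately show ?thesis by simp
  qed
qed

text \<open>Rounding \<open>k \<gamma>\<close> changes each form by an amount that does not depend
  on \<open>k\<close>, while its value grows linearly. Hence all finitely many strict inequalities
  hold for large \<open>k\<close>.\<close>

lemma Rpos_lattice_point:
  assumes "Rpos A \<alpha> \<noteq> {}"
  obtains g where "\<forall>\<sigma>\<in>Fplus A \<alpha>. 1 \<le> Fint \<sigma> g" "\<forall>\<sigma>\<in>Fminus A \<alpha>. Fint \<sigma> g \<le> -1"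
proof -
  obtain \<gamma> where \<gamma>: "\<gamma> \<in> Rpos A \<alpha>" using assms by blast
  define g where "g k = (\<chi> i. \<lfloor>real k * \<gamma> $ i\<rfloor>)" for k :: nat
  have close: "\<bar>inner w (ivec (g k)) - real k * inner w \<gamma>\<bar> \<le> (\<Sum>i\<in>UNIV. \<bar>w $ i\<bar>)" for w :: "real^'n" and k
  proof -
    have "inner w (ivec (g k)) - real k * inner w \<gamma> =
        (\<Sum>i\<in>UNIV. w $ i * (of_int \<lfloor>real k * \<gamma> $ i\<rfloor> - real k * \<gamma> $ i))"
      by (simp add: inner_vec_def g_def right_diff_distrib sum_subtractf sum_distrib_left mult.left_commute)
    then have "\<bar>inner w (ivec (g k)) - real k * inner w \<gamma>\<bar> \<le>
        (\<Sum>i\<in>UNIV. \<bar>w $ i\<bar> * \<bar>of_int \<lfloor>real k * \<gamma> $ i\<rfloor> - real k * \<gamma> $ i\<bar>)"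
      by (simp only: abs_sum_mult_le)
    also have "\<dots> \<le> (\<Sum>i\<in>UNIV. \<bar>w $ i\<bar> * 1)"
      by (intro sum_mono mult_left_mono) (auto simp: abs_le_iff, linarith+)
    finally show ?thesis by simp
  qed
  have pos: "\<forall>\<^sub>F k in sequentially. inner w (ivec (g k)) > 0" if w: "inner w \<gamma> > 0" for w
  proof -
    obtain K :: nat where K: "(\<Sum>i\<in>UNIV. \<bar>w $ i\<bar>) < real K * inner w \<gamma>"
      using w reals_Archimedean3 by blast
    have "inner w (ivec (g k)) > 0" if "k \<ge> K" for k
    proof -
      have "real K * inner w \<gamma> \<le> real k * inner w \<gamma>" using w that by (intro mult_right_mono) auto
      then show ?thesis using close[of w k] K by linarith
    qed
    then show ?thesis unfolding eventually_sequentially by blast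
  qed
  have fin_F: "finite (Fplus A \<alpha>)" "finite (Fminus A \<alpha>)"
    using finite_subset[OF _ finite_facets] Fplus_facets Fminus_facets by blast+
  have "\<forall>\<^sub>F k in sequentially. (\<forall>\<sigma>\<in>Fplus A \<alpha>. inner (Fform A \<sigma>) (ivec (g k)) > 0) \<and>
      (\<forall>\<sigma>\<in>Fminus A \<alpha>. inner (- Fform A \<sigma>) (ivec (g k)) > 0)"
    using \<gamma> unfolding Rpos_def
    by (intro eventually_conj eventually_ball_finite fin_F ballI pos) auto
  then obtain k where k: "\<forall>\<sigma>\<in>Fplus A \<alpha>. inner (Fform A \<sigma>) (ivec (g k)) > 0"
      "\<forall>\<sigma>\<in>Fminus A \<alpha>. inner (Fform A \<sigma>) (ivec (g k)) < 0"
    unfolding eventually_sequentially by auto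
  show ?thesis
  proof (rule that[of "g k"])
    show "\<forall>\<sigma>\<in>Fplus A \<alpha>. 1 \<le> Fint \<sigma> (g k)"
    proof
      fix \<sigma> assume \<sigma>: "\<sigma> \<in> Fplus A \<alpha>"
      then have "0 < real_of_int (Fint \<sigma> (g k))" using k(1) of_int_Fint[OF Fplus_facets[OF \<sigma>]] by simp
      then show "1 \<le> Fint \<sigma> (g k)" by simp
    qed
    show "\<forall>\<sigma>\<in>Fminus A \<alpha>. Fint \<sigma> (g k) \<le> -1"
    proof
      fix \<sigma> assume \<sigma>: "\<sigma> \<in> Fminus A \<alpha>"
      then have "real_of_int (Fint \<sigma> (g k)) < 0" using k(2) of_int_Fint[OF Fminus_facets[OF \<sigma>]] by simp
      then show "Fint \<sigma> (g k) \<le> -1" by simp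
    qed
  qed
qed

lemma Cspan_UNIV: "Cspan A = UNIV"
proof -
  have "l \<in> Cspan A" for l
  proof (rule ccontr)
    assume "l \<notin> Cspan A"
    then obtain w where w: "pairing w l \<noteq> 0" "\<forall>s\<in>A. pairing w (ivec s) = 0"
      using Cspan_separate[OF fin] by blast
    have "w $ i = 0" for i
    proof -
      have axis: "ivec (axis i 1) \<in> Cspan A" using ivec_Zspan_in_Cspan[of "axis i 1" A] gen by simp
      have "pairing w (ivec (axis i 1)) = 0" by (rule pairing_Cspan[OF fin _ axis]) (use w(2) in blast)
      then show ?thesis
        by (simp add: pairing_def axis_def if_distrib[of "\<lambda>x. _ * x"] if_distrib[of of_int] cong: if_cong)
    qed
    with w(1) show False by (simp add: pairing_def)
  qed
  then show ?thesis by blast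
qed

text \<open>From every point of \<open>\<alpha> + \<int>^d\<close> the ray in direction
  \<open>g\<close> eventually stays in the class. Hence \<open>p\<close> vanishes on
  \<open>\<alpha> + \<int>^d\<close>, and freeing the coefficients extends this to all of
  \<complex>^d.\<close>

lemma dense_if_extreme:
  assumes "extreme A \<alpha>" "Rpos A \<alpha> \<noteq> {}" "polyfun p"
    and vanish: "\<And>a. equivalent \<alpha> (\<alpha> + ivec a) \<Longrightarrow> p (\<alpha> + ivec a) = 0"
  shows "p x = 0"
proof -
  obtain M where M: "M > 0" "conducts M" using exists_conducts .
  obtain g where g: "\<forall>\<sigma>\<in>Fplus A \<alpha>. 1 \<le> Fint \<sigma> g" "\<forall>\<sigma>\<in>Fminus A \<alpha>. Fint \<sigma> g \<le> -1"
    using Rpos_lattice_point[OF assms(2)] .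
  \<comment> \<open>A total function is convenient for the sum below; its value is meaningful only
    where the form is integral at \<alpha>.\<close>
  define n where "n \<sigma> = (SOME n. FC A \<sigma> \<alpha> = of_int n)" for \<sigma>
  have n: "n \<sigma> = m" if "FC A \<sigma> \<alpha> = of_int m" for \<sigma> m
    unfolding n_def using that by (intro some_equality) auto
  have "p (\<alpha> + ivec z) = 0" for z
  proof -
    \<comment> \<open>Since \<open>g\<close> changes each relevant form by at least 1 in the right
      direction, \<open>K\<close> steps outweigh \<open>z\<close>, the value at \<alpha> and the
      threshold.\<close>
    define K where "K = nat (M + (\<Sum>\<sigma>\<in>facets. \<bar>Fint \<sigma> z\<bar> + \<bar>n \<sigma>\<bar>))"
    have K: "M + \<bar>Fint \<sigma> z\<bar> + \<bar>n \<sigma>\<bar> \<le> int K" if "\<sigma> \<in> facets" for \<sigma>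
      using member_le_sum[OF that, of "\<lambda>\<sigma>. \<bar>Fint \<sigma> z\<bar> + \<bar>n \<sigma>\<bar>"] finite_facets by (simp add: K_def)
    have "p ((\<alpha> + ivec z) + of_nat k *s ivec g) = 0" if k: "k \<ge> K" for k
    proof -
      let ?a = "z + of_nat k *s g"
      have "equivalent \<alpha> (\<alpha> + ivec ?a)"
      proof (rule equivalent_if_deep[OF M(2) assms(1)])
        show "\<forall>\<sigma>\<in>Fplus A \<alpha>. M \<le> Fint \<sigma> ?a"
        proof
          fix \<sigma> assume \<sigma>: "\<sigma> \<in> Fplus A \<alpha>"
          then have "int k * 1 \<le> int k * Fint \<sigma> g" using g(1) by (intro mult_left_mono) auto
          then show "M \<le> Fint \<sigma> ?a"
            using K[OF Fplus_facets[OF \<sigma>]] k Fplus_facets[OF \<sigma>] by (simp add: Fint_add Fint_scale)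
        qed
        show "\<forall>\<sigma>\<in>Fminus A \<alpha>. \<forall>m. FC A \<sigma> \<alpha> = of_int m \<longrightarrow> m + Fint \<sigma> ?a < 0"
        proof (intro ballI allI impI)
          fix \<sigma> m assume \<sigma>: "\<sigma> \<in> Fminus A \<alpha>" and m: "FC A \<sigma> \<alpha> = of_int m"
          have "int k * Fint \<sigma> g \<le> int k * (-1)" using g(2) \<sigma> by (intro mult_left_mono) auto
          then show "m + Fint \<sigma> ?a < 0"
            using K[OF Fminus_facets[OF \<sigma>]] k Fminus_facets[OF \<sigma>] n[OF m] M(1)
            by (simp add: Fint_add Fint_scale)
        qed
      qed
      then have "p (\<alpha> + ivec ?a) = 0" by (rule vanish)
      then show ?thesis by (simp add: ivec_add ivec_scale add.assoc)
    qed
    from polyfun_line_zero[OF assms(3) this, of K 0] show ?thesis by simp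
  qed
  then have "p (\<alpha> + (x - \<alpha>)) = 0"
    using polyfun_zero_on_Cspan[OF assms(3) fin, of \<alpha> "x - \<alpha>"] Cspan_UNIV by blast
  then show ?thesis by simp
qed

end

theorem theorem8p20:
  fixes A :: "(int^'n) set" and \<alpha> :: "complex^'n"
    and act :: "'n op \<Rightarrow> 'b::ab_group_add \<Rightarrow> 'b"
  assumes "finite A" and "Zspan A = UNIV"
    and "is_L A \<alpha> act"
  shows "Ann A act = {\<lambda>f z. 0} \<longleftrightarrow> extreme A \<alpha> \<and> Rpos A \<alpha> \<noteq> {}"
proof -
  interpret affine_monoid A using assms by unfold_locales
  interpret D_module A act using assms(3) by unfold_locales (simp add: is_L_def)
  have simple: "dsimple A act" using assms(3) by (simp add: is_L_def)
  obtain v where v: "v \<noteq> 0" "weight_vec \<alpha> v"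
    using assms(3) unfolding is_L_def weight_vec_def by blast
  show ?thesis
  proof
    assume Ann: "Ann A act = {\<lambda>f z. 0}"
    show "extreme A \<alpha> \<and> Rpos A \<alpha> \<noteq> {}"
    proof (rule ccontr)
      assume "\<not> (extreme A \<alpha> \<and> Rpos A \<alpha> \<noteq> {})"
      then obtain p x where p: "polyfun p" "p x \<noteq> 0"
          "\<forall>a. equivalent \<alpha> (\<alpha> + ivec a) \<longrightarrow> p (\<alpha> + ivec a) = 0"
        using not_dense_if_not_extreme[of \<alpha>] not_dense_if_Rpos_empty[of \<alpha>] by metis
      have "shift_op 0 p \<in> Ann A act"
        using p(3) by (intro Ann_nonzero[OF simple v(2,1) p(1,2)]) (auto simp: equivalent_iff_reach)
      with Ann have zero: "shift_op 0 p = (\<lambda>f z. 0)" by simp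
      have "p (0 + ivec z) = 0" for z
      proof -
        \<comment> \<open>Operators are defined on all functions, so the constant function 1,
          although not finitely supported, reads off \<open>p\<close> at every integer
          vector.\<close>
        have "shift_op 0 p (\<lambda>_. 1) z = 0" unfolding zero by simp
        then show ?thesis by (simp add: shift_op_def)
      qed
      then have "p (0 + x) = 0"
        using polyfun_zero_on_Cspan[OF p(1) fin, of 0 x] Cspan_UNIV by blast
      with p(2) show False by simp
    qed
  next
    assume ext: "extreme A \<alpha> \<and> Rpos A \<alpha> \<noteq> {}"
    show "Ann A act = {\<lambda>f z. 0}"
    proof (rule Ann_zero[OF v(2,1), of "{a. equivalent \<alpha> (\<alpha> + ivec a)}"])
      show "reach A \<alpha> a \<and> reach A (\<alpha> + ivec a) (- a)" if "a \<in> {a. equivalent \<alpha> (\<alpha> + ivec a)}" for a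
        using that by (simp add: equivalent_iff_reach)
      show "p x = 0" if "polyfun p" "\<And>a. a \<in> {a. equivalent \<alpha> (\<alpha> + ivec a)} \<Longrightarrow> p (\<alpha> + ivec a) = 0" for p x
        using dense_if_extreme[of \<alpha> p x] ext that by auto
      show "\<exists>r y. polyfun r \<and> shift_op a r \<in> DA A \<and> r y \<noteq> 0" for a
        using exists_operator by metis
    qed
  qed
qed

end
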